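(* The following decision problem, \textsc{ThinTreeValid}, is $\mathsf{coNP}$-complete. Instance: a graph $G$, a spanning tree $T$ of $G$, and a value $\alpha \in [0,1]$. Output: YES if $T$ is $\alpha$-thin, i.e. if for every set $A \subseteq V(G)$ with $\emptyset \neq A \neq V(G)$ we have $|\delta_T(A)|/|\delta_G(A)| \le \alpha$; and NO otherwise.
   Context: Graphs are undirected and unweighted. For a subgraph $S$ of $G$ and $A \subseteq V(G)$, $\delta_S(A)$ denotes the set of edges of $S$ with exactly one endpoint in $A$. A subgraph $S$ of $G$ is called $\alpha$-thin if for every cut $(A, V(G)\setminus A)$ of $G$, $|\delta_S(A)|/|\delta_G(A)| \le \alpha$. *)

theory Defs
  imports Complex_Main "HOL-Computational_Algebra.Polynomial"
begin

section \<open>Deterministic multi-tape Turing machines\<close>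

text \<open>
  States and tape symbols are initial segments of the natural numbers. The start state is 0.
  Symbol 0 is the blank; 1 and 2 are the input/output symbols for the bits False and True.
  Tapes are two-way infinite. Tape 0 is the input tape and the last tape is the output tape.
  The transition function maps a state and the list of scanned symbols to a new state and, for
  every tape, a symbol to write and a head move.
\<close>

datatype move = Left | Stay | Right

fun shift :: "move \<Rightarrow> int" where
  "shift Left = -1"
| "shift Stay = 0"
| "shift Right = 1"

record tm =
  tapes :: nat
  symbols :: nat
  states :: nat
  halt :: nat
  trans :: "nat \<Rightarrow> nat list \<Rightarrow> nat \<times> (nat \<times> move) list"

definition turing_machine :: "tm \<Rightarrow> bool" where
  "turing_machine M \<longleftrightarrow>
     1 \<le> tapes M \<and> 3 \<le> symbols M \<and> 0 < states M \<and> halt M < states M \<and>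
     (\<forall>q ss. q < states M \<and> length ss = tapes M \<and> (\<forall>s\<in>set ss. s < symbols M) \<longrightarrow>
        fst (trans M q ss) < states M \<and>
        length (snd (trans M q ss)) = tapes M \<and>
        (\<forall>(s, d)\<in>set (snd (trans M q ss)). s < symbols M))"

text \<open>A tape is a pair of its contents and its head position.\<close>

type_synonym tape = "(int \<Rightarrow> nat) \<times> int"
type_synonym config = "nat \<times> tape list"

fun scanned :: "tape \<Rightarrow> nat" where
  "scanned (f, i) = f i"

fun act :: "nat \<times> move \<Rightarrow> tape \<Rightarrow> tape" where
  "act (s, d) (f, i) = (f(i := s), i + shift d)"

fun step :: "tm \<Rightarrow> config \<Rightarrow> config" where
  "step M (q, ts) =
     (if q = halt M then (q, ts)
      else let (q', acts) = trans M q (map scanned ts) in (q', map2 act acts ts))"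

definition contents :: "bool list \<Rightarrow> int \<Rightarrow> nat" where
  "contents x i =
     (if 0 \<le> i \<and> i < int (length x) then (if x ! nat i then 2 else 1) else 0)"

definition start :: "tm \<Rightarrow> bool list \<Rightarrow> config" where
  "start M x = (0, (contents x, 0) # replicate (tapes M - 1) (contents [], 0))"

text \<open>
  As halted configurations are fixed by \<^const>\<open>step\<close>, being halted after t steps means having
  halted within t steps.
\<close>

definition outputs_within :: "tm \<Rightarrow> bool list \<Rightarrow> nat \<Rightarrow> bool list \<Rightarrow> bool" where
  "outputs_within M x t y \<longleftrightarrow>
     (let (q, ts) = (step M ^^ t) (start M x) in q = halt M \<and> fst (last ts) = contents y)"

section \<open>Polynomial time, NP and coNP\<close>

type_synonym language = "bool list set"

definition polytime_computable :: "(bool list \<Rightarrow> bool list) \<Rightarrow> bool" where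
  "polytime_computable f \<longleftrightarrow>
     (\<exists>M (p :: nat poly). turing_machine M \<and>
        (\<forall>x. outputs_within M x (poly p (length x)) (f x)))"

definition PTIME :: "language set" where
  "PTIME = {L. polytime_computable (\<lambda>x. [x \<in> L])}"

text \<open>A self-delimiting code: every bit is preceded by True, and False marks the end.\<close>

definition delimit :: "bool list \<Rightarrow> bool list" where
  "delimit x = concat (map (\<lambda>b. [True, b]) x) @ [False]"

definition pair :: "bool list \<Rightarrow> bool list \<Rightarrow> bool list" where
  "pair x y = delimit x @ y"

definition NP :: "language set" where
  "NP = {L. \<exists>R\<in>PTIME. \<exists>p :: nat poly.
           \<forall>x. x \<in> L \<longleftrightarrow> (\<exists>y. length y \<le> poly p (length x) \<and> pair x y \<in> R)}"

definition coNP :: "language set" where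
  "coNP = {L. - L \<in> NP}"

definition polytime_reducible :: "language \<Rightarrow> language \<Rightarrow> bool" where
  "polytime_reducible L K \<longleftrightarrow>
     (\<exists>f. polytime_computable f \<and> (\<forall>x. x \<in> L \<longleftrightarrow> f x \<in> K))"

definition coNP_complete :: "language \<Rightarrow> bool" where
  "coNP_complete K \<longleftrightarrow> K \<in> coNP \<and> (\<forall>L\<in>coNP. polytime_reducible L K)"

section \<open>Graphs, spanning trees and thinness\<close>

definition simple_graph :: "'a set \<Rightarrow> 'a set set \<Rightarrow> bool" where
  "simple_graph V E \<longleftrightarrow> finite V \<and> V \<noteq> {} \<and> (\<forall>e\<in>E. e \<subseteq> V \<and> card e = 2)"

definition connected_graph :: "'a set \<Rightarrow> 'a set set \<Rightarrow> bool" where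
  "connected_graph V E \<longleftrightarrow> (\<forall>u\<in>V. \<forall>v\<in>V. (\<lambda>x y. {x, y} \<in> E)\<^sup>*\<^sup>* u v)"

definition graph_cycle :: "'a set set \<Rightarrow> 'a list \<Rightarrow> bool" where
  "graph_cycle E c \<longleftrightarrow> 3 \<le> length c \<and> distinct c \<and>
     (\<forall>i<length c. {c ! i, c ! (Suc i mod length c)} \<in> E)"

definition spanning_tree :: "'a set \<Rightarrow> 'a set set \<Rightarrow> 'a set set \<Rightarrow> bool" where
  "spanning_tree V E T \<longleftrightarrow> T \<subseteq> E \<and> connected_graph V T \<and> (\<nexists>c. graph_cycle T c)"

definition cut_edges :: "'a set set \<Rightarrow> 'a set \<Rightarrow> 'a set set" where
  "cut_edges S A = {e\<in>S. card (e \<inter> A) = 1}"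

definition thin :: "'a set \<Rightarrow> 'a set set \<Rightarrow> 'a set set \<Rightarrow> real \<Rightarrow> bool" where
  "thin V E S \<alpha> \<longleftrightarrow>
     (\<forall>A. A \<subseteq> V \<and> A \<noteq> {} \<and> A \<noteq> V \<longrightarrow>
        real (card (cut_edges S A)) / real (card (cut_edges E A)) \<le> \<alpha>)"

section \<open>The problem ThinTreeValid\<close>

text \<open>
  Instances are graphs on the vertex set \<open>{..<n}\<close>; the graph and the tree are given by
  adjacency matrices, and \<open>\<alpha> = a / b\<close> by numerator and denominator in binary (least significant
  bit first). The fraction need not be in lowest terms.
\<close>

fun binary :: "nat \<Rightarrow> bool list" where
  "binary k = (if k = 0 then [] else odd k # binary (k div 2))"

declare binary.simps [simp del]

definition adjacency_matrix :: "nat \<Rightarrow> nat set set \<Rightarrow> bool list" where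
  "adjacency_matrix n E = concat (map (\<lambda>u. map (\<lambda>v. {u, v} \<in> E) [0..<n]) [0..<n])"

definition encode_instance ::
  "nat \<Rightarrow> nat set set \<Rightarrow> nat set set \<Rightarrow> nat \<Rightarrow> nat \<Rightarrow> bool list" where
  "encode_instance n E T a b =
     replicate n True @ [False] @ adjacency_matrix n E @ adjacency_matrix n T @
     delimit (binary a) @ delimit (binary b)"

text \<open>Bit strings that do not encode an instance are not in the language.\<close>

definition ThinTreeValid :: language where
  "ThinTreeValid =
     {encode_instance n E T a b | n E T a b.
        simple_graph {..<n} E \<and> spanning_tree {..<n} E T \<and>
        0 < b \<and> real a / real b \<in> {0..1} \<and>
        thin {..<n} E T (real a / real b)}"

end

theory Submission
  imports Defs "HOL-Library.Countable"
begin

text \<open>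
  Both polynomial-time claims are about programs over counters that hold numbers in unary, with a
  read-only input and a write-only output. Such a program becomes a Turing machine whose states are
  the continuations of the program and whose work tapes are blank except for a mark, a counter being
  a head position. The functions that these programs compute in polynomial time are closed under
  arithmetic, bounded sums and quantifiers, and polynomially bounded recursion, which is all that is
  needed below.

  Membership: a set of vertices certifies that a tree is not valid, since it witnesses
  disconnectedness (no tree edge leaves it), a cycle (each of its vertices has two neighbours in it)
  or a thick cut. The fractions are compared bit by bit, with carries that stay small.

  Hardness: a run of the verifier is a choice of one tile for every time, tape and position, without
  conflicts; so an input has a certificate iff a conflict graph has an independent set with one
  vertex per group. For \<open>\<alpha> = 1/2\<close> a cut violates thinness iff it contains more tree
  than non-tree edges. Cliques of non-tree edges (blobs) stay together in an optimal cut, so their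
  sides are Boolean variables. The tree is a comb: its teeth join each blob to a partner blob that
  represents the negated variable, and its spine is neutralised by additional non-tree edges. Blob 0
  and its partner represent false and true. Non-tree edges between blobs penalise the choice of two
  conflicting vertices, and those between blob 0 and its partner set the threshold.
\<close>

section \<open>Counter programs and their compilation to Turing machines\<close>

text \<open>For \<alpha> = 1/2 a cut is too thick iff it has positive value when tree edges weigh 1
  and all other edges -1, so the hard problem is a maximum cut. The obstacle is that the positive
  weights are units lying on a spanning tree, while a cut reduction wants heavy edges between
  arbitrary pairs. Blobs of \<open>B\<close> vertices turn the \<open>B\<close> teeth between two
  blobs into one edge of weight \<open>B\<close>, but only between a blob and its partner; all else
  must be expressed by negative weights, which can be chosen freely below \<open>B\<close>. This is
  why every variable occurs with its negation: a conflict penalises one blob for differing from the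
  partner of the other. Such a penalty also hits pairs of which neither is chosen; degree terms in
  other weights cancel this. The value of a consistent assignment becomes
  \<open>1 + 2 * (size - m - viol)\<close>, odd on purpose: it is positive iff
  \<open>m + viol <= size\<close>, and then deleting all vertices with conflicts leaves at least
  \<open>m\<close> vertices. In the membership proof the numerals of \<alpha> may be exponentially
  large, which unary counters cannot hold; this forces the bitwise comparison.\<close>

datatype test = Nz nat | Sym "nat set"

datatype com = Skip | Inc nat | Dec nat | MvR | MvL | Out bool
  | Seq com com | Cond test com com | Loop test com

text \<open>Position of the input head, counters, output written so far.\<close>

type_synonym store = "int \<times> (nat \<Rightarrow> nat) \<times> bool list"

fun holds :: "bool list \<Rightarrow> test \<Rightarrow> store \<Rightarrow> bool" where
  "holds x (Nz r) (p, R, w) = (R r \<noteq> 0)"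
| "holds x (Sym a) (p, R, w) = (contents x p \<in> a)"

text \<open>The first argument is the stack of commands still to be run. The outcome
  \<open>b\<close> of the guard is passed as a bit, so that the stack depends on the store only
  through it and can become the finite control of a machine.\<close>

fun nxt :: "com list \<Rightarrow> bool \<Rightarrow> com list" where
  "nxt [] b = []"
| "nxt (Seq c d # k) b = c # d # k"
| "nxt (Cond t c d # k) b = (if b then c else d) # k"
| "nxt (Loop t c # k) b = (if b then c # Loop t c # k else k)"
| "nxt (_ # k) b = k"

fun guard :: "com list \<Rightarrow> test option" where
  "guard (Cond t c d # k) = Some t"
| "guard (Loop t c # k) = Some t"
| "guard _ = None"

fun eff :: "com list \<Rightarrow> store \<Rightarrow> store" where
  "eff (Inc r # k) (p, R, w) = (p, R(r := Suc (R r)), w)"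
| "eff (Dec r # k) (p, R, w) = (p, R(r := R r - 1), w)"
| "eff (MvR # k) (p, R, w) = (p + 1, R, w)"
| "eff (MvL # k) (p, R, w) = (p - 1, R, w)"
| "eff (Out b # k) (p, R, w) = (p, R, w @ [b])"
| "eff _ s = s"

definition guard_holds :: "bool list \<Rightarrow> com list \<Rightarrow> store \<Rightarrow> bool" where
  "guard_holds x k s = (case guard k of None \<Rightarrow> False | Some t \<Rightarrow> holds x t s)"

definition small :: "bool list \<Rightarrow> com list \<times> store \<Rightarrow> com list \<times> store" where
  "small x = (\<lambda>(k, s). (nxt k (guard_holds x k s), eff k s))"

text \<open>The step count \<open>t\<close> is chosen before the continuation \<open>k\<close>, so a
  run does not depend on what follows it; this is what makes runs compose.\<close>

definition runs :: "bool list \<Rightarrow> com \<Rightarrow> store \<Rightarrow> nat \<Rightarrow> store \<Rightarrow> bool" where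
  "runs x c s T s' \<longleftrightarrow> (\<exists>t\<le>T. \<forall>k. (small x ^^ t) (c # k, s) = (k, s'))"

section \<open>Composition of timed runs\<close>

lemma runs_mono: "runs x c s T s' \<Longrightarrow> T \<le> T' \<Longrightarrow> runs x c s T' s'"
  unfolding runs_def using le_trans by blast

lemma funpow_trans:
  assumes "(f ^^ m) a = b" "(f ^^ n) b = c"
  shows "(f ^^ (m + n)) a = c"
  using assms by (metis add.commute comp_apply funpow_add)

lemma runs_small:
  assumes "\<And>k. small x (c # k, s) = (k, s')"
  shows "runs x c s 1 s'"
  unfolding runs_def using assms by (intro exI[of _ 1]) simp

lemma runs_atoms:
  "runs x Skip s 1 s"
  "runs x (Inc r) (p, R, w) 1 (p, R(r := Suc (R r)), w)"
  "runs x (Dec r) (p, R, w) 1 (p, R(r := R r - 1), w)"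
  "runs x MvR (p, R, w) 1 (p + 1, R, w)"
  "runs x MvL (p, R, w) 1 (p - 1, R, w)"
  "runs x (Out b) (p, R, w) 1 (p, R, w @ [b])"
  by (rule runs_small, simp add: small_def)+

lemma runs_prefix:
  assumes "\<And>k. small x (c # k, s) = (d # k, s)" "runs x d s T s'"
  shows "runs x c s (Suc T) s'"
proof -
  obtain t where t: "t \<le> T" "\<And>k. (small x ^^ t) (d # k, s) = (k, s')"
    using assms(2) unfolding runs_def by blast
  have "(small x ^^ Suc t) (c # k, s) = (k, s')" for k
    using t(2) assms(1) by (simp add: funpow_Suc_right del: funpow.simps)
  thus ?thesis unfolding runs_def using t(1) by (intro exI[of _ "Suc t"]) blast
qed

lemma runs_prefix2:
  assumes "\<And>k. small x (c # k, s) = (d # e # k, s)" "runs x d s T s1" "runs x e s1 T' s2"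
  shows "runs x c s (Suc (T + T')) s2"
proof -
  obtain t where t: "t \<le> T" "\<And>k. (small x ^^ t) (d # k, s) = (k, s1)"
    using assms(2) unfolding runs_def by blast
  obtain t' where t': "t' \<le> T'" "\<And>k. (small x ^^ t') (e # k, s1) = (k, s2)"
    using assms(3) unfolding runs_def by blast
  have "(small x ^^ Suc (t + t')) (c # k, s) = (k, s2)" for k
    using funpow_trans[OF t(2) t'(2)] assms(1) by (simp add: funpow_Suc_right del: funpow.simps)
  thus ?thesis unfolding runs_def using t(1) t'(1) by (intro exI[of _ "Suc (t + t')"]) simp
qed

lemma runs_Seq: "runs x c s T s1 \<Longrightarrow> runs x d s1 T' s2 \<Longrightarrow> runs x (Seq c d) s (Suc (T + T')) s2"
  by (rule runs_prefix2) (simp_all add: small_def)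

lemma runs_Cond:
  "runs x (if holds x t s then c else d) s T s' \<Longrightarrow> runs x (Cond t c d) s (Suc T) s'"
  by (rule runs_prefix) (simp_all add: small_def guard_holds_def)

lemma runs_Loop_False: "\<not> holds x t s \<Longrightarrow> runs x (Loop t c) s 1 s"
  by (rule runs_small) (simp add: small_def guard_holds_def)

lemma runs_Loop_True:
  "holds x t s \<Longrightarrow> runs x c s T s1 \<Longrightarrow> runs x (Loop t c) s1 T' s2 \<Longrightarrow>
   runs x (Loop t c) s (Suc (T + T')) s2"
  by (rule runs_prefix2) (simp_all add: small_def guard_holds_def)

text \<open>\<open>st i\<close> is the store after \<open>i\<close> rounds and \<open>T\<close>
  bounds every execution of the body. Each round pays one more step for its guard, and the failing
  guard at the end pays one.\<close>

lemma runs_Loop: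
  assumes "\<And>i. i < n \<Longrightarrow> holds x t (st i)" "\<not> holds x t (st n)"
    and "\<And>i. i < n \<Longrightarrow> runs x c (st i) T (st (Suc i))"
  shows "runs x (Loop t c) (st 0) (n * Suc T + 1) (st n)"
proof -
  \<comment> \<open>Induction on the number \<open>j\<close> of rounds that remain.\<close>
  have "j \<le> n \<Longrightarrow> runs x (Loop t c) (st (n - j)) (j * Suc T + 1) (st n)" for j
  proof (induction j)
    case 0
    thus ?case using runs_Loop_False[OF assms(2)] by simp
  next
    case (Suc j)
    have e: "Suc (n - Suc j) = n - j" using Suc.prems by simp
    have "runs x (Loop t c) (st (n - Suc j)) (Suc (T + (j * Suc T + 1))) (st n)"
      using runs_Loop_True[OF assms(1) assms(3)] Suc e by (metis Suc_leD diff_less_Suc e less_Suc_eq_le less_le_trans not_less_eq)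
    thus ?case by (rule runs_mono) simp
  qed
  from this[of n] show ?thesis by simp
qed

section \<open>Finiteness of the control\<close>

fun conts :: "com \<Rightarrow> com list \<Rightarrow> com list set" where
  "conts (Seq c d) k = {Seq c d # k, k} \<union> conts c (d # k) \<union> conts d k"
| "conts (Cond t c d) k = {Cond t c d # k, k} \<union> conts c k \<union> conts d k"
| "conts (Loop t c) k = {Loop t c # k, k} \<union> conts c (Loop t c # k)"
| "conts c k = {c # k, k}"

lemma conts_self: "c # k \<in> conts c k" "k \<in> conts c k"
  by (cases c; simp)+

text \<open>Loops do not make the stack grow without bound: the body always runs in front of the
  same stack, with the loop put back on top.\<close>

lemma finite_conts: "finite (conts c k)"
  by (induction c arbitrary: k) auto

text \<open>Control leaves \<open>c\<close> only through \<open>k\<close>, which still belongs to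
  the set. For a whole program \<open>k\<close> is the empty stack, which \<open>nxt\<close> does
  not change, so its set is closed.\<close>

lemma conts_nxt: "k' \<in> conts c k \<Longrightarrow> k' \<noteq> k \<Longrightarrow> nxt k' b \<in> conts c k"
proof (induction c arbitrary: k)
  case (Seq c d)
  show ?case
  proof (cases "k' = Seq c d # k \<or> k' = d # k")
    case True
    then show ?thesis using conts_self Seq.IH(2)[of k] by auto
  next
    case False
    then show ?thesis using Seq by auto
  qed
next
  case (Cond t c d)
  then show ?case using conts_self by (auto split: if_splits)
next
  case (Loop t c)
  show ?case
  proof (cases "k' = Loop t c # k")
    case True
    then show ?thesis using conts_self by auto
  next
    case False
    then show ?thesis using Loop by auto
  qed
qed auto

fun regs_below :: "nat \<Rightarrow> com \<Rightarrow> bool" where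
  "regs_below m (Inc r) = (r < m)"
| "regs_below m (Dec r) = (r < m)"
| "regs_below m (Seq c d) = (regs_below m c \<and> regs_below m d)"
| "regs_below m (Cond t c d) = ((\<forall>r. t = Nz r \<longrightarrow> r < m) \<and> regs_below m c \<and> regs_below m d)"
| "regs_below m (Loop t c) = ((\<forall>r. t = Nz r \<longrightarrow> r < m) \<and> regs_below m c)"
| "regs_below m _ = True"

lemma regs_below_mono: "regs_below m c \<Longrightarrow> m \<le> m' \<Longrightarrow> regs_below m' c"
  by (induction c) auto

lemma ex_regs_below: "\<exists>m. regs_below m c"
proof (induction c)
  case (Seq c d)
  then obtain m n where "regs_below m c" "regs_below n d" by blast
  hence "regs_below (max m n) (Seq c d)" by (auto intro: regs_below_mono)
  thus ?case by blast
next
  case (Cond t c d)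
  then obtain m n where "regs_below m c" "regs_below n d" by blast
  hence "regs_below (Max {m, n, case t of Nz r \<Rightarrow> Suc r | _ \<Rightarrow> 0}) (Cond t c d)"
    by (auto intro: regs_below_mono split: test.splits)
  thus ?case by blast
next
  case (Loop t c)
  then obtain m where "regs_below m c" by blast
  hence "regs_below (Max {m, case t of Nz r \<Rightarrow> Suc r | _ \<Rightarrow> 0}) (Loop t c)"
    by (auto intro: regs_below_mono split: test.splits)
  thus ?case by blast
qed auto

lemma regs_below_conts:
  "k' \<in> conts c k \<Longrightarrow> regs_below m c \<Longrightarrow> list_all (regs_below m) k \<Longrightarrow> list_all (regs_below m) k'"
proof (induction c arbitrary: k)
  case (Seq c d)
  from Seq.prems Seq.IH(1)[of "d # k"] Seq.IH(2)[of k] show ?case by auto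
next
  case (Cond t c d)
  from Cond.prems Cond.IH(1)[of k] Cond.IH(2)[of k] show ?case by auto
next
  case (Loop t c)
  from Loop.prems Loop.IH[of "Loop t c # k"] show ?case by auto
qed auto

section \<open>The machine of a program\<close>

fun tm_test :: "test option \<Rightarrow> nat list \<Rightarrow> bool" where
  "tm_test None ss = False"
| "tm_test (Some (Nz r)) ss = (ss ! Suc r \<noteq> 1)"
| "tm_test (Some (Sym a)) ss = (ss ! 0 \<in> a)"

text \<open>Tape \<open>Suc m\<close> is the output tape. \<open>Dec\<close> does not move off the
  mark, symbol 1, which gives the truncated subtraction of \<open>eff\<close>.\<close>

fun tm_act :: "nat \<Rightarrow> com list \<Rightarrow> nat \<Rightarrow> nat \<Rightarrow> nat \<times> move" where
  "tm_act m (Inc r # k) j s = (s, if j = Suc r then Right else Stay)"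
| "tm_act m (Dec r # k) j s = (s, if j = Suc r \<and> s \<noteq> 1 then Left else Stay)"
| "tm_act m (MvR # k) j s = (s, if j = 0 then Right else Stay)"
| "tm_act m (MvL # k) j s = (s, if j = 0 then Left else Stay)"
| "tm_act m (Out b # k) j s = (if j = Suc m then (if b then 2 else 1, Right) else (s, Stay))"
| "tm_act m _ j s = (s, Stay)"

lemma tm_act_symbol: "s < 3 \<Longrightarrow> fst (tm_act m k j s) < 3"
  by (cases "(m, k, j, s)" rule: tm_act.cases) auto

text \<open>
  Counter \<open>r\<close> is the head position of tape \<open>Suc r\<close>, whose only nonblank cell is a mark at
  position 0. State 0 sets these marks; the other states are the continuations of the program.
\<close>

definition counter_tm :: "nat \<Rightarrow> com \<Rightarrow> (com list \<Rightarrow> nat) \<Rightarrow> tm" where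
  "counter_tm m c idx =
     \<lparr>tapes = m + 2, symbols = 3, states = Suc (card (conts c [])), halt = Suc (idx []),
      trans = (\<lambda>q ss. if q = 0
        then (Suc (idx [c]), map (\<lambda>j. (if 1 \<le> j \<and> j \<le> m then 1 else ss ! j, Stay)) [0..<m+2])
        else let k = inv_into (conts c []) idx (q - 1) in
          (Suc (idx (nxt k (tm_test (guard k) ss))), map (\<lambda>j. tm_act m k j (ss ! j)) [0..<m+2]))\<rparr>"

definition mark :: "int \<Rightarrow> nat" where
  "mark i = (if i = 0 then 1 else 0)"

text \<open>The output head rests on the first cell after the output, so that writing there appends
  a bit.\<close>

fun counter_tape :: "nat \<Rightarrow> bool list \<Rightarrow> store \<Rightarrow> nat \<Rightarrow> tape" where
  "counter_tape m x (p, R, w) j =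
     (if j = 0 then (contents x, p) else if j \<le> m then (mark, int (R (j - 1)))
      else (contents w, int (length w)))"

definition counter_config ::
  "nat \<Rightarrow> (com list \<Rightarrow> nat) \<Rightarrow> bool list \<Rightarrow> com list \<times> store \<Rightarrow> config" where
  "counter_config m idx x = (\<lambda>(k, s). (Suc (idx k), map (counter_tape m x s) [0..<m+2]))"

locale counter_compile =
  fixes m :: nat and c :: com and idx :: "com list \<Rightarrow> nat"
  assumes bij: "bij_betw idx (conts c []) {..<card (conts c [])}"
    and below: "regs_below m c"
begin

abbreviation "K \<equiv> conts c []"
abbreviation "M \<equiv> counter_tm m c idx"

lemma idx_less: "k \<in> K \<Longrightarrow> idx k < card K"
  using bij unfolding bij_betw_def by blast

lemma idx_inv: "k \<in> K \<Longrightarrow> inv_into K idx (idx k) = k"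
  using bij unfolding bij_betw_def by simp

lemma inv_mem: "q < card K \<Longrightarrow> inv_into K idx q \<in> K"
  using bij unfolding bij_betw_def by (metis inv_into_into lessThan_iff)

lemma nxt_mem: "k \<in> K \<Longrightarrow> nxt k b \<in> K"
  using conts_nxt by (cases "k = []") auto

lemma turing: "turing_machine M"
proof -
  have 1: "fst (trans M q ss) < states M" if "q < states M" for q ss
  proof (cases q)
    case 0
    then show ?thesis using idx_less conts_self by (auto simp: counter_tm_def)
  next
    case (Suc i)
    hence "inv_into K idx i \<in> K" using that inv_mem by (auto simp: counter_tm_def)
    then show ?thesis using Suc idx_less nxt_mem by (auto simp: counter_tm_def Let_def)
  qed
  have 2: "s < 3" if "length ss = m + 2" "\<forall>s\<in>set ss. s < 3" "(s, d) \<in> set (snd (trans M q ss))"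
    for q ss s d
  proof -
    from that(3) obtain j where j: "j < m + 2"
      "(s, d) = (if 1 \<le> j \<and> j \<le> m then 1 else ss ! j, Stay) \<or>
       (s, d) = tm_act m (inv_into K idx (q - 1)) j (ss ! j)"
      by (auto simp: counter_tm_def Let_def simp del: upt_Suc split: if_splits(2))
    have "ss ! j < 3" using that(1,2) j(1) by (metis nth_mem)
    hence "fst (s, d) < 3" using j(2) tm_act_symbol[of "ss ! j" m "inv_into K idx (q - 1)" j]
      by (elim disjE) simp_all
    thus ?thesis by simp
  qed
  have 3: "idx [] < card K" by (simp add: idx_less conts_self)
  have 4: "length (snd (trans M q ss)) = m + 2" for q ss
    by (simp add: counter_tm_def Let_def)
  have sel: "tapes M = m + 2" "symbols M = 3" "states M = Suc (card K)" "halt M = Suc (idx [])"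
    by (simp_all add: counter_tm_def)
  show ?thesis
    unfolding turing_machine_def
  proof (intro conjI allI impI ballI, goal_cases)
    case (7 q ss sd)
    then show ?case using 2[of ss "fst sd" "snd sd" q] sel by auto
  qed (use 1 3 4 sel in auto)
qed

lemma scanned_nth:
  "j < m + 2 \<Longrightarrow> map scanned (map (counter_tape m x s) [0..<m+2]) ! j = scanned (counter_tape m x s j)"
  by (simp del: upt_Suc)

lemma contents_snoc:
  "(contents w)(int (length w) := if b then 2 else 1) = contents (w @ [b])"
  by (rule ext) (auto simp: contents_def nth_append)

text \<open>The bound on the counters keeps \<open>Inc\<close> and \<open>Dec\<close> away from the
  output tape. For \<open>Dec\<close> at counter 0 the mark is scanned and both sides stay
  put.\<close>

lemma act_tape:
  assumes "j < m + 2" "k = [] \<or> regs_below m (hd k)"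
  shows "act (tm_act m k j (scanned (counter_tape m x s j))) (counter_tape m x s j) =
         counter_tape m x (eff k s) j"
proof -
  obtain p R w where s: "s = (p, R, w)" by (cases s)
  have id: "act (scanned tp, Stay) tp = tp" for tp by (cases tp) simp
  show ?thesis
  proof (cases k)
    case Nil
    then show ?thesis by (simp add: id)
  next
    case (Cons d k')
    then show ?thesis
    proof (cases d)
      case (Inc r)
      then show ?thesis using Cons s assms by (cases "j = Suc r") (auto simp: id)
    next
      case (Dec r)
      then show ?thesis using Cons s assms by (cases "j = Suc r") (auto simp: id mark_def)
    next
      case (Out b)
      then show ?thesis using Cons s assms contents_snoc[of w b]
        by (cases "j = Suc m") (auto simp: id)
    qed (use s in \<open>auto simp: id\<close>)
  qed
qed

lemma tm_test_guard:
  assumes "k = [] \<or> regs_below m (hd k)"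
  shows "tm_test (guard k) (map scanned (map (counter_tape m x s) [0..<m+2])) = guard_holds x k s"
proof -
  obtain p R w where s: "s = (p, R, w)" by (cases s)
  show ?thesis
  proof (cases "guard k")
    case None
    then show ?thesis by (simp add: guard_holds_def)
  next
    case (Some t)
    then obtain d k' where k: "k = d # k'" by (cases k) auto
    show ?thesis
    proof (cases t)
      case (Nz r)
      hence "r < m" using assms Some k by (cases d) auto
      hence "Suc r < m + 2" by simp
      then show ?thesis using Some Nz s scanned_nth[of "Suc r" x s] \<open>r < m\<close>
        by (simp add: guard_holds_def mark_def del: upt_Suc map_map)
    next
      case (Sym a)
      then show ?thesis using Some s scanned_nth[of 0 x s]
        by (simp add: guard_holds_def del: upt_Suc map_map)
    qed
  qed
qed

text \<open>One step of the program is one step of the machine, so time bounds carry over. A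
  finished program corresponds to the halting state, and both stay unchanged.\<close>

lemma step_config:
  assumes "k \<in> K"
  shows "step M (counter_config m idx x (k, s)) = counter_config m idx x (small x (k, s))"
proof (cases "k = []")
  case True
  then show ?thesis
    by (simp add: counter_config_def small_def counter_tm_def guard_holds_def)
next
  case False
  have ne: "Suc (idx k) \<noteq> halt M"
    using False assms conts_self(2) bij
    by (simp add: counter_tm_def bij_betw_def inj_on_def) metis
  have b: "k = [] \<or> regs_below m (hd k)"
    using regs_below_conts[OF assms below] False by (cases k) auto
  let ?ss = "map scanned (map (counter_tape m x s) [0..<m+2])"
  have "trans M (Suc (idx k)) ?ss =
      (Suc (idx (nxt k (guard_holds x k s))), map (\<lambda>j. tm_act m k j (?ss ! j)) [0..<m+2])"
    using tm_test_guard[OF b, of x s] idx_inv[OF assms]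
    by (simp add: counter_tm_def Let_def del: upt_Suc map_map)
  moreover have "map2 act (map (\<lambda>j. tm_act m k j (?ss ! j)) [0..<m+2]) (map (counter_tape m x s) [0..<m+2])
      = map (counter_tape m x (eff k s)) [0..<m+2]"
    by (rule nth_equalityI) (use act_tape[OF _ b, of _ x s] in \<open>simp_all del: upt_Suc\<close>)
  ultimately show ?thesis
    using ne by (simp add: counter_config_def small_def Let_def del: upt_Suc map_map)
qed

lemma small_mem: "k \<in> K \<Longrightarrow> fst (small x (k, s)) \<in> K"
  by (simp add: small_def nxt_mem)

lemma steps_config:
  "k \<in> K \<Longrightarrow> (step M ^^ t) (counter_config m idx x (k, s)) = counter_config m idx x ((small x ^^ t) (k, s))
     \<and> fst ((small x ^^ t) (k, s)) \<in> K"
proof (induction t)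
  case (Suc t)
  obtain k' s' where "(small x ^^ t) (k, s) = (k', s')" by (cases "(small x ^^ t) (k, s)")
  with Suc show ?case using step_config[of k' x s'] small_mem[of k' x s'] by simp
qed simp

text \<open>This extra first step places the marks that turn blank work tapes into counters with
  value 0.\<close>

lemma step_start:
  "step M (start M x) = counter_config m idx x ([c], (0, \<lambda>_. 0, []))"
proof -
  let ?ts = "(contents x, 0) # replicate (m + 1) (contents [], 0) :: tape list"
  let ?ss = "map scanned ?ts"
  have len: "length ?ts = m + 2" by simp
  have "trans M 0 ?ss = (Suc (idx [c]), map (\<lambda>j. (if 1 \<le> j \<and> j \<le> m then 1 else ?ss ! j, Stay)) [0..<m+2])"
    by (simp add: counter_tm_def del: upt_Suc)
  moreover have "map2 act (map (\<lambda>j. (if 1 \<le> j \<and> j \<le> m then 1 else ?ss ! j, Stay)) [0..<m+2]) ?ts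
     = map (counter_tape m x (0, \<lambda>_. 0, [])) [0..<m+2]"
  proof (rule nth_equalityI)
    fix j assume "j < length (map2 act (map (\<lambda>j. (if 1 \<le> j \<and> j \<le> m then 1 else ?ss ! j, Stay)) [0..<m+2]) ?ts)"
    hence j: "j < m + 2" by (simp del: upt_Suc)
    have 1: "(map2 act (map (\<lambda>j. (if 1 \<le> j \<and> j \<le> m then 1 else ?ss ! j, Stay)) [0..<m+2]) ?ts) ! j
      = act (if 1 \<le> j \<and> j \<le> m then 1 else ?ss ! j, Stay) (?ts ! j)"
      using j by (simp del: upt_Suc)
    have 2: "?ts ! j = (if j = 0 then contents x else contents [], 0)"
      using j by (cases j) (auto simp: nth_Cons' simp del: replicate_Suc)
    have 3: "?ss ! j = scanned (?ts ! j)" using j len by (metis nth_map)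
    have 4: "map (counter_tape m x (0, \<lambda>_. 0, [])) [0..<m+2] ! j = counter_tape m x (0, \<lambda>_. 0, []) j"
      using j by (simp del: upt_Suc)
    show "(map2 act (map (\<lambda>j. (if 1 \<le> j \<and> j \<le> m then 1 else ?ss ! j, Stay)) [0..<m+2]) ?ts) ! j
      = map (counter_tape m x (0, \<lambda>_. 0, [])) [0..<m+2] ! j"
      unfolding 1 3 2 4 by (auto simp: mark_def contents_def fun_eq_iff)
  qed (simp del: upt_Suc)
  moreover have "0 \<noteq> halt M" by (simp add: counter_tm_def)
  moreover have "start M x = (0, ?ts)" by (simp add: start_def counter_tm_def)
  ultimately show ?thesis
    by (simp only: counter_config_def step.simps Let_def prod.case if_False)
qed

lemma runs_outputs:
  assumes "runs x c (0, \<lambda>_. 0, []) T (p, R, w)"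
  shows "outputs_within M x (Suc T) w"
proof -
  obtain t where t: "t \<le> T" "(small x ^^ t) ([c], (0, \<lambda>_. 0, [])) = ([], (p, R, w))"
    using assms unfolding runs_def by blast
  \<comment> \<open>A finished program idles, so it may be run for exactly \<open>T\<close>
    steps.\<close>
  have fix_halt: "(small x ^^ n) ([], s) = ([], s)" for n s
    by (induction n) (auto simp: small_def)
  have "(small x ^^ (t + (T - t))) ([c], (0, \<lambda>_. 0, [])) = ([], (p, R, w))"
    using funpow_trans[OF t(2) fix_halt] .
  hence "(small x ^^ T) ([c], (0, \<lambda>_. 0, [])) = ([], (p, R, w))" using t(1) by simp
  hence "(step M ^^ Suc T) (start M x) = counter_config m idx x ([], (p, R, w))"
    using steps_config[OF conts_self(1), of T x "(0, \<lambda>_. 0, [])"] step_start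
    by (simp add: funpow_Suc_right del: funpow.simps)
  thus ?thesis
    by (simp add: outputs_within_def counter_config_def counter_tm_def)
qed

end

lemma polytime_computable_runs:
  assumes "\<And>x. \<exists>p R. runs x c (0, \<lambda>_. 0, []) (poly P (length x)) (p, R, f x)"
  shows "polytime_computable f"
proof -
  obtain m where "regs_below m c" using ex_regs_below by blast
  moreover obtain idx where "bij_betw idx (conts c []) {..<card (conts c [])}"
    using ex_bij_betw_finite_nat[OF finite_conts] by (metis atLeast0LessThan)
  ultimately interpret counter_compile m c idx by unfold_locales
  \<comment> \<open>The additional 1 is the step that places the marks.\<close>
  have "outputs_within M x (poly (P + 1) (length x)) (f x)" for x
    using assms[of x] runs_outputs by fastforce
  thus ?thesis unfolding polytime_computable_def using turing by blast
qed

section \<open>Functions computable with unary counters in polynomial time\<close>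

text \<open>The base of all polynomial bounds. As it is at least 2, constants, sums and products of
  bounds are absorbed by a larger exponent, and a bound is described by a single number.\<close>

definition esize :: "('e \<Rightarrow> nat) list \<Rightarrow> bool list \<Rightarrow> 'e \<Rightarrow> nat" where
  "esize vs x e = 2 + length x + (\<Sum>v\<leftarrow>vs. v e)"

definition PB :: "('e \<Rightarrow> nat) list \<Rightarrow> (bool list \<Rightarrow> 'e \<Rightarrow> nat) \<Rightarrow> bool" where
  "PB vs t \<longleftrightarrow> (\<exists>k. \<forall>x e. t x e \<le> esize vs x e ^ k)"

lemma esize_ge2: "2 \<le> esize vs x e"
  by (simp add: esize_def)

lemma PB_mono: "PB vs t \<Longrightarrow> (\<And>x e. t' x e \<le> t x e) \<Longrightarrow> PB vs t'"
  unfolding PB_def by (meson le_trans)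

lemma PB_const: "PB vs (\<lambda>x e. c)"
  unfolding PB_def
proof (intro exI allI)
  fix x e
  have "c \<le> 2 ^ c" by (simp add: less_imp_le)
  also have "\<dots> \<le> esize vs x e ^ c" using esize_ge2 by (intro power_mono) auto
  finally show "c \<le> esize vs x e ^ c" .
qed

lemma PB_add: "PB vs s \<Longrightarrow> PB vs t \<Longrightarrow> PB vs (\<lambda>x e. s x e + t x e)"
  unfolding PB_def
proof (elim exE, intro exI allI)
  fix k l x e
  assume h: "\<forall>x e. s x e \<le> esize vs x e ^ k" "\<forall>x e. t x e \<le> esize vs x e ^ l"
  let ?S = "esize vs x e"
  have "?S ^ k \<le> ?S ^ (k + l)" "?S ^ l \<le> ?S ^ (k + l)"
    using esize_ge2[of vs x e] by (auto intro!: power_increasing)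
  hence "s x e + t x e \<le> 2 * ?S ^ (k + l)" using h[rule_format, of x e] by linarith
  also have "\<dots> \<le> ?S ^ Suc (k + l)" using esize_ge2[of vs x e] by simp
  finally show "s x e + t x e \<le> ?S ^ Suc (k + l)" .
qed

lemma PB_mult: "PB vs s \<Longrightarrow> PB vs t \<Longrightarrow> PB vs (\<lambda>x e. s x e * t x e)"
  unfolding PB_def
proof (elim exE, intro exI allI)
  fix k l x e
  assume h: "\<forall>x e. s x e \<le> esize vs x e ^ k" "\<forall>x e. t x e \<le> esize vs x e ^ l"
  thus "s x e * t x e \<le> esize vs x e ^ (k + l)" by (simp add: power_add mult_le_mono)
qed

lemma PB_pow: "PB vs s \<Longrightarrow> PB vs (\<lambda>x e. s x e ^ k)"
  by (induction k) (auto intro: PB_const PB_mult)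

lemma PB_len: "PB vs (\<lambda>x e. length x)"
  unfolding PB_def by (rule exI[of _ 1]) (simp add: esize_def)

lemma PB_sum: "PB vs (\<lambda>x e. \<Sum>v\<leftarrow>vs. v e)"
  unfolding PB_def by (rule exI[of _ 1]) (simp add: esize_def)

lemma PB_var: "v \<in> set vs \<Longrightarrow> PB vs (\<lambda>x e. v e)"
  by (rule PB_mono[OF PB_sum]) (auto intro!: member_le_sum_list)

text \<open>Substitution into a bound only needs the new values of the accessors to be bounded; the
  environment produced by \<open>h\<close> may have any type.\<close>

lemma PB_subst:
  assumes "PB us t" "PB vs (\<lambda>x e. \<Sum>u\<leftarrow>us. u (h x e))"
  shows "PB vs (\<lambda>x e. t x (h x e))"
proof -
  obtain k where "\<forall>x e. t x e \<le> esize us x e ^ k" using assms(1) unfolding PB_def by blast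
  moreover have "PB vs (\<lambda>x e. esize us x (h x e) ^ k)"
    unfolding esize_def by (intro PB_pow PB_add PB_const PB_len assms(2))
  ultimately show ?thesis by (auto intro: PB_mono)
qed

text \<open>Weakening: the environment becomes a pair whose first component is the old one, and
  further accessors read the second. Bound variables are thus components of nested pairs.\<close>

abbreviation lift :: "('e \<Rightarrow> nat) list \<Rightarrow> ('e \<times> 'f \<Rightarrow> nat) list" where
  "lift vs \<equiv> map (\<lambda>v p. v (fst p)) vs"

lemma PB_let:
  assumes "PB (lift vs @ [snd]) t" "PB vs g"
  shows "PB vs (\<lambda>x e. t x (e, g x e))"
proof (rule PB_subst[OF assms(1)])
  show "PB vs (\<lambda>x e. \<Sum>u\<leftarrow>lift vs @ [snd]. u (e, g x e))"
    by (simp add: comp_def) (intro PB_add assms(2) PB_sum)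
qed

lemmas PB_intros = PB_const PB_add PB_mult PB_pow PB_len

text \<open>
  A function of the input and an environment, of which the programs see the numbers given by the
  accessors \<open>vs\<close> in registers \<open>\<rho>\<close>, is in the class if counter programs compute it in time
  polynomial in the input length and these numbers (so counters hold numbers in unary).
\<close>

definition computes ::
  "('e \<Rightarrow> nat) list \<Rightarrow> (bool list \<Rightarrow> 'e \<Rightarrow> nat) \<Rightarrow> nat list \<Rightarrow> nat \<Rightarrow> com \<Rightarrow> (bool list \<Rightarrow> 'e \<Rightarrow> nat) \<Rightarrow> bool"
  where
  "computes vs f \<rho> r c T \<longleftrightarrow> PB vs T \<and>
     (\<forall>x e R w. map R \<rho> = map (\<lambda>v. v e) vs \<and> (\<forall>q\<ge>r. R q = 0) \<longrightarrow>
        runs x c (0, R, w) (T x e) (0, R(r := f x e), w))"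

text \<open>Programs are relocatable: any registers \<open>\<rho>\<close> for the arguments and any
  \<open>r\<close> above them. The registers from \<open>r\<close> on are 0 before the run and,
  apart from the result in \<open>r\<close>, also after it, so nested programs can share the scratch
  space.\<close>

definition PC :: "('e \<Rightarrow> nat) list \<Rightarrow> (bool list \<Rightarrow> 'e \<Rightarrow> nat) \<Rightarrow> bool" where
  "PC vs f \<longleftrightarrow> PB vs f \<and>
     (\<forall>\<rho> r. length \<rho> = length vs \<and> (\<forall>a\<in>set \<rho>. a < r) \<longrightarrow> (\<exists>c T. computes vs f \<rho> r c T))"

definition PD :: "('e \<Rightarrow> nat) list \<Rightarrow> (bool list \<Rightarrow> 'e \<Rightarrow> bool) \<Rightarrow> bool" where
  "PD vs P \<longleftrightarrow> PC vs (\<lambda>x e. if P x e then 1 else 0)"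

lemma PC_PB: "PC vs f \<Longrightarrow> PB vs f"
  by (simp add: PC_def)

lemma PC_obtain:
  assumes "PC vs f" "length \<rho> = length vs" "\<forall>a\<in>set \<rho>. a < r"
  obtains c T where "PB vs T"
    "\<And>x e R w. map R \<rho> = map (\<lambda>v. v e) vs \<Longrightarrow> (\<forall>q\<ge>r. R q = 0) \<Longrightarrow>
        runs x c (0, R, w) (T x e) (0, R(r := f x e), w)"
  using assms unfolding PC_def computes_def by metis

lemma PC_intro:
  assumes "PB vs f"
    and "\<And>\<rho> r. length \<rho> = length vs \<Longrightarrow> \<forall>a\<in>set \<rho>. a < r \<Longrightarrow>
      \<exists>c T. PB vs T \<and> (\<forall>x e R w. map R \<rho> = map (\<lambda>v. v e) vs \<longrightarrow> (\<forall>q\<ge>r. R q = 0) \<longrightarrow>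
        runs x c (0, R, w) (T x e) (0, R(r := f x e), w))"
  shows "PC vs f"
  using assms unfolding PC_def computes_def by metis

section \<open>Register programs for the basic functions\<close>

definition clr :: "nat \<Rightarrow> com" where
  "clr a = Loop (Nz a) (Dec a)"

definition mv :: "nat \<Rightarrow> nat \<Rightarrow> com" where
  "mv a b = Loop (Nz a) (Seq (Dec a) (Inc b))"

lemma runs_clr: "runs x (clr a) (p, R, w) (R a * 2 + 1) (p, R(a := 0), w)"
proof -
  let ?st = "\<lambda>i. (p, R(a := R a - i), w)"
  have "runs x (clr a) (?st 0) (R a * Suc 1 + 1) (?st (R a))"
    unfolding clr_def
  proof (rule runs_Loop)
    fix i assume "i < R a"
    show "runs x (Dec a) (?st i) 1 (?st (Suc i))"
      using runs_atoms(3)[of x a p "R(a := R a - i)" w] by simp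
  qed auto
  thus ?thesis by (simp add: fun_upd_idem mult_2_right)
qed

lemma runs_mv:
  assumes "a \<noteq> b"
  shows "runs x (mv a b) (p, R, w) (R a * 4 + 1) (p, R(a := 0, b := R b + R a), w)"
proof -
  let ?st = "\<lambda>i. (p, R(a := R a - i, b := R b + i), w)"
  have "runs x (mv a b) (?st 0) (R a * Suc 3 + 1) (?st (R a))"
    unfolding mv_def
  proof (rule runs_Loop)
    fix i assume "i < R a"
    have "runs x (Seq (Dec a) (Inc b)) (?st i) (Suc (1 + 1))
      (p, (R(a := R a - i, b := R b + i))(a := (R(a := R a - i, b := R b + i)) a - 1,
            b := Suc (((R(a := R a - i, b := R b + i))(a := (R(a := R a - i, b := R b + i)) a - 1)) b)), w)"
      by (rule runs_Seq[OF runs_atoms(3) runs_atoms(2)])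
    moreover have "(R(a := R a - i, b := R b + i))(a := (R(a := R a - i, b := R b + i)) a - 1,
            b := Suc (((R(a := R a - i, b := R b + i))(a := (R(a := R a - i, b := R b + i)) a - 1)) b))
          = R(a := R a - Suc i, b := R b + Suc i)"
      using assms by (auto simp: fun_eq_iff)
    ultimately show "runs x (Seq (Dec a) (Inc b)) (?st i) 3 (?st (Suc i))"
      by (simp add: numeral_3_eq_3)
  qed (use assms in auto)
  thus ?thesis by simp
qed

lemma runs_Seq': "runs x c s T s1 \<Longrightarrow> runs x d s1 T' s2 \<Longrightarrow> T + T' + 1 \<le> U \<Longrightarrow> runs x (Seq c d) s U s2"
  by (rule runs_mono[OF runs_Seq]) auto

lemma runs_eq: "runs x c s T s1 \<Longrightarrow> s1 = s2 \<Longrightarrow> T \<le> U \<Longrightarrow> runs x c s U s2"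
  using runs_mono by blast

lemma PC_zero: "PC vs (\<lambda>x e. 0)"
proof (rule PC_intro)
  fix \<rho> :: "nat list" and r :: nat
  show "\<exists>c T. PB vs T \<and> (\<forall>x e R w. map R \<rho> = map (\<lambda>v. v e) vs \<longrightarrow> (\<forall>q\<ge>r. R q = 0) \<longrightarrow>
        runs x c (0, R, w) (T x e) (0, R(r := 0), w))"
  proof (intro exI[of _ Skip] exI[of _ "\<lambda>x e. 1"] conjI allI impI)
    fix x :: "bool list" and e and R :: "nat \<Rightarrow> nat" and w :: "bool list" assume "\<forall>q\<ge>r. R q = (0::nat)"
    hence "R(r := 0) = R" by auto
    thus "runs x Skip (0, R, w) 1 (0, R(r := 0), w)" using runs_atoms(1) by simp
  qed (rule PB_const)
qed (rule PB_const)

lemma PC_Suc: assumes "PC vs f" shows "PC vs (\<lambda>x e. Suc (f x e))"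
proof (rule PC_intro)
  show "PB vs (\<lambda>x e. Suc (f x e))" using PB_add[OF PB_const[of vs 1] PC_PB[OF assms]] by simp
  fix \<rho> :: "nat list" and r :: nat assume h: "length \<rho> = length vs" "\<forall>a\<in>set \<rho>. a < r"
  obtain c T where T: "PB vs T" and c:
    "\<And>x e R w. map R \<rho> = map (\<lambda>v. v e) vs \<Longrightarrow> (\<forall>q\<ge>r. R q = 0) \<Longrightarrow>
        runs x c (0, R, w) (T x e) (0, R(r := f x e), w)"
    by (rule PC_obtain[OF assms h]) (rule that)
  show "\<exists>c T. PB vs T \<and> (\<forall>x e R w. map R \<rho> = map (\<lambda>v. v e) vs \<longrightarrow> (\<forall>q\<ge>r. R q = 0) \<longrightarrow>
        runs x c (0, R, w) (T x e) (0, R(r := Suc (f x e)), w))"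
  proof (intro exI[of _ "Seq c (Inc r)"] exI[of _ "\<lambda>x e. T x e + 2"] conjI allI impI)
    fix x :: "bool list" and e and R :: "nat \<Rightarrow> nat" and w :: "bool list" assume "map R \<rho> = map (\<lambda>v. v e) vs" "\<forall>q\<ge>r. R q = 0"
    from c[OF this] show "runs x (Seq c (Inc r)) (0, R, w) (T x e + 2) (0, R(r := Suc (f x e)), w)"
      by (rule runs_Seq') (rule runs_eq[OF runs_atoms(2)], auto)
  qed (intro PB_intros T)
qed

lemma PC_pred: assumes "PC vs f" shows "PC vs (\<lambda>x e. f x e - 1)"
proof (rule PC_intro)
  show "PB vs (\<lambda>x e. f x e - 1)" using PC_PB[OF assms] by (rule PB_mono) simp
  fix \<rho> :: "nat list" and r :: nat assume h: "length \<rho> = length vs" "\<forall>a\<in>set \<rho>. a < r"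
  obtain c T where T: "PB vs T" and c:
    "\<And>x e R w. map R \<rho> = map (\<lambda>v. v e) vs \<Longrightarrow> (\<forall>q\<ge>r. R q = 0) \<Longrightarrow>
        runs x c (0, R, w) (T x e) (0, R(r := f x e), w)"
    by (rule PC_obtain[OF assms h]) (rule that)
  show "\<exists>c T. PB vs T \<and> (\<forall>x e R w. map R \<rho> = map (\<lambda>v. v e) vs \<longrightarrow> (\<forall>q\<ge>r. R q = 0) \<longrightarrow>
        runs x c (0, R, w) (T x e) (0, R(r := f x e - 1), w))"
  proof (intro exI[of _ "Seq c (Dec r)"] exI[of _ "\<lambda>x e. T x e + 2"] conjI allI impI)
    fix x :: "bool list" and e and R :: "nat \<Rightarrow> nat" and w :: "bool list" assume "map R \<rho> = map (\<lambda>v. v e) vs" "\<forall>q\<ge>r. R q = 0"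
    from c[OF this] show "runs x (Seq c (Dec r)) (0, R, w) (T x e + 2) (0, R(r := f x e - 1), w)"
      by (rule runs_Seq') (rule runs_eq[OF runs_atoms(3)], auto)
  qed (intro PB_intros T)
qed

lemma PC_var: assumes "v \<in> set vs" shows "PC vs (\<lambda>x e. v e)"
proof (rule PC_intro)
  show "PB vs (\<lambda>x e. v e)" using assms by (rule PB_var)
  fix \<rho> :: "nat list" and r :: nat assume h: "length \<rho> = length vs" "\<forall>a\<in>set \<rho>. a < r"
  obtain i where i: "i < length vs" "vs ! i = v" using assms by (auto simp: in_set_conv_nth)
  define a where "a = \<rho> ! i"
  have a: "a < r" using h i by (simp add: a_def)
  \<comment> \<open>Reading a register empties it, so its value is moved into \<open>r\<close> and
    \<open>Suc r\<close> at once and then restored from \<open>Suc r\<close>.\<close>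
  define c where "c = Seq (Loop (Nz a) (Seq (Dec a) (Seq (Inc r) (Inc (Suc r))))) (mv (Suc r) a)"
  show "\<exists>c T. PB vs T \<and> (\<forall>x e R w. map R \<rho> = map (\<lambda>v. v e) vs \<longrightarrow> (\<forall>q\<ge>r. R q = 0) \<longrightarrow>
        runs x c (0, R, w) (T x e) (0, R(r := v e), w))"
  proof (intro exI[of _ c] exI[of _ "\<lambda>x e. v e * 10 + 10"] conjI allI impI)
    fix x :: "bool list" and e and R :: "nat \<Rightarrow> nat" and w :: "bool list" assume R: "map R \<rho> = map (\<lambda>v. v e) vs" "\<forall>q\<ge>r. R q = 0"
    have "map R \<rho> ! i = map (\<lambda>v. v e) vs ! i" using R(1) by simp
    hence ra: "R a = v e" using i h by (simp add: a_def)
    let ?st = "\<lambda>j. (0::int, R(a := R a - j, r := j, Suc r := j), w)"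
    have 1: "runs x (Loop (Nz a) (Seq (Dec a) (Seq (Inc r) (Inc (Suc r))))) (?st 0) (R a * Suc 5 + 1) (?st (R a))"
    proof (rule runs_Loop)
      fix j assume "j < R a"
      show "runs x (Seq (Dec a) (Seq (Inc r) (Inc (Suc r)))) (?st j) 5 (?st (Suc j))"
        apply (rule runs_Seq'[OF runs_atoms(3)])
         apply (rule runs_Seq'[OF runs_atoms(2)])
          apply (rule runs_eq[OF runs_atoms(2) _ order_refl])
        using a by (auto simp: fun_eq_iff)
    qed (use a in auto)
    have s0: "?st 0 = (0, R, w)" using R(2) a by (auto simp: fun_eq_iff)
    show "runs x c (0, R, w) (v e * 10 + 10) (0, R(r := v e), w)"
      unfolding c_def
      apply (rule runs_Seq'[OF 1[unfolded s0]])
       apply (rule runs_eq[OF runs_mv _ order_refl])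
      using a ra R(2) by (auto simp: fun_eq_iff)
  qed (intro PB_add PB_mult PB_const PB_var[OF assms])
qed

text \<open>Renaming variables costs no code: the old program is run on the registers that hold the
  values \<open>u (h e)\<close>, possibly with repetitions.\<close>

lemma PC_reindex:
  assumes "PC us f" "\<forall>u\<in>set us. (\<lambda>e. u (h e)) \<in> set vs"
  shows "PC vs (\<lambda>x e. f x (h e))"
proof -
  have sub: "PB vs (\<lambda>x e. t x (h e))" if "PB us t" for t
  proof (rule PB_subst[OF that])
    have "\<forall>u\<in>set us. (\<lambda>e. u (h e)) \<in> set vs" by (rule assms(2))
    thus "PB vs (\<lambda>x e. \<Sum>u\<leftarrow>us. u (h e))"
    proof (induction us)
      case Nil
      show ?case by (simp add: PB_const)
    next
      case (Cons u us)
      hence "PB vs (\<lambda>x e. u (h e) + (\<Sum>u\<leftarrow>us. u (h e)))"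
        by (intro PB_add PB_var[of "\<lambda>e. u (h e)"]) auto
      thus ?case by simp
    qed
  qed
  show ?thesis
  proof (rule PC_intro)
    show "PB vs (\<lambda>x e. f x (h e))" by (rule sub[OF PC_PB[OF assms(1)]])
    fix \<rho> :: "nat list" and r :: nat assume h: "length \<rho> = length vs" "\<forall>a\<in>set \<rho>. a < r"
    define pos where "pos u = (SOME i. i < length vs \<and> vs ! i = (\<lambda>e. u (h e)))" for u
    have pos: "pos u < length vs \<and> vs ! pos u = (\<lambda>e. u (h e))" if "u \<in> set us" for u
    proof -
      have "(\<lambda>e. u (h e)) \<in> set vs" using assms(2) that by blast
      then obtain i where "i < length vs \<and> vs ! i = (\<lambda>e. u (h e))"
        unfolding in_set_conv_nth by blast
      thus ?thesis unfolding pos_def by (rule someI)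
    qed
    define \<sigma> where "\<sigma> = map (\<lambda>u. \<rho> ! pos u) us"
    have s2: "\<forall>a\<in>set \<sigma>. a < r"
    proof
      fix a assume "a \<in> set \<sigma>"
      then obtain u where u: "u \<in> set us" "a = \<rho> ! pos u" unfolding \<sigma>_def by auto
      have "pos u < length \<rho>" using pos[OF u(1)] h(1) by (elim conjE) simp
      thus "a < r" using h(2) u(2) nth_mem by blast
    qed
    have s1: "length \<sigma> = length us" by (simp add: \<sigma>_def)
    obtain c T where T: "PB us T" and c:
      "\<And>x e R w. map R \<sigma> = map (\<lambda>v. v e) us \<Longrightarrow> (\<forall>q\<ge>r. R q = 0) \<Longrightarrow>
          runs x c (0, R, w) (T x e) (0, R(r := f x e), w)"
      by (rule PC_obtain[OF assms(1) s1 s2]) (rule that)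
    show "\<exists>c T. PB vs T \<and> (\<forall>x e R w. map R \<rho> = map (\<lambda>v. v e) vs \<longrightarrow> (\<forall>q\<ge>r. R q = 0) \<longrightarrow>
          runs x c (0, R, w) (T x e) (0, R(r := f x (h e)), w))"
    proof (intro exI[of _ c] exI[of _ "\<lambda>x e. T x (h e)"] conjI allI impI)
      fix x :: "bool list" and e and R :: "nat \<Rightarrow> nat" and w :: "bool list" assume R: "map R \<rho> = map (\<lambda>v. v e) vs" "\<forall>q\<ge>r. R q = 0"
      have *: "R (\<rho> ! i) = (vs ! i) e" if "i < length vs" for i
        using arg_cong[OF R(1), of "\<lambda>l. l ! i"] that h(1) by simp
      have "R (\<rho> ! pos u) = u (h e)" if "u \<in> set us" for u
        using *[of "pos u"] pos[OF that] by (elim conjE) simp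
      hence "map R \<sigma> = map (\<lambda>v. v (h e)) us" by (simp add: \<sigma>_def)
      from c[OF this R(2)] show "runs x c (0, R, w) (T x (h e)) (0, R(r := f x (h e)), w)" .
    qed (rule sub[OF T])
  qed
qed

text \<open>The value of \<open>g\<close> occupies \<open>r\<close> as an additional argument of
  \<open>f\<close>, whose result appears in \<open>Suc r\<close> and is moved down after
  \<open>r\<close> has been cleared.\<close>

lemma PC_Let:
  assumes f: "PC (lift vs @ [snd]) (\<lambda>x p. f x (fst p) (snd p))" and g: "PC vs g"
  shows "PC vs (\<lambda>x e. f x e (g x e))"
proof (rule PC_intro)
  show "PB vs (\<lambda>x e. f x e (g x e))" using PB_let[OF PC_PB[OF f] PC_PB[OF g]] by simp
  fix \<rho> :: "nat list" and r :: nat assume h: "length \<rho> = length vs" "\<forall>a\<in>set \<rho>. a < r"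
  obtain c T where T: "PB vs T" and c:
    "\<And>x e R w. map R \<rho> = map (\<lambda>v. v e) vs \<Longrightarrow> (\<forall>q\<ge>r. R q = 0) \<Longrightarrow>
        runs x c (0, R, w) (T x e) (0, R(r := g x e), w)"
    by (rule PC_obtain[OF g h]) (rule that)
  have h': "length (\<rho> @ [r]) = length (lift vs @ [snd])" "\<forall>a\<in>set (\<rho> @ [r]). a < Suc r"
    using h by auto
  obtain d U where U: "PB (lift vs @ [snd]) U" and d:
    "\<And>x p R w. map R (\<rho> @ [r]) = map (\<lambda>v. v p) (lift vs @ [snd]) \<Longrightarrow> (\<forall>q\<ge>Suc r. R q = 0) \<Longrightarrow>
        runs x d (0, R, w) (U x p) (0, R(Suc r := f x (fst p) (snd p)), w)"
    by (rule PC_obtain[OF f h']) (rule that)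
  show "\<exists>c T. PB vs T \<and> (\<forall>x e R w. map R \<rho> = map (\<lambda>v. v e) vs \<longrightarrow> (\<forall>q\<ge>r. R q = 0) \<longrightarrow>
        runs x c (0, R, w) (T x e) (0, R(r := f x e (g x e)), w))"
  proof (intro exI[of _ "Seq c (Seq d (Seq (clr r) (mv (Suc r) r)))"]
      exI[of _ "\<lambda>x e. T x e + (U x (e, g x e) + (g x e * 2 + (f x e (g x e) * 4 + 10)))"] conjI allI impI)
    fix x :: "bool list" and e and R :: "nat \<Rightarrow> nat" and w :: "bool list" assume R: "map R \<rho> = map (\<lambda>v. v e) vs" "\<forall>q\<ge>r. R q = 0"
    have notin: "q \<notin> set \<rho>" if "r \<le> q" for q using h(2) that by auto
    let ?R = "R(r := g x e)"
    have 1: "map ?R (\<rho> @ [r]) = map (\<lambda>v. v (e, g x e)) (lift vs @ [snd])"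
      using R(1) notin by (simp add: comp_def)
    have 2: "\<forall>q\<ge>Suc r. ?R q = 0" using R(2) by simp
    show "runs x (Seq c (Seq d (Seq (clr r) (mv (Suc r) r)))) (0, R, w)
       (T x e + (U x (e, g x e) + (g x e * 2 + (f x e (g x e) * 4 + 10)))) (0, R(r := f x e (g x e)), w)"
      apply (rule runs_Seq'[OF c[OF R]])
       apply (rule runs_Seq'[OF d[OF 1 2]])
        apply (rule runs_Seq'[OF runs_clr])
         apply (rule runs_eq[OF runs_mv _ order_refl])
      using R(2) by (auto simp: fun_eq_iff)
  next
    have "PB vs (\<lambda>x e. f x e (g x e))" using PB_let[OF PC_PB[OF f] PC_PB[OF g]] by simp
    thus "PB vs (\<lambda>x e. T x e + (U x (e, g x e) + (g x e * 2 + (f x e (g x e) * 4 + 10))))"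
      by (intro PB_add PB_mult PB_const T PC_PB[OF g] PB_let[OF U PC_PB[OF g]])
  qed
qed

lemma PC_if0:
  assumes b: "PC vs b" and f: "PC vs f" and g: "PC vs g"
  shows "PC vs (\<lambda>x e. if b x e = 0 then f x e else g x e)"
proof (rule PC_intro)
  show "PB vs (\<lambda>x e. if b x e = 0 then f x e else g x e)"
    by (rule PB_mono[OF PB_add[OF PC_PB[OF f] PC_PB[OF g]]]) simp
  fix \<rho> :: "nat list" and r :: nat assume h: "length \<rho> = length vs" "\<forall>a\<in>set \<rho>. a < r"
  obtain c0 T0 where T0: "PB vs T0" and c0:
    "\<And>x e R w. map R \<rho> = map (\<lambda>v. v e) vs \<Longrightarrow> (\<forall>q\<ge>r. R q = 0) \<Longrightarrow>
        runs x c0 (0, R, w) (T0 x e) (0, R(r := b x e), w)"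
    by (rule PC_obtain[OF b h]) (rule that)
  obtain c1 T1 where T1: "PB vs T1" and c1:
    "\<And>x e R w. map R \<rho> = map (\<lambda>v. v e) vs \<Longrightarrow> (\<forall>q\<ge>r. R q = 0) \<Longrightarrow>
        runs x c1 (0, R, w) (T1 x e) (0, R(r := f x e), w)"
    by (rule PC_obtain[OF f h]) (rule that)
  obtain c2 T2 where T2: "PB vs T2" and c2:
    "\<And>x e R w. map R \<rho> = map (\<lambda>v. v e) vs \<Longrightarrow> (\<forall>q\<ge>r. R q = 0) \<Longrightarrow>
        runs x c2 (0, R, w) (T2 x e) (0, R(r := g x e), w)"
    by (rule PC_obtain[OF g h]) (rule that)
  show "\<exists>c T. PB vs T \<and> (\<forall>x e R w. map R \<rho> = map (\<lambda>v. v e) vs \<longrightarrow> (\<forall>q\<ge>r. R q = 0) \<longrightarrow>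
        runs x c (0, R, w) (T x e) (0, R(r := if b x e = 0 then f x e else g x e), w))"
  proof (intro exI[of _ "Seq c0 (Cond (Nz r) (Seq (clr r) c2) c1)"]
      exI[of _ "\<lambda>x e. T0 x e + (T1 x e + (T2 x e + (b x e * 2 + 10)))"] conjI allI impI)
    fix x :: "bool list" and e and R :: "nat \<Rightarrow> nat" and w :: "bool list" assume R: "map R \<rho> = map (\<lambda>v. v e) vs" "\<forall>q\<ge>r. R q = 0"
    have 0: "(R(r := b x e))(r := 0) = R" using R(2) by auto
    have 1: "R(r := b x e) = R" if "b x e = 0" using R(2) that by auto
    have 2: "runs x (if holds x (Nz r) (0, R(r := b x e), w) then Seq (clr r) c2 else c1)
       (0, R(r := b x e), w) (T1 x e + (T2 x e + (b x e * 2 + 3))) (0, R(r := if b x e = 0 then f x e else g x e), w)"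
    proof (cases "b x e = 0")
      case True
      have "runs x c1 (0, R, w) (T1 x e + (T2 x e + (b x e * 2 + 3))) (0, R(r := f x e), w)"
        by (rule runs_mono[OF c1[OF R]]) simp
      moreover have "\<not> holds x (Nz r) (0, R(r := b x e), w)" using True by simp
      ultimately show ?thesis using True 1 R(2) by simp
    next
      case False
      have "runs x (Seq (clr r) c2) (0, R(r := b x e), w) (T1 x e + (T2 x e + (b x e * 2 + 3))) (0, R(r := g x e), w)"
        apply (rule runs_Seq'[OF runs_clr])
         apply (unfold 0)
         apply (rule c2[OF R])
        by simp
      with False show ?thesis by simp
    qed
    show "runs x (Seq c0 (Cond (Nz r) (Seq (clr r) c2) c1)) (0, R, w)
       (T0 x e + (T1 x e + (T2 x e + (b x e * 2 + 10)))) (0, R(r := if b x e = 0 then f x e else g x e), w)"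
      by (rule runs_Seq'[OF c0[OF R] runs_Cond[OF 2]]) simp
  qed (intro PB_intros T0 T1 T2 PC_PB[OF b])
qed

text \<open>The input head walks right while \<open>r\<close> is used up. \<open>Suc r\<close> keeps
  the distance for the way back, since every program has to return the head to cell 0.\<close>

lemma PC_contents:
  assumes g: "PC vs g"
  shows "PC vs (\<lambda>x e. contents x (int (g x e)))"
proof (rule PC_intro)
  show "PB vs (\<lambda>x e. contents x (int (g x e)))"
    by (rule PB_mono[OF PB_const[of _ 2]]) (simp add: contents_def)
  fix \<rho> :: "nat list" and r :: nat assume h: "length \<rho> = length vs" "\<forall>a\<in>set \<rho>. a < r"
  obtain c T where T: "PB vs T" and c:
    "\<And>x e R w. map R \<rho> = map (\<lambda>v. v e) vs \<Longrightarrow> (\<forall>q\<ge>r. R q = 0) \<Longrightarrow>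
        runs x c (0, R, w) (T x e) (0, R(r := g x e), w)"
    by (rule PC_obtain[OF g h]) (rule that)
  define d where "d = Seq c (Seq (Loop (Nz r) (Seq (Dec r) (Seq (Inc (Suc r)) MvR)))
     (Seq (Cond (Sym {1}) (Inc r) (Cond (Sym {2}) (Seq (Inc r) (Inc r)) Skip))
       (Loop (Nz (Suc r)) (Seq (Dec (Suc r)) MvL))))"
  show "\<exists>c T. PB vs T \<and> (\<forall>x e R w. map R \<rho> = map (\<lambda>v. v e) vs \<longrightarrow> (\<forall>q\<ge>r. R q = 0) \<longrightarrow>
        runs x c (0, R, w) (T x e) (0, R(r := contents x (int (g x e))), w))"
  proof (intro exI[of _ d] exI[of _ "\<lambda>x e. T x e + (g x e * 10 + 20)"] conjI allI impI)
    fix x :: "bool list" and e and R :: "nat \<Rightarrow> nat" and w :: "bool list" assume R: "map R \<rho> = map (\<lambda>v. v e) vs" "\<forall>q\<ge>r. R q = 0"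
    let ?n = "g x e"
    let ?s1 = "\<lambda>j. (int j, R(r := ?n - j, Suc r := j), w)"
    have 1: "runs x (Loop (Nz r) (Seq (Dec r) (Seq (Inc (Suc r)) MvR))) (?s1 0) (?n * Suc 5 + 1) (?s1 ?n)"
    proof (rule runs_Loop)
      fix j assume "j < ?n"
      show "runs x (Seq (Dec r) (Seq (Inc (Suc r)) MvR)) (?s1 j) 5 (?s1 (Suc j))"
        apply (rule runs_Seq'[OF runs_atoms(3)])
         apply (rule runs_Seq'[OF runs_atoms(2)])
          apply (rule runs_eq[OF runs_atoms(4) _ order_refl])
        by (auto simp: fun_eq_iff)
    qed auto
    have s0: "?s1 0 = (0, R(r := ?n), w)" using R(2) by (auto simp: fun_eq_iff)
    let ?v = "contents x (int ?n)"
    let ?s2 = "\<lambda>j. (int (?n - j), R(r := ?v, Suc r := ?n - j), w)"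
    have 2: "runs x (Cond (Sym {1}) (Inc r) (Cond (Sym {2}) (Seq (Inc r) (Inc r)) Skip)) (?s1 ?n) 6 (?s2 0)"
    proof -
      consider "?v = 0" | "?v = 1" | "?v = 2" unfolding contents_def by presburger
      thus ?thesis
      proof cases
        case 1
        have "runs x (Cond (Sym {1}) (Inc r) (Cond (Sym {2}) (Seq (Inc r) (Inc r)) Skip)) (?s1 ?n) 3 (?s1 ?n)"
          using runs_Cond[of x "Sym {1}" "?s1 ?n" "Inc r" "Cond (Sym {2}) (Seq (Inc r) (Inc r)) Skip" 2]
            runs_Cond[of x "Sym {2}" "?s1 ?n" "Seq (Inc r) (Inc r)" Skip 1] 1 runs_atoms(1)
          by (simp add: numeral_eq_Suc)
        thus ?thesis by (rule runs_eq) (auto simp: 1)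
      next
        case 2
        have "runs x (Cond (Sym {1}) (Inc r) (Cond (Sym {2}) (Seq (Inc r) (Inc r)) Skip)) (?s1 ?n) (Suc 1)
           (int ?n, (R(r := ?n - ?n, Suc r := ?n))(r := Suc ((R(r := ?n - ?n, Suc r := ?n)) r)), w)"
          apply (rule runs_Cond)
          apply (subst if_P)
          using 2 apply simp
          apply (rule runs_atoms(2))
          done
        thus ?thesis by (rule runs_eq) (auto simp: 2)
      next
        case 3
        have *: "runs x (Seq (Inc r) (Inc r)) (?s1 ?n) 4 (?s2 0)"
          apply (rule runs_Seq'[OF runs_atoms(2)])
           apply (rule runs_eq[OF runs_atoms(2) _ order_refl])
          using 3 by (auto simp: fun_eq_iff)
        have "runs x (Cond (Sym {1}) (Inc r) (Cond (Sym {2}) (Seq (Inc r) (Inc r)) Skip)) (?s1 ?n) (Suc (Suc 4)) (?s2 0)"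
          apply (rule runs_Cond)
          apply (subst if_not_P)
          using 3 apply simp
          apply (rule runs_Cond)
          apply (subst if_P)
          using 3 apply simp
          by (rule *)
        thus ?thesis by simp
      qed
    qed
    have 3: "runs x (Loop (Nz (Suc r)) (Seq (Dec (Suc r)) MvL)) (?s2 0) (?n * Suc 3 + 1) (?s2 ?n)"
    proof (rule runs_Loop)
      fix j assume "j < ?n"
      show "runs x (Seq (Dec (Suc r)) MvL) (?s2 j) 3 (?s2 (Suc j))"
        apply (rule runs_Seq'[OF runs_atoms(3)])
         apply (rule runs_eq[OF runs_atoms(5) _ order_refl])
        using \<open>j < ?n\<close> by (auto simp: fun_eq_iff)
    qed auto
    show "runs x d (0, R, w) (T x e + (?n * 10 + 20)) (0, R(r := ?v), w)"
      unfolding d_def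
      apply (rule runs_Seq'[OF c[OF R]])
       apply (rule runs_Seq'[OF 1[unfolded s0]])
        apply (rule runs_Seq'[OF 2])
         apply (rule runs_eq[OF 3 _ order_refl])
      using R(2) by (auto simp: fun_eq_iff)
  qed (intro PB_intros T PC_PB[OF g])
qed

lemma PC_length: "PC vs (\<lambda>x e. length x)"
proof (rule PC_intro)
  fix \<rho> :: "nat list" and r :: nat
  define d where "d = Seq (Loop (Sym {1, 2}) (Seq (Inc r) (Seq (Inc (Suc r)) MvR)))
       (Loop (Nz (Suc r)) (Seq (Dec (Suc r)) MvL))"
  show "\<exists>c T. PB vs T \<and> (\<forall>x e R w. map R \<rho> = map (\<lambda>v. v e) vs \<longrightarrow> (\<forall>q\<ge>r. R q = 0) \<longrightarrow>
        runs x c (0, R, w) (T x e) (0, R(r := length x), w))"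
  proof (intro exI[of _ d] exI[of _ "\<lambda>x e. length x * 10 + 20"] conjI allI impI)
    fix x :: "bool list" and e and R :: "nat \<Rightarrow> nat" and w :: "bool list" assume R: "\<forall>q\<ge>r. R q = 0"
    let ?n = "length x"
    let ?s1 = "\<lambda>j. (int j, R(r := j, Suc r := j), w)"
    have 1: "runs x (Loop (Sym {1, 2}) (Seq (Inc r) (Seq (Inc (Suc r)) MvR))) (?s1 0) (?n * Suc 5 + 1) (?s1 ?n)"
    proof (rule runs_Loop)
      fix j assume "j < ?n"
      show "runs x (Seq (Inc r) (Seq (Inc (Suc r)) MvR)) (?s1 j) 5 (?s1 (Suc j))"
        apply (rule runs_Seq'[OF runs_atoms(2)])
         apply (rule runs_Seq'[OF runs_atoms(2)])
          apply (rule runs_eq[OF runs_atoms(4) _ order_refl])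
        by (auto simp: fun_eq_iff)
    qed (auto simp: contents_def)
    have s0: "?s1 0 = (0, R, w)" using R by (auto simp: fun_eq_iff)
    let ?s2 = "\<lambda>j. (int (?n - j), R(r := ?n, Suc r := ?n - j), w)"
    have 3: "runs x (Loop (Nz (Suc r)) (Seq (Dec (Suc r)) MvL)) (?s2 0) (?n * Suc 3 + 1) (?s2 ?n)"
    proof (rule runs_Loop)
      fix j assume "j < ?n"
      show "runs x (Seq (Dec (Suc r)) MvL) (?s2 j) 3 (?s2 (Suc j))"
        apply (rule runs_Seq'[OF runs_atoms(3)])
         apply (rule runs_eq[OF runs_atoms(5) _ order_refl])
        using \<open>j < ?n\<close> by (auto simp: fun_eq_iff)
    qed auto
    have s1: "?s1 ?n = ?s2 0" by simp
    show "runs x d (0, R, w) (?n * 10 + 20) (0, R(r := ?n), w)"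
      unfolding d_def
      apply (rule runs_Seq'[OF 1[unfolded s0 s1]])
       apply (rule runs_eq[OF 3 _ order_refl])
      using R by (auto simp: fun_eq_iff)
  qed (intro PB_intros)
qed (rule PB_len)

lemma PC_rec:
  assumes N: "PC vs N" and i: "PC vs i"
    and s: "PC (lift vs @ [\<lambda>p. fst (snd p), \<lambda>p. snd (snd p)]) (\<lambda>x p. s x (fst p) (fst (snd p)) (snd (snd p)))"
    and B: "PB vs B" "\<And>x e j. j \<le> N x e \<Longrightarrow> rec_nat (i x e) (s x e) j \<le> B x e"
  shows "PC vs (\<lambda>x e. rec_nat (i x e) (s x e) (N x e))"
proof (rule PC_intro)
  show "PB vs (\<lambda>x e. rec_nat (i x e) (s x e) (N x e))"
    by (rule PB_mono[OF B(1)]) (simp add: B(2))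
  fix \<rho> :: "nat list" and r :: nat assume h: "length \<rho> = length vs" "\<forall>a\<in>set \<rho>. a < r"
  obtain c1 T1 where T1: "PB vs T1" and c1:
    "\<And>x e R w. map R \<rho> = map (\<lambda>v. v e) vs \<Longrightarrow> (\<forall>q\<ge>r. R q = 0) \<Longrightarrow>
        runs x c1 (0, R, w) (T1 x e) (0, R(r := N x e), w)"
    by (rule PC_obtain[OF N h]) (rule that)
  obtain c2 T2 where T2: "PB vs T2" and c2:
    "\<And>x e R w. map R \<rho> = map (\<lambda>v. v e) vs \<Longrightarrow> (\<forall>q\<ge>r+2. R q = 0) \<Longrightarrow>
        runs x c2 (0, R, w) (T2 x e) (0, R(r+2 := i x e), w)"
    by (rule PC_obtain[OF i h(1), of "r+2"]) (use h(2) in force, rule that)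
  have h': "length (\<rho> @ [r+1, r+2]) = length (lift vs @ [\<lambda>p. fst (snd p), \<lambda>p. snd (snd p)])"
    "\<forall>a\<in>set (\<rho> @ [r+1, r+2]). a < r+3"
    using h by auto
  obtain c3 T3 where T3: "PB (lift vs @ [\<lambda>p. fst (snd p), \<lambda>p. snd (snd p)]) T3" and c3:
    "\<And>x p R w. map R (\<rho> @ [r+1, r+2]) = map (\<lambda>v. v p) (lift vs @ [\<lambda>p. fst (snd p), \<lambda>p. snd (snd p)]) \<Longrightarrow>
       (\<forall>q\<ge>r+3. R q = 0) \<Longrightarrow>
        runs x c3 (0, R, w) (T3 x p) (0, R(r+3 := s x (fst p) (fst (snd p)) (snd (snd p))), w)"
    by (rule PC_obtain[OF s h']) (rule that)
  obtain k where k: "\<And>x p. T3 x p \<le> esize (lift vs @ [\<lambda>p. fst (snd p), \<lambda>p. snd (snd p)]) x p ^ k"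
    using T3 unfolding PB_def by blast
  \<comment> \<open>The time of the step program depends on index and accumulator; \<open>U\<close>
    bounds it uniformly over all rounds.\<close>
  define U where "U x e = (esize vs x e + (N x e + B x e)) ^ k" for x e
  have U: "PB vs U" unfolding U_def esize_def by (intro PB_intros PB_sum B PC_PB[OF N])
  have T3U: "T3 x (e, j, a) \<le> U x e" if "j \<le> N x e" "a \<le> B x e" for x e j a
  proof -
    have "esize (lift vs @ [\<lambda>p. fst (snd p), \<lambda>p. snd (snd p)]) x (e, j, a) \<le> esize vs x e + (N x e + B x e)"
      using that by (simp add: esize_def comp_def)
    thus ?thesis unfolding U_def using k le_trans power_mono by blast
  qed
  define body where "body = Seq (Dec r) (Seq c3 (Seq (clr (r+2)) (Seq (mv (r+3) (r+2)) (Inc (r+1)))))"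
  define d where "d = Seq c1 (Seq c2 (Seq (Loop (Nz r) body) (Seq (clr (r+1)) (mv (r+2) r))))"
  show "\<exists>c T. PB vs T \<and> (\<forall>x e R w. map R \<rho> = map (\<lambda>v. v e) vs \<longrightarrow> (\<forall>q\<ge>r. R q = 0) \<longrightarrow>
        runs x c (0, R, w) (T x e) (0, R(r := rec_nat (i x e) (s x e) (N x e)), w))"
  proof (intro exI[of _ d] exI[of _ "\<lambda>x e. T1 x e + (T2 x e + (N x e * Suc (U x e + (B x e * 6 + 15)) + (N x e * 2 + (B x e * 4 + 20))))"] conjI allI impI)
    fix x :: "bool list" and e and R :: "nat \<Rightarrow> nat" and w :: "bool list" assume R: "map R \<rho> = map (\<lambda>v. v e) vs" "\<forall>q\<ge>r. R q = 0"
    have notin: "q \<notin> set \<rho>" if "r \<le> q" for q using h(2) that by auto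
    let ?n = "N x e"
    let ?a = "rec_nat (i x e) (s x e)"
    let ?st = "\<lambda>j. (0::int, R(r := ?n - j, r+1 := j, r+2 := ?a j), w)"
    have 1: "runs x (Loop (Nz r) body) (?st 0) (?n * Suc (U x e + (B x e * 6 + 15)) + 1) (?st ?n)"
    proof (rule runs_Loop)
      fix j assume j: "j < ?n"
      let ?R = "R(r := ?n - Suc j, r+1 := j, r+2 := ?a j)"
      have m: "map ?R (\<rho> @ [r+1, r+2]) = map (\<lambda>v. v (e, j, ?a j)) (lift vs @ [\<lambda>p. fst (snd p), \<lambda>p. snd (snd p)])"
        using R(1) notin by (simp add: comp_def)
      have z: "\<forall>q\<ge>r+3. ?R q = 0" using R(2) by simp
      have 3: "runs x c3 (0, ?R, w) (U x e) (0, ?R(r+3 := ?a (Suc j)), w)"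
        by (rule runs_eq[OF c3[OF m z]]) (use T3U j B(2)[of j x e] in \<open>simp_all add: fun_eq_iff\<close>)
      have b: "?a j \<le> B x e" "?a (Suc j) \<le> B x e" using B(2)[of j x e] B(2)[of "Suc j" x e] j by auto
      have 2: "runs x (Dec r) (?st j) 1 (0, ?R, w)"
        by (rule runs_eq[OF runs_atoms(3) _ order_refl]) (auto simp: fun_eq_iff)
      show "runs x body (?st j) (U x e + (B x e * 6 + 15)) (?st (Suc j))"
        unfolding body_def
        apply (rule runs_Seq'[OF 2])
         apply (rule runs_Seq'[OF 3])
          apply (rule runs_Seq'[OF runs_clr])
           apply (rule runs_Seq'[OF runs_mv])
             apply simp
            apply (rule runs_eq[OF runs_atoms(2) _ order_refl])
        using R(2) b by (auto simp: fun_eq_iff)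
    qed auto
    have m: "map (R(r := ?n)) \<rho> = map (\<lambda>v. v e) vs"
      using R(1) notin by (simp add: comp_def)
    have z: "\<forall>q\<ge>r+2. (R(r := ?n)) q = 0" using R(2) by simp
    have 2: "runs x c2 (0, R(r := ?n), w) (T2 x e) (?st 0)"
      by (rule runs_eq[OF c2[OF m z] _ order_refl]) (use R(2) in \<open>auto simp: fun_eq_iff\<close>)
    have b: "?a ?n \<le> B x e" using B(2)[of ?n x e] by simp
    show "runs x d (0, R, w) (T1 x e + (T2 x e + (N x e * Suc (U x e + (B x e * 6 + 15)) + (N x e * 2 + (B x e * 4 + 20))))) (0, R(r := ?a ?n), w)"
      unfolding d_def
      apply (rule runs_Seq'[OF c1[OF R]])
       apply (rule runs_Seq'[OF 2])
        apply (rule runs_Seq'[OF 1])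
         apply (rule runs_Seq'[OF runs_clr])
          apply (rule runs_eq[OF runs_mv _ order_refl])
      using R(2) b by (auto simp: fun_eq_iff)
  next
    have "PB vs (\<lambda>x e. T1 x e + (T2 x e + (N x e * (1 + (U x e + (B x e * 6 + 15))) + (N x e * 2 + (B x e * 4 + 20)))))"
      by (intro PB_intros T1 T2 U PC_PB[OF N] B(1))
    thus "PB vs (\<lambda>x e. T1 x e + (T2 x e + (N x e * Suc (U x e + (B x e * 6 + 15)) + (N x e * 2 + (B x e * 4 + 20)))))"
      by simp
  qed
qed

section \<open>Arithmetic, bounded quantifiers and finite tables\<close>

lemma PC_cong: "PC vs f \<Longrightarrow> (\<And>x e. g x e = f x e) \<Longrightarrow> PC vs g"
  by (metis ext)

lemma PD_cong: "PD vs P \<Longrightarrow> (\<And>x e. Q x e = P x e) \<Longrightarrow> PD vs Q"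
  unfolding PD_def by (erule PC_cong) simp

lemma PC_const: "PC vs (\<lambda>x e. c)"
  by (induction c) (auto intro: PC_zero PC_Suc)

lemma PC_lift: "PC vs f \<Longrightarrow> PC (lift vs @ ws) (\<lambda>x p. f x (fst p))"
  by (rule PC_reindex[where h = fst]) auto

lemma PC_add: assumes f: "PC vs f" and g: "PC vs g" shows "PC vs (\<lambda>x e. f x e + g x e)"
proof -
  have eq: "rec_nat (f x e) (\<lambda>j a. Suc a) n = f x e + n" for x e n by (induction n) auto
  have "PC vs (\<lambda>x e. rec_nat (f x e) ((\<lambda>x e j a. Suc a) x e) (g x e))"
  proof (rule PC_rec[OF g f, where B = "\<lambda>x e. f x e + g x e"])
    show "PC (lift vs @ [\<lambda>p. fst (snd p), \<lambda>p. snd (snd p)]) (\<lambda>x p. Suc (snd (snd p)))"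
      by (intro PC_Suc PC_var[where v = "\<lambda>p. snd (snd p)"]) simp
    show "PB vs (\<lambda>x e. f x e + g x e)" by (intro PB_add PC_PB[OF f] PC_PB[OF g])
  qed (simp add: eq)
  thus ?thesis by (simp add: eq)
qed

lemma PC_mult: assumes f: "PC vs f" and g: "PC vs g" shows "PC vs (\<lambda>x e. f x e * g x e)"
proof -
  have eq: "rec_nat 0 (\<lambda>j a. a + f x e) n = f x e * n" for x e n by (induction n) auto
  have "PC vs (\<lambda>x e. rec_nat ((\<lambda>x e. 0) x e) ((\<lambda>x e j a. a + f x e) x e) (g x e))"
  proof (rule PC_rec[OF g, where B = "\<lambda>x e. f x e * g x e"])
    show "PC (lift vs @ [\<lambda>p. fst (snd p), \<lambda>p. snd (snd p)]) (\<lambda>x p. snd (snd p) + f x (fst p))"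
      by (intro PC_add PC_lift[OF f] PC_var[where v = "\<lambda>p. snd (snd p)"]) simp
    show "PB vs (\<lambda>x e. f x e * g x e)" by (intro PB_mult PC_PB[OF f] PC_PB[OF g])
  qed (simp_all add: eq PC_zero)
  thus ?thesis by (simp add: eq)
qed

lemma PC_diff: assumes f: "PC vs f" and g: "PC vs g" shows "PC vs (\<lambda>x e. f x e - g x e)"
proof -
  have eq: "rec_nat (f x e) (\<lambda>j a. a - 1) n = f x e - n" for x e n by (induction n) auto
  have "PC vs (\<lambda>x e. rec_nat (f x e) ((\<lambda>x e j a. a - 1) x e) (g x e))"
  proof (rule PC_rec[OF g f, where B = f])
    show "PC (lift vs @ [\<lambda>p. fst (snd p), \<lambda>p. snd (snd p)]) (\<lambda>x p. snd (snd p) - 1)"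
      by (intro PC_pred PC_var[where v = "\<lambda>p. snd (snd p)"]) simp
  qed (unfold eq, auto intro: PC_PB f)
  thus ?thesis by (simp only: eq)
qed

lemma PC_If:
  assumes "PD vs P" "PC vs f" "PC vs g"
  shows "PC vs (\<lambda>x e. if P x e then f x e else g x e)"
  by (rule PC_cong[OF PC_if0[OF assms(1)[unfolded PD_def] assms(3,2)]]) simp

lemma PD_not: assumes "PD vs P" shows "PD vs (\<lambda>x e. \<not> P x e)"
  unfolding PD_def by (rule PC_cong[OF PC_If[OF assms PC_const[of vs 0] PC_const[of vs 1]]]) simp

lemma PD_conj: assumes "PD vs P" "PD vs Q" shows "PD vs (\<lambda>x e. P x e \<and> Q x e)"
  unfolding PD_def
  by (rule PC_cong[OF PC_If[OF assms(1) assms(2)[unfolded PD_def] PC_const[of vs 0]]]) simp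

lemma PD_disj: assumes "PD vs P" "PD vs Q" shows "PD vs (\<lambda>x e. P x e \<or> Q x e)"
  by (rule PD_cong[OF PD_not[OF PD_conj[OF PD_not[OF assms(1)] PD_not[OF assms(2)]]]]) simp

lemma PD_imp: assumes "PD vs P" "PD vs Q" shows "PD vs (\<lambda>x e. P x e \<longrightarrow> Q x e)"
  by (rule PD_cong[OF PD_disj[OF PD_not[OF assms(1)] assms(2)]]) simp

lemma PD_nonzero: assumes "PC vs f" shows "PD vs (\<lambda>x e. f x e \<noteq> 0)"
  unfolding PD_def
  by (rule PC_cong[OF PC_if0[OF assms PC_const[of vs 0] PC_const[of vs 1]]]) simp

lemma PD_less: assumes "PC vs f" "PC vs g" shows "PD vs (\<lambda>x e. f x e < g x e)"
  by (rule PD_cong[OF PD_nonzero[OF PC_diff[OF assms(2,1)]]]) auto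

lemma PD_le: assumes "PC vs f" "PC vs g" shows "PD vs (\<lambda>x e. f x e \<le> g x e)"
  by (rule PD_cong[OF PD_not[OF PD_less[OF assms(2,1)]]]) auto

lemma PD_eq: assumes "PC vs f" "PC vs g" shows "PD vs (\<lambda>x e. f x e = g x e)"
  by (rule PD_cong[OF PD_conj[OF PD_le[OF assms] PD_le[OF assms(2,1)]]]) auto

lemma PD_iff: assumes "PD vs P" "PD vs Q" shows "PD vs (\<lambda>x e. P x e = Q x e)"
  by (rule PD_cong[OF PD_conj[OF PD_imp[OF assms] PD_imp[OF assms(2,1)]]]) auto

lemma PD_const: "PD vs (\<lambda>x e. b)"
  unfolding PD_def by (rule PC_const)

lemma PC_sum:
  assumes N: "PC vs N" and F: "PC (lift vs @ [snd]) (\<lambda>x p. F x (fst p) (snd p))"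
  shows "PC vs (\<lambda>x e. \<Sum>j<N x e. F x e j)"
proof -
  have eq: "rec_nat 0 (\<lambda>j a. a + F x e j) n = (\<Sum>j<n. F x e j)" for x e n
    by (induction n) auto
  obtain k where k: "\<And>x p. F x (fst p) (snd p) \<le> esize (lift vs @ [snd]) x p ^ k"
    using PC_PB[OF F] unfolding PB_def by blast
  \<comment> \<open>The exponent \<open>k\<close> bounds every summand whose index is below
    \<open>N x e\<close>, hence all partial sums.\<close>
  define B where "B x e = N x e * (esize vs x e + N x e) ^ k" for x e
  have "PC vs (\<lambda>x e. rec_nat ((\<lambda>x e. 0) x e) ((\<lambda>x e j a. a + F x e j) x e) (N x e))"
  proof (rule PC_rec[OF N, where B = B])
    have "PC (lift vs @ [\<lambda>p. fst (snd p), \<lambda>p. snd (snd p)])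
       (\<lambda>x p. (\<lambda>x p. F x (fst p) (snd p)) x ((\<lambda>p. (fst p, fst (snd p))) p))"
      by (rule PC_reindex[OF F]) auto
    thus "PC (lift vs @ [\<lambda>p. fst (snd p), \<lambda>p. snd (snd p)]) (\<lambda>x p. snd (snd p) + F x (fst p) (fst (snd p)))"
      by (intro PC_add PC_var[where v = "\<lambda>p. snd (snd p)"]) auto
    show "PB vs B" unfolding B_def esize_def by (intro PB_intros PB_sum PC_PB[OF N])
    fix x e j assume "j \<le> N x e"
    have "(\<Sum>i<j. F x e i) \<le> of_nat (card {..<j}) * (esize vs x e + N x e) ^ k"
    proof (rule sum_bounded_above)
      fix i assume "i \<in> {..<j}"
      hence "esize (lift vs @ [snd]) x (e, i) \<le> esize vs x e + N x e"
        using \<open>j \<le> N x e\<close> by (simp add: esize_def comp_def)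
      thus "F x e i \<le> (esize vs x e + N x e) ^ k"
        using k[of x "(e, i)"] by (auto intro: order.trans power_mono)
    qed
    also have "\<dots> \<le> B x e" using \<open>j \<le> N x e\<close> by (simp add: B_def mult_le_mono1)
    finally show "rec_nat 0 (\<lambda>j a. a + F x e j) j \<le> B x e" by (simp add: eq)
  qed (rule PC_zero)
  thus ?thesis by (simp only: eq)
qed

lemma PD_ex:
  assumes "PC vs N" "PD (lift vs @ [snd]) (\<lambda>x p. P x (fst p) (snd p))"
  shows "PD vs (\<lambda>x e. \<exists>j<N x e. P x e j)"
proof -
  have "PD vs (\<lambda>x e. (\<Sum>j<N x e. if P x e j then 1 else 0) \<noteq> (0::nat))"
    by (intro PD_nonzero PC_sum assms assms(2)[unfolded PD_def])
  thus ?thesis by (rule PD_cong) (auto simp: sum_eq_0_iff split: if_splits)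
qed

lemma PD_all:
  assumes "PC vs N" "PD (lift vs @ [snd]) (\<lambda>x p. P x (fst p) (snd p))"
  shows "PD vs (\<lambda>x e. \<forall>j<N x e. P x e j)"
  using PD_not[OF PD_ex[OF assms(1) PD_not[OF assms(2)]]] by simp

text \<open>\<open>a div b\<close> is the number of \<open>j < a\<close> with
  \<open>(j + 1) * b <= a\<close>; the test for a nonzero divisor reproduces
  \<open>a div 0 = 0\<close>.\<close>

lemma PC_div: assumes f: "PC vs f" and g: "PC vs g" shows "PC vs (\<lambda>x e. f x e div g x e)"
proof -
  have v: "PC (lift vs @ [snd]) (\<lambda>x p. snd p)" by (rule PC_var) simp
  have "PC vs (\<lambda>x e. \<Sum>j<f x e. if g x e \<noteq> 0 \<and> (j + 1) * g x e \<le> f x e then 1 else 0)"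
    by (intro PC_sum f PC_If PC_const PD_conj PD_nonzero PD_le PC_mult PC_add v PC_lift[OF f] PC_lift[OF g])
  moreover have "(\<Sum>j<a. if b \<noteq> 0 \<and> (j + 1) * b \<le> a then 1 else 0) = a div b" for a b :: nat
  proof (cases "b = 0")
    case False
    have "(\<Sum>j<a. if b \<noteq> 0 \<and> (j + 1) * b \<le> a then 1 else 0) = card {j\<in>{..<a}. b \<noteq> 0 \<and> (j + 1) * b \<le> a}"
      by (simp add: sum.If_cases Int_def conj_commute)
    also have "{j\<in>{..<a}. b \<noteq> 0 \<and> (j + 1) * b \<le> a} = {..<a div b}"
    proof (intro equalityI subsetI)
      fix j assume "j \<in> {j\<in>{..<a}. b \<noteq> 0 \<and> (j + 1) * b \<le> a}"
      thus "j \<in> {..<a div b}" using less_eq_div_iff_mult_less_eq[of b "j+1" a] False by simp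
    next
      fix j assume "j \<in> {..<a div b}"
      moreover from this have "j < a" using div_le_dividend[of a b] by (simp del: div_le_dividend)
      ultimately show "j \<in> {j\<in>{..<a}. b \<noteq> 0 \<and> (j + 1) * b \<le> a}"
        using less_eq_div_iff_mult_less_eq[of b "j+1" a] False by simp
    qed
    finally show ?thesis by simp
  qed simp
  ultimately show ?thesis by simp
qed

lemma PC_mod: "PC vs f \<Longrightarrow> PC vs g \<Longrightarrow> PC vs (\<lambda>x e. f x e mod g x e)"
  by (simp only: minus_mult_div_eq_mod[symmetric]) (intro PC_diff PC_mult PC_div)

text \<open>\<open>h\<close> is arbitrary, since a bounded argument allows a finite case distinction
  inside the program. In this way the transition table of a fixed machine enters the
  reduction.\<close>

lemma PC_table:
  assumes g: "PC vs g" and b: "\<And>x e. g x e < K"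
  shows "PC vs (\<lambda>x e. h (g x e))"
proof -
  have "PC vs (\<lambda>x e. if g x e < K then h (g x e) else 0)" for K
  proof (induction K)
    case 0
    then show ?case by (simp add: PC_const)
  next
    case (Suc K)
    have "PC vs (\<lambda>x e. if g x e = K then h K else if g x e < K then h (g x e) else 0)"
      by (intro PC_If PD_eq g PC_const Suc)
    thus ?case by (rule PC_cong) auto
  qed
  from this[of K] show ?thesis using b by simp
qed

lemma PC_poly: "PC vs g \<Longrightarrow> PC vs (\<lambda>x e. poly p (g x e))"
  by (induction p) (auto intro!: PC_const PC_add PC_mult)

definition bit_at :: "bool list \<Rightarrow> nat \<Rightarrow> bool" where
  "bit_at x i \<longleftrightarrow> i < length x \<and> x ! i"

lemma PD_bit: assumes "PC vs g" shows "PD vs (\<lambda>x e. bit_at x (g x e))"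
proof -
  have "PD vs (\<lambda>x e. contents x (int (g x e)) = 2)"
    by (intro PD_eq PC_contents assms PC_const)
  thus ?thesis by (rule PD_cong) (auto simp: contents_def bit_at_def)
qed

lemma PC_comp1:
  assumes "PC [\<lambda>u. u] f" "PC vs g"
  shows "PC vs (\<lambda>x e. f x (g x e))"
proof -
  have "PC (lift vs @ [snd]) (\<lambda>x p. f x (snd p))"
    by (rule PC_reindex[OF assms(1)]) simp
  from PC_Let[OF this assms(2)] show ?thesis .
qed

text \<open>\<open>f\<close> is treated as an open term in two variables and closed by two nested
  lets. A function shown to be in the class once can thus be applied to any arguments.\<close>

lemma PC_comp2:
  assumes f: "PC [fst, snd] (\<lambda>x p. f x (fst p) (snd p))" and g: "PC vs g" and h: "PC vs h"
  shows "PC vs (\<lambda>x e. f x (g x e) (h x e))"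
proof -
  have 1: "PC (lift (lift vs @ [snd]) @ [snd]) (\<lambda>x p. f x (snd (fst p)) (snd p))"
    using PC_reindex[OF f, of "\<lambda>p. (snd (fst p), snd p)" "lift (lift vs @ [snd]) @ [snd]"] by simp
  have 2: "PC (lift vs @ [snd]) (\<lambda>x p. f x (snd p) (h x (fst p)))"
    using PC_Let[of "lift vs @ [snd]" "\<lambda>x q b. f x (snd q) b", OF 1 PC_lift[OF h]] .
  show ?thesis using PC_Let[of vs "\<lambda>x e a. f x a (h x e)", OF 2 g] .
qed

lemmas PD_comp2 = PC_comp2[where f = "\<lambda>x u v. if P x u v then 1 else 0" for P, folded PD_def]

lemmas pc_rules = PC_const PC_length PC_add PC_mult PC_diff PC_div PC_mod PC_If PC_Suc PC_sum
  PD_const PD_not PD_conj PD_disj PD_imp PD_less PD_le PD_eq PD_iff PD_ex PD_all PD_bit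

text \<open>An output word is described by its length and a predicate on positions, so that no
  program has to manipulate words. Registers 0, 1 and 2 hold the number of bits left, the position
  and the current bit.\<close>

lemma polytime_computable_bits:
  assumes N: "PC [] (\<lambda>x (_::unit). N x)" and b: "PD [\<lambda>u. u] b"
  shows "polytime_computable (\<lambda>x. map (b x) [0..<N x])"
proof -
  obtain c T where T: "PB [] T" and c:
    "\<And>x e R w. map R [] = map (\<lambda>v. v e) ([] :: (unit \<Rightarrow> nat) list) \<Longrightarrow> (\<forall>q\<ge>0. R q = 0) \<Longrightarrow>
        runs x c (0, R, w) (T x e) (0, R(0 := N x), w)"
    by (rule PC_obtain[OF N, of "[]" 0]) (simp, simp, rule that)
  obtain d U where U: "PB [\<lambda>u. u] U" and d:
    "\<And>x i R w. map R [1] = map (\<lambda>v. v i) [\<lambda>u. u] \<Longrightarrow> (\<forall>q\<ge>2. R q = 0) \<Longrightarrow>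
        runs x d (0, R, w) (U x i) (0, R(2 := if b x i then 1 else 0), w)"
    by (rule PC_obtain[OF b[unfolded PD_def], of "[1]" 2]) (simp, simp, rule that)
  define body where "body = Seq (Dec 0) (Seq d (Seq (Cond (Nz 2) (Seq (Out True) (Dec 2)) (Out False)) (Inc 1)))"
  obtain kT where kT: "\<And>x e. T x e \<le> esize [] x e ^ kT" using T unfolding PB_def by blast
  obtain kN where kN: "\<And>x. N x \<le> esize ([] :: (unit \<Rightarrow> nat) list) x () ^ kN" using PC_PB[OF N] unfolding PB_def by blast
  obtain kU where kU: "\<And>x i. U x i \<le> esize [\<lambda>u. u] x i ^ kU" using U unfolding PB_def by blast
  define S :: "nat poly" where "S = [:2, 1:]"
  have S: "poly S (length x) = 2 + length x" for x :: "bool list" by (simp add: S_def)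
  define V where "V x = (2 + length x + (2 + length x) ^ kN) ^ kU" for x :: "bool list"
  have TT: "T x e \<le> (2 + length x) ^ kT" for x e using kT[of x e] by (simp add: esize_def)
  have NN: "N x \<le> (2 + length x) ^ kN" for x using kN[of x] by (simp add: esize_def)
  have UV: "U x i \<le> V x" if "i < N x" for x i
  proof -
    have "esize [\<lambda>u. u] x i \<le> 2 + length x + (2 + length x) ^ kN"
      using that NN[of x] by (simp add: esize_def)
    thus ?thesis unfolding V_def using kU[of x i] le_trans power_mono by blast
  qed
  define P where "P = S ^ kT + S ^ kN * ((S + S ^ kN) ^ kU + 21) + 10"
  have P: "poly P (length x) = (2 + length x) ^ kT + (2 + length x) ^ kN * (V x + 21) + 10" for x :: "bool list"
    by (simp add: P_def S V_def)
  have "runs x (Seq c (Loop (Nz 0) body)) (0, \<lambda>_. 0, []) (poly P (length x))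
     (0, (\<lambda>_. 0)(1 := N x), map (b x) [0..<N x])" for x
  proof -
    let ?st = "\<lambda>j. (0::int, (\<lambda>_. 0::nat)(0 := N x - j, 1 := j), map (b x) [0..<j])"
    have 1: "runs x (Loop (Nz 0) body) (?st 0) (N x * Suc (V x + 20) + 1) (?st (N x))"
    proof (rule runs_Loop)
      fix j assume j: "j < N x"
      let ?R = "(\<lambda>_. 0::nat)(0 := N x - Suc j, 1 := j)"
      have 2: "runs x (Dec 0) (?st j) 1 (0, ?R, map (b x) [0..<j])"
        by (rule runs_eq[OF runs_atoms(3) _ order_refl]) (auto simp: fun_eq_iff)
      have 3: "runs x d (0, ?R, map (b x) [0..<j]) (V x) (0, ?R(2 := if b x j then 1 else 0), map (b x) [0..<j])"
        by (rule runs_mono[OF d UV[OF j]]) auto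
      have 4: "runs x (Cond (Nz 2) (Seq (Out True) (Dec 2)) (Out False))
         (0, ?R(2 := if b x j then 1 else 0), map (b x) [0..<j]) (Suc 3) (0, ?R, map (b x) [0..<Suc j])"
      proof (rule runs_Cond, cases "b x j")
        case True
        have "runs x (Seq (Out True) (Dec 2)) (0, ?R(2 := 1), map (b x) [0..<j]) 3 (0, ?R, map (b x) [0..<Suc j])"
          apply (rule runs_Seq'[OF runs_atoms(6)])
           apply (rule runs_eq[OF runs_atoms(3) _ order_refl])
          using True by (auto simp: fun_eq_iff)
        thus "runs x (if holds x (Nz 2) (0, ?R(2 := if b x j then 1 else 0), map (b x) [0..<j])
           then Seq (Out True) (Dec 2) else Out False)
           (0, ?R(2 := if b x j then 1 else 0), map (b x) [0..<j]) 3 (0, ?R, map (b x) [0..<Suc j])"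
          using True by simp
      next
        case False
        have "runs x (Out False) (0, ?R(2 := 0), map (b x) [0..<j]) 3 (0, ?R, map (b x) [0..<Suc j])"
          apply (rule runs_eq[OF runs_atoms(6)])
          using False by (auto simp: fun_eq_iff)
        thus "runs x (if holds x (Nz 2) (0, ?R(2 := if b x j then 1 else 0), map (b x) [0..<j])
           then Seq (Out True) (Dec 2) else Out False)
           (0, ?R(2 := if b x j then 1 else 0), map (b x) [0..<j]) 3 (0, ?R, map (b x) [0..<Suc j])"
          using False by simp
      qed
      show "runs x body (?st j) (V x + 20) (?st (Suc j))"
        unfolding body_def
        apply (rule runs_Seq'[OF 2])
         apply (rule runs_Seq'[OF 3])
          apply (rule runs_Seq'[OF 4])
           apply (rule runs_eq[OF runs_atoms(2) _ order_refl])
        by (auto simp: fun_eq_iff)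
    qed auto
    have 2: "runs x c (0, \<lambda>_. 0, []) (T x ()) (?st 0)"
      by (rule runs_eq[OF c _ order_refl]) (auto simp: fun_eq_iff)
    have "N x * Suc (V x + 20) \<le> (2 + length x) ^ kN * (V x + 21)"
      by (rule mult_le_mono[OF NN]) simp
    hence le: "T x () + (N x * Suc (V x + 20) + 1) + 1 \<le> poly P (length x)"
      unfolding P using TT[of x "()"] by linarith
    have "runs x (Seq c (Loop (Nz 0) body)) (0, \<lambda>_. 0, []) (poly P (length x)) (?st (N x))"
      by (rule runs_Seq'[OF 2 1 le])
    thus ?thesis by (rule runs_eq) (simp_all add: fun_eq_iff)
  qed
  thus ?thesis by (intro polytime_computable_runs) blast
qed

lemma PTIME_PD:
  assumes "PD [] (\<lambda>x (_::unit). P x)"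
  shows "{x. P x} \<in> PTIME"
proof -
  have "PD [\<lambda>u::nat. u] (\<lambda>x u. P x)"
    using PC_reindex[OF assms[unfolded PD_def], of "\<lambda>_. ()" "[\<lambda>u::nat. u]"] unfolding PD_def by simp
  from polytime_computable_bits[OF PC_const[of "[]" 1] this]
  show ?thesis unfolding PTIME_def by (simp add: comp_def)
qed

section \<open>Encodings, cuts, connectedness and cycles\<close>

fun bval :: "bool list \<Rightarrow> nat" where
  "bval [] = 0"
| "bval (b # bs) = (if b then 1 else 0) + 2 * bval bs"

lemma bval_binary: "bval (binary k) = k"
proof (induction k rule: less_induct)
  case (less k)
  show ?case
  proof (cases "k = 0")
    case False
    hence "bval (binary k) = (if odd k then 1 else 0) + 2 * (k div 2)"
      by (subst binary.simps) (simp add: less)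
    thus ?thesis by (auto simp: odd_two_times_div_two_succ)
  qed (simp add: binary.simps)
qed

lemma last_binary: "k \<noteq> 0 \<Longrightarrow> binary k \<noteq> [] \<and> last (binary k)"
proof (induction k rule: less_induct)
  case (less k)
  show ?case
  proof (cases "k div 2 = 0")
    case True
    hence "k = 1" using less.prems by auto
    thus ?thesis by (simp add: binary.simps)
  next
    case False
    thus ?thesis using less.IH[of "k div 2"] less.prems by (subst (1 2) binary.simps) auto
  qed
qed

lemma bval_pos: "bs \<noteq> [] \<Longrightarrow> last bs \<Longrightarrow> 0 < bval bs"
  by (induction bs) (auto split: if_splits)

text \<open>The least significant bit comes first, so having no leading zero means ending in True;
  the decoder tests this condition.\<close>

lemma binary_bval: "bs = [] \<or> last bs \<Longrightarrow> binary (bval bs) = bs"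
proof (induction bs)
  case (Cons b bs)
  show ?case
  proof (cases "bs = []")
    case True
    with Cons.prems have "b" by simp
    with True show ?thesis by (simp add: binary.simps)
  next
    case False
    with Cons.prems have "last bs" by simp
    hence "0 < bval bs" "binary (bval bs) = bs" using False bval_pos Cons.IH by auto
    thus ?thesis by (subst binary.simps) auto
  qed
qed (simp add: binary.simps)

lemma bval_sum: "bval bs = (\<Sum>j<length bs. if bs ! j then 2 ^ j else 0)"
proof (induction bs)
  case (Cons b bs)
  have "(\<Sum>j<length (b # bs). if (b # bs) ! j then 2 ^ j else 0) =
      (if b then 1 else 0) + (\<Sum>j<length bs. if bs ! j then 2 ^ Suc j else (0::nat))"
    by (simp add: sum.lessThan_Suc_shift del: sum.lessThan_Suc)
  also have "(\<Sum>j<length bs. if bs ! j then 2 ^ Suc j else (0::nat)) = 2 * (\<Sum>j<length bs. if bs ! j then 2 ^ j else 0)"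
    by (subst sum_distrib_left) (rule sum.cong, auto)
  finally show ?case using Cons by simp
qed simp

lemma bval_map_sum:
  assumes "l \<le> k"
  shows "bval (map f [0..<l]) = (\<Sum>j<k. if j < l \<and> f j then 2 ^ j else 0)"
proof -
  have "bval (map f [0..<l]) = (\<Sum>j<l. if j < l \<and> f j then 2 ^ j else 0)"
    by (subst bval_sum) (rule sum.cong, auto)
  also have "\<dots> = (\<Sum>j<k. if j < l \<and> f j then 2 ^ j else 0)"
    using assms by (intro sum.mono_neutral_left) auto
  finally show ?thesis .
qed

lemma delimit_Nil: "delimit [] = [False]"
  and delimit_Cons: "delimit (b # bs) = True # b # delimit bs"
  by (simp_all add: delimit_def)

lemma delimit_eq: "delimit x @ u = delimit y @ v \<Longrightarrow> x = y \<and> u = v"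
proof (induction x arbitrary: y)
  case Nil
  thus ?case by (cases y) (auto simp: delimit_Nil delimit_Cons)
next
  case (Cons b x)
  thus ?case by (cases y) (auto simp: delimit_Nil delimit_Cons)
qed

lemma length_delimit: "length (delimit x) = 2 * length x + 1"
  by (induction x) (auto simp: delimit_Nil delimit_Cons)

lemma nth_delimit:
  "i < length x \<Longrightarrow> delimit x ! (2 * i) \<and> delimit x ! (2 * i + 1) = x ! i"
  "\<not> delimit x ! (2 * length x)"
proof (induction x arbitrary: i)
  case (Cons b x)
  { case 1 thus ?case using Cons.IH(1)[of "i - 1"] by (cases i) (auto simp: delimit_Cons) }
  { case 2 thus ?case using Cons.IH(2) by (simp add: delimit_Cons) }
qed (auto simp: delimit_Nil)

lemma delimit_eqI:
  assumes "length xs = 2 * length x + 1" "\<And>i. i < length x \<Longrightarrow> xs ! (2 * i)"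
    "\<And>i. i < length x \<Longrightarrow> xs ! (2 * i + 1) = x ! i" "\<not> xs ! (2 * length x)"
  shows "xs = delimit x"
proof (rule nth_equalityI)
  fix j assume "j < length xs"
  hence j: "j < 2 * length x + 1" by (simp add: assms(1))
  define i where "i = j div 2"
  have "j = 2 * i \<or> j = 2 * i + 1" unfolding i_def by presburger
  with j consider "i < length x" "j = 2 * i" | "i < length x" "j = 2 * i + 1" | "j = 2 * length x"
    by (cases "i = length x") auto
  thus "xs ! j = delimit x ! j" using assms nth_delimit(1)[of i x] nth_delimit(2)[of x] by cases auto
qed (simp add: assms(1) length_delimit)

section \<open>Adjacency matrices and injectivity of the encoding\<close>

lemma concat_map_upt_nth:
  "(\<forall>u<m. length (f u) = k) \<Longrightarrow>
   length (concat (map f [0..<m])) = m * k \<and>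
   (\<forall>u<m. \<forall>v<k. concat (map f [0..<m]) ! (u * k + v) = f u ! v)"
proof (induction m)
  case (Suc m)
  hence IH: "length (concat (map f [0..<m])) = m * k"
    "\<forall>u<m. \<forall>v<k. concat (map f [0..<m]) ! (u * k + v) = f u ! v" by auto
  have "concat (map f [0..<Suc m]) ! (u * k + v) = f u ! v" if "u < Suc m" "v < k" for u v
  proof (cases "u = m")
    case False
    hence "u < m" using that by simp
    hence "u * k + v < m * k"
      using that(2) mult_le_mono1[of "Suc u" m k] by simp
    thus ?thesis using IH \<open>u < m\<close> that(2) by (simp add: nth_append)
  qed (use IH that in \<open>simp add: nth_append\<close>)
  thus ?case using IH Suc.prems by simp
qed simp

lemma length_adjacency: "length (adjacency_matrix n E) = n * n"
  and nth_adjacency: "u < n \<Longrightarrow> v < n \<Longrightarrow> adjacency_matrix n E ! (u * n + v) = ({u, v} \<in> E)"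
  using concat_map_upt_nth[of n "\<lambda>u. map (\<lambda>v. {u, v} \<in> E) [0..<n]" n]
  by (auto simp: adjacency_matrix_def)

lemma adjacency_eqI:
  assumes "length xs = n * n" "\<And>u v. u < n \<Longrightarrow> v < n \<Longrightarrow> xs ! (u * n + v) = ({u, v} \<in> E)"
  shows "xs = adjacency_matrix n E"
proof (rule nth_equalityI)
  fix j assume "j < length xs"
  hence "j < n * n" by (simp add: assms(1))
  hence "0 < n" by (cases n) auto
  hence "j div n < n" "j mod n < n" "j = j div n * n + j mod n"
    using \<open>j < n * n\<close> by (auto simp: less_mult_imp_div_less)
  thus "xs ! j = adjacency_matrix n E ! j" using assms(2) nth_adjacency by metis
qed (simp add: assms(1) length_adjacency)

lemma replicate_True_eq:
  "replicate n True @ False # u = replicate m True @ False # v \<Longrightarrow> n = m \<and> u = v"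
proof (induction n arbitrary: m)
  case 0
  thus ?case by (cases m) auto
next
  case (Suc n)
  thus ?case by (cases m) auto
qed

lemma encode_instance_inj:
  assumes "encode_instance n E T a b = encode_instance m E' T' a' b'"
  shows "n = m" "adjacency_matrix n E = adjacency_matrix n E'"
    "adjacency_matrix n T = adjacency_matrix n T'" "a = a'" "b = b'"
proof -
  let ?u = "adjacency_matrix n E @ adjacency_matrix n T @ delimit (binary a) @ delimit (binary b)"
  let ?v = "adjacency_matrix m E' @ adjacency_matrix m T' @ delimit (binary a') @ delimit (binary b')"
  have "replicate n True @ False # ?u = replicate m True @ False # ?v"
    using assms by (simp add: encode_instance_def)
  hence *: "n = m \<and> ?u = ?v" by (rule replicate_True_eq)
  thus n: "n = m" by simp
  with * have "adjacency_matrix n E = adjacency_matrix n E' \<and> adjacency_matrix n T = adjacency_matrix n T' \<and>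
     delimit (binary a) @ delimit (binary b) = delimit (binary a') @ delimit (binary b')"
    by (simp add: append_eq_append_conv length_adjacency)
  moreover from this have "binary a = binary a' \<and> delimit (binary b) = delimit (binary b')"
    using delimit_eq by blast
  moreover from this have "binary b = binary b'" using delimit_eq[of _ "[]" _ "[]"] by simp
  moreover have "a = a'" if "binary a = binary a'" for a a' using that bval_binary by metis
  ultimately show "adjacency_matrix n E = adjacency_matrix n E'"
    "adjacency_matrix n T = adjacency_matrix n T'" "a = a'" "b = b'"
    by blast+
qed

definition edges :: "nat \<Rightarrow> (nat \<Rightarrow> nat \<Rightarrow> bool) \<Rightarrow> nat set set" where
  "edges n P = {{u, v} | u v. u < n \<and> v < n \<and> P u v}"

lemma edges_mem:
  assumes "\<And>u v. u < n \<Longrightarrow> v < n \<Longrightarrow> P u v \<Longrightarrow> P v u"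
  shows "{u, v} \<in> edges n P \<longleftrightarrow> u < n \<and> v < n \<and> P u v"
  unfolding edges_def using assms by (auto simp: doubleton_eq_iff)

lemma edges_of_graph:
  assumes "\<forall>e\<in>E. e \<subseteq> {..<n} \<and> card e = 2"
  shows "edges n (\<lambda>u v. {u, v} \<in> E) = E"
proof (intro equalityI subsetI)
  fix e assume e: "e \<in> E"
  then obtain u v where "e = {u, v}" using assms by (metis card_2_iff)
  moreover from this have "u < n" "v < n" using e assms by auto
  ultimately show "e \<in> edges n (\<lambda>u v. {u, v} \<in> E)" using e unfolding edges_def by blast
qed (auto simp: edges_def)

lemma edges_cong: "(\<And>u v. u < n \<Longrightarrow> v < n \<Longrightarrow> P u v = Q u v) \<Longrightarrow> edges n P = edges n Q"
  unfolding edges_def by auto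

lemma edges_graph:
  assumes "\<And>u. u < n \<Longrightarrow> \<not> P u u" "e \<in> edges n P"
  shows "e \<subseteq> {..<n} \<and> card e = 2"
proof -
  obtain u v where e: "e = {u, v}" "u < n" "v < n" "P u v" using assms(2) unfolding edges_def by blast
  hence "u \<noteq> v" using assms(1) by blast
  thus ?thesis using e by simp
qed

text \<open>Membership in \<open>ThinTreeValid\<close> only asserts that some instance has the given
  code. For graphs on \<open>{..<n}\<close> the matrices determine the edge sets, so it is the
  instance that was encoded.\<close>

lemma encode_instance_inj_graph:
  assumes "encode_instance n E T a b = encode_instance m E' T' a' b'"
    "\<forall>e\<in>E. e \<subseteq> {..<n} \<and> card e = 2" "\<forall>e\<in>E'. e \<subseteq> {..<m} \<and> card e = 2" "T \<subseteq> E" "T' \<subseteq> E'"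
  shows "n = m \<and> E = E' \<and> T = T' \<and> a = a' \<and> b = b'"
proof -
  note i = encode_instance_inj[OF assms(1)]
  have "edges n (\<lambda>u v. {u, v} \<in> E) = edges n (\<lambda>u v. {u, v} \<in> E')"
    using i(2) by (intro edges_cong) (simp flip: nth_adjacency)
  hence "E = E'" using edges_of_graph[OF assms(2)] edges_of_graph[OF assms(3)] i(1) by simp
  have "edges n (\<lambda>u v. {u, v} \<in> T) = edges n (\<lambda>u v. {u, v} \<in> T')"
    using i(3) by (intro edges_cong) (simp flip: nth_adjacency)
  moreover have "edges n (\<lambda>u v. {u, v} \<in> T) = T" "edges m (\<lambda>u v. {u, v} \<in> T') = T'"
    by (rule edges_of_graph, use assms in blast)+
  ultimately have "T = T'" using i(1) by simp
  with \<open>E = E'\<close> show ?thesis using i by simp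
qed

section \<open>Cuts, thinness, connectedness and cycles\<close>

text \<open>Of the two orientations of a cut edge exactly one leads out of \<open>A\<close>, so
  ordered pairs count each edge once.\<close>

lemma card_cut_edges:
  assumes sym: "\<And>u v. u < n \<Longrightarrow> v < n \<Longrightarrow> P u v = P v u" and irr: "\<And>u. u < n \<Longrightarrow> \<not> P u u"
  shows "card (cut_edges (edges n P) A) = (\<Sum>u<n. \<Sum>v<n. if u \<in> A \<and> v \<notin> A \<and> P u v then 1 else 0)"
proof -
  let ?D = "{(u, v). u < n \<and> v < n \<and> u \<in> A \<and> v \<notin> A \<and> P u v}"
  have cut: "card ({u, v} \<inter> A) = 1 \<longleftrightarrow> (u \<in> A) \<noteq> (v \<in> A)" if "u \<noteq> v" for u v
    using that by (cases "u \<in> A"; cases "v \<in> A"; cases "u = v") auto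
  have "bij_betw (\<lambda>(u, v). {u, v}) ?D (cut_edges (edges n P) A)"
    unfolding bij_betw_def
  proof
    show "inj_on (\<lambda>(u, v). {u, v}) ?D" by (auto simp: inj_on_def doubleton_eq_iff)
    show "(\<lambda>(u, v). {u, v}) ` ?D = cut_edges (edges n P) A"
    proof (intro equalityI subsetI)
      fix e assume "e \<in> cut_edges (edges n P) A"
      then obtain u v where e: "e = {u, v}" "u < n" "v < n" "P u v" "card ({u, v} \<inter> A) = 1"
        unfolding cut_edges_def edges_def by blast
      hence "(u \<in> A) \<noteq> (v \<in> A)" using cut irr by metis
      hence "(u, v) \<in> ?D \<or> (v, u) \<in> ?D" using sym e by auto
      thus "e \<in> (\<lambda>(u, v). {u, v}) ` ?D" using e(1) by (auto simp: insert_commute image_iff)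
    next
      fix e assume "e \<in> (\<lambda>(u, v). {u, v}) ` ?D"
      then obtain u v where e: "e = {u, v}" "u < n" "v < n" "u \<in> A" "v \<notin> A" "P u v" by auto
      hence "card (e \<inter> A) = 1" using cut[of u v] by auto
      with e show "e \<in> cut_edges (edges n P) A" unfolding cut_edges_def edges_def by blast
    qed
  qed
  hence "card (cut_edges (edges n P) A) = card ?D" by (simp add: bij_betw_same_card)
  also have "?D = (SIGMA u:{..<n}. {v\<in>{..<n}. u \<in> A \<and> v \<notin> A \<and> P u v})" by auto
  also have "card \<dots> = (\<Sum>u<n. card {v\<in>{..<n}. u \<in> A \<and> v \<notin> A \<and> P u v})" by simp
  also have "\<dots> = (\<Sum>u<n. \<Sum>v<n. if u \<in> A \<and> v \<notin> A \<and> P u v then 1 else 0)"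
    by (rule sum.cong[OF refl]) (simp only: card_eq_sum sum.inter_filter[symmetric] finite_lessThan)
  finally show ?thesis .
qed

text \<open>The delicate case is a cut without edges of \<open>E\<close>: the quotient is then 0 by
  convention, and \<open>S\<close>, being part of \<open>E\<close>, has no edge there
  either.\<close>

lemma thin_iff:
  assumes "finite E" "S \<subseteq> E" "0 < b"
  shows "thin V E S (real a / real b) \<longleftrightarrow>
    (\<forall>A. A \<subseteq> V \<and> A \<noteq> {} \<and> A \<noteq> V \<longrightarrow> \<not> a * card (cut_edges E A) < card (cut_edges S A) * b)"
proof -
  have "real (card (cut_edges S A)) / real (card (cut_edges E A)) \<le> real a / real b \<longleftrightarrow>
      \<not> a * card (cut_edges E A) < card (cut_edges S A) * b" for A
  proof (cases "card (cut_edges E A) = 0")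
    case True
    have "finite (cut_edges E A)" "cut_edges S A \<subseteq> cut_edges E A"
      using assms by (auto simp: cut_edges_def)
    hence "card (cut_edges S A) = 0" using True card_mono by fastforce
    thus ?thesis by simp
  next
    case False
    have "real (card (cut_edges S A)) / real (card (cut_edges E A)) \<le> real a / real b \<longleftrightarrow>
        real (card (cut_edges S A) * b) \<le> real (a * card (cut_edges E A))"
      using False assms(3) by (simp add: field_simps)
    thus ?thesis by (simp only: of_nat_le_iff not_less)
  qed
  thus ?thesis unfolding thin_def by simp
qed

text \<open>A path from inside \<open>A\<close> to the outside has an edge leaving \<open>A\<close>;
  conversely, no edge leaves the set of vertices reachable from \<open>u\<close>, so this set is all
  of \<open>V\<close>.\<close>

lemma connected_graph_iff:
  assumes "\<forall>e\<in>T. e \<subseteq> V"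
  shows "connected_graph V T \<longleftrightarrow>
    (\<forall>A. A \<subseteq> V \<and> A \<noteq> {} \<and> A \<noteq> V \<longrightarrow> (\<exists>u\<in>A. \<exists>v\<in>V - A. {u, v} \<in> T))"
proof
  assume conn: "connected_graph V T"
  show "\<forall>A. A \<subseteq> V \<and> A \<noteq> {} \<and> A \<noteq> V \<longrightarrow> (\<exists>u\<in>A. \<exists>v\<in>V - A. {u, v} \<in> T)"
  proof (intro allI impI)
    fix A assume A: "A \<subseteq> V \<and> A \<noteq> {} \<and> A \<noteq> V"
    then obtain u v where uv: "u \<in> A" "v \<in> V" "v \<notin> A" by blast
    have "(\<lambda>x y. {x, y} \<in> T)\<^sup>*\<^sup>* u v" using conn uv A unfolding connected_graph_def by blast
    hence "v \<in> A \<or> (\<exists>u\<in>A. \<exists>v\<in>V - A. {u, v} \<in> T)"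
    proof (induction rule: rtranclp_induct)
      case (step y z)
      have "z \<in> V" using assms step(2) by blast
      thus ?case using step by blast
    qed (use uv in simp)
    thus "\<exists>u\<in>A. \<exists>v\<in>V - A. {u, v} \<in> T" using uv by simp
  qed
next
  assume h: "\<forall>A. A \<subseteq> V \<and> A \<noteq> {} \<and> A \<noteq> V \<longrightarrow> (\<exists>u\<in>A. \<exists>v\<in>V - A. {u, v} \<in> T)"
  show "connected_graph V T"
    unfolding connected_graph_def
  proof (intro ballI)
    fix u v assume uv: "u \<in> V" "v \<in> V"
    define A where "A = {x\<in>V. (\<lambda>x y. {x, y} \<in> T)\<^sup>*\<^sup>* u x}"
    have "A = V"
    proof (rule ccontr)
      assume "A \<noteq> V"
      moreover have "A \<subseteq> V" "u \<in> A" using uv by (auto simp: A_def)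
      ultimately obtain a z where "a \<in> A" "z \<in> V - A" "{a, z} \<in> T" using h by blast
      thus False unfolding A_def by (auto intro: rtranclp.rtrancl_into_rtrancl)
    qed
    thus "(\<lambda>x y. {x, y} \<in> T)\<^sup>*\<^sup>* u v" using uv A_def by blast
  qed
qed

text \<open>This turns a cycle into a vertex set, which can serve as certificate. For the converse
  take a longest path in \<open>A\<close>: both neighbours of its first vertex lie on it, and the
  farther one closes a cycle.\<close>

lemma cycle_iff_min_degree:
  assumes V: "finite V" "\<forall>e\<in>T. e \<subseteq> V \<and> card e = 2"
  shows "(\<exists>c. graph_cycle T c) \<longleftrightarrow>
    (\<exists>A\<subseteq>V. A \<noteq> {} \<and> (\<forall>u\<in>A. \<exists>v\<in>A. \<exists>w\<in>A. v \<noteq> w \<and> {u, v} \<in> T \<and> {u, w} \<in> T))"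
proof
  assume "\<exists>c. graph_cycle T c"
  then obtain c where c: "3 \<le> length c" "distinct c" "\<forall>i<length c. {c ! i, c ! (Suc i mod length c)} \<in> T"
    unfolding graph_cycle_def by blast
  let ?l = "length c"
  have "\<exists>v\<in>set c. \<exists>w\<in>set c. v \<noteq> w \<and> {u, v} \<in> T \<and> {u, w} \<in> T" if "u \<in> set c" for u
  proof -
    obtain i where i: "i < ?l" "c ! i = u" using \<open>u \<in> set c\<close> unfolding in_set_conv_nth by blast
    \<comment> \<open>The cyclic predecessor of \<open>i\<close>; it differs from the successor
      because the cycle has at least 3 vertices.\<close>
    define j where "j = (if i = 0 then ?l - 1 else i - 1)"
    have j: "j < ?l" "Suc j mod ?l = i" 
    proof -
      show "j < ?l" using i(1) c(1) unfolding j_def by presburger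
      show "Suc j mod ?l = i"
      proof (cases "i = 0")
        case True
        hence "Suc j = ?l" using c(1) unfolding j_def by presburger
        thus ?thesis using True by simp
      next
        case False
        hence "Suc j = i" unfolding j_def by simp
        thus ?thesis using i(1) by simp
      qed
    qed
    have k: "Suc i mod ?l < ?l" using c(1) by (intro mod_less_divisor) linarith
    have "Suc i mod ?l \<noteq> j"
      using i(1) c(1) by (cases "Suc i = ?l") (simp_all add: j_def, linarith)
    hence "c ! (Suc i mod ?l) \<noteq> c ! j" using c(2) j k by (simp add: nth_eq_iff_index_eq)
    moreover have "{u, c ! (Suc i mod ?l)} \<in> T" "{u, c ! j} \<in> T"
      using c(3)[rule_format, OF i(1)] c(3)[rule_format, OF j(1)] unfolding i(2) j(2)
      by (simp_all only: insert_commute[of u])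
    ultimately show ?thesis using j(1) k nth_mem by blast
  qed
  moreover have "set c \<subseteq> V"
  proof
    fix u assume "u \<in> set c"
    then obtain i where "i < ?l" "c ! i = u" unfolding in_set_conv_nth by blast
    hence "{u, c ! (Suc i mod ?l)} \<in> T" using c(3) by blast
    thus "u \<in> V" using V(2) by blast
  qed
  moreover have "set c \<noteq> {}" using c(1) by auto
  ultimately show "\<exists>A\<subseteq>V. A \<noteq> {} \<and> (\<forall>u\<in>A. \<exists>v\<in>A. \<exists>w\<in>A. v \<noteq> w \<and> {u, v} \<in> T \<and> {u, w} \<in> T)"
    by (intro exI[of _ "set c"]) simp
next
  assume "\<exists>A\<subseteq>V. A \<noteq> {} \<and> (\<forall>u\<in>A. \<exists>v\<in>A. \<exists>w\<in>A. v \<noteq> w \<and> {u, v} \<in> T \<and> {u, w} \<in> T)"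
  then obtain A where A: "A \<subseteq> V" "A \<noteq> {}" "\<forall>u\<in>A. \<exists>v\<in>A. \<exists>w\<in>A. v \<noteq> w \<and> {u, v} \<in> T \<and> {u, w} \<in> T" by blast
  have fA: "finite A" using A(1) V(1) finite_subset by blast
  define path where "path p \<longleftrightarrow> p \<noteq> [] \<and> distinct p \<and> set p \<subseteq> A \<and> (\<forall>i. Suc i < length p \<longrightarrow> {p ! i, p ! Suc i} \<in> T)" for p
  obtain a where "a \<in> A" using A(2) by blast
  hence pa: "path [a]" by (simp add: path_def)
  have bound: "\<forall>p. path p \<longrightarrow> length p < Suc (card A)"
  proof (intro allI impI)
    fix p assume "path p"
    thus "length p < Suc (card A)" using card_mono[OF fA, of "set p"] distinct_card[of p] by (simp add: path_def)
  qed
  obtain p where p: "path p" "\<forall>q. path q \<longrightarrow> length q \<le> length p"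
    using ex_has_greatest_nat[of path "[a]" length "Suc (card A)", OF pa bound] by (elim exE conjE)
  from p(1) obtain u p' where pu: "p = u # p'" by (cases p) (auto simp: path_def)
  have "u \<in> A" using p(1) pu by (simp add: path_def)
  then obtain v w where vw: "v \<in> A" "w \<in> A" "v \<noteq> w" "{u, v} \<in> T" "{u, w} \<in> T" using A(3) by blast
  have inp: "z \<in> set p" if "z \<in> A" "{u, z} \<in> T" for z
  proof (rule ccontr)
    assume "z \<notin> set p"
    hence "path (z # p)"
    proof -
      have "{(z # p) ! i, (z # p) ! Suc i} \<in> T" if "Suc i < length (z # p)" for i
        using p(1) that pu \<open>{u, z} \<in> T\<close> by (cases i) (simp_all add: path_def insert_commute)
      thus ?thesis using p(1) \<open>z \<in> A\<close> \<open>z \<notin> set p\<close> unfolding path_def by simp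
    qed
    thus False using p(2) by force
  qed
  have ne: "z \<noteq> u" if "{u, z} \<in> T" for z
  proof
    assume "z = u"
    hence "card {u} = 2" using V(2) that by (metis insert_absorb2)
    thus False by simp
  qed
  \<comment> \<open>The two neighbours of the first vertex sit at distinct positive indices, so one
    index is at least 2 and the cycle gets length at least 3.\<close>
  obtain z j where z: "{u, z} \<in> T" "2 \<le> j" "j < length p" "p ! j = z"
  proof -
    obtain i where i: "i < length p" "p ! i = v" using inp vw unfolding in_set_conv_nth by blast
    obtain k where k: "k < length p" "p ! k = w" using inp vw unfolding in_set_conv_nth by blast
    have "i \<noteq> 0" using i ne[OF vw(4)] pu by (cases i) auto
    moreover have "k \<noteq> 0" using k ne[OF vw(5)] pu by (cases k) auto
    moreover have "i \<noteq> k" using i k vw(3) by auto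
    ultimately have "2 \<le> i \<or> 2 \<le> k" by linarith
    thus thesis using that i k vw by blast
  qed
  let ?c = "take (Suc j) p"
  have len: "length ?c = Suc j" using z by simp
  have "graph_cycle T ?c"
    unfolding graph_cycle_def
  proof (intro conjI allI impI)
    show "3 \<le> length ?c" "distinct ?c" using z len p(1) by (auto simp: path_def)
    fix i assume "i < length ?c"
    hence i: "i \<le> j" using len by simp
    show "{?c ! i, ?c ! (Suc i mod length ?c)} \<in> T"
    proof (cases "i = j")
      case True
      then show ?thesis using z len pu by (simp add: insert_commute)
    next
      case False
      hence "Suc i < length p" "Suc i < Suc j" using i z by auto
      then show ?thesis using p(1) len by (simp add: path_def)
    qed
  qed
  thus "\<exists>c. graph_cycle T c" by blast
qed

section \<open>Membership in coNP\<close>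

text \<open>Bitwise computation of \<open>d\<close> times the first numeral minus \<open>c\<close>
  times the second. Only the floor of the partial difference divided by \<open>2 ^ k\<close> is
  kept, raised by \<open>c\<close>. A set bit of the second numeral contributes \<open>- c\<close>,
  so together with the offset a clear bit yields \<open>c\<close> and a set bit 0.\<close>

definition carry :: "nat \<Rightarrow> nat \<Rightarrow> (nat \<Rightarrow> bool) \<Rightarrow> (nat \<Rightarrow> bool) \<Rightarrow> nat \<Rightarrow> nat" where
  "carry c d \<alpha> \<beta> = rec_nat c (\<lambda>j t. (t + (if \<beta> j then 0 else c) + (if \<alpha> j then d else 0)) div 2)"

lemma carry_Suc:
  "carry c d \<alpha> \<beta> (Suc k) = (carry c d \<alpha> \<beta> k + (if \<beta> k then 0 else c) + (if \<alpha> k then d else 0)) div 2"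
  by (simp add: carry_def)

text \<open>The bound does not depend on the number of bits, so a unary counter can hold the value
  even if the numerals are exponentially large.\<close>

lemma carry_le: "carry c d \<alpha> \<beta> k \<le> c + d"
proof (induction k)
  case (Suc k)
  have "carry c d \<alpha> \<beta> k + (if \<beta> k then 0 else c) + (if \<alpha> k then d else 0) \<le> 2 * (c + d)"
    using Suc by simp
  hence "(carry c d \<alpha> \<beta> k + (if \<beta> k then 0 else c) + (if \<alpha> k then d else 0)) div 2 \<le> c + d"
    using div_le_mono[of _ "2 * (c + d)" 2] by fastforce
  thus ?case by (simp only: carry_Suc)
qed (simp add: carry_def)

text \<open>The offset \<open>c\<close> keeps the carries of the subtraction nonnegative.\<close>

lemma carry_floor:
  "(int d * (\<Sum>j<k. if \<alpha> j then 2 ^ j else 0) - int c * (\<Sum>j<k. if \<beta> j then 2 ^ j else 0)) div 2 ^ k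
    = int (carry c d \<alpha> \<beta> k) - int c"
proof (induction k)
  case (Suc k)
  let ?D = "\<lambda>k. int d * (\<Sum>j<k. if \<alpha> j then 2 ^ j else 0) - int c * (\<Sum>j<k. if \<beta> j then 2 ^ j else 0)"
  let ?e = "(if \<alpha> k then int d else 0) - (if \<beta> k then int c else 0)"
  have "?D (Suc k) = ?D k + ?e * 2 ^ k" by (simp add: algebra_simps)
  moreover have "a div 2 ^ Suc k = a div 2 ^ k div 2" for a :: int
    unfolding power_Suc2 by (rule zdiv_zmult2_eq) simp
  ultimately have "?D (Suc k) div 2 ^ Suc k = ((?D k + ?e * 2 ^ k) div 2 ^ k) div 2" by (simp only:)
  also have "(?D k + ?e * 2 ^ k) div 2 ^ k = ?D k div 2 ^ k + ?e" by simp
  also have "\<dots> = int (carry c d \<alpha> \<beta> k) - int c + ?e" using Suc by simp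
  \<comment> \<open>The offset of the carry and one more \<open>c\<close> for the bit of \<beta> are
    added before halving, which leaves the offset \<open>c\<close> afterwards.\<close>
  also have "\<dots> = int (carry c d \<alpha> \<beta> k + (if \<beta> k then 0 else c) + (if \<alpha> k then d else 0)) - 2 * int c"
    by simp
  also have "\<dots> div 2 = int (carry c d \<alpha> \<beta> k + (if \<beta> k then 0 else c) + (if \<alpha> k then d else 0)) div 2 - int c"
    by linarith
  also have "\<dots> = int (carry c d \<alpha> \<beta> (Suc k)) - int c" by (simp only: carry_Suc zdiv_int of_nat_numeral)
  finally show ?case .
qed (simp add: carry_def)

text \<open>The floor of a quotient by a positive number is negative iff the numerator is.\<close>

lemma carry_less_iff:
  "carry c d \<alpha> \<beta> k < c \<longleftrightarrow> d * (\<Sum>j<k. if \<alpha> j then 2 ^ j else 0) < c * (\<Sum>j<k. if \<beta> j then 2 ^ j else 0)"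
proof -
  let ?D = "int d * (\<Sum>j<k. if \<alpha> j then 2 ^ j else 0) - int c * (\<Sum>j<k. if \<beta> j then 2 ^ j else 0)"
  have "carry c d \<alpha> \<beta> k < c \<longleftrightarrow> ?D div 2 ^ k < 0" by (simp add: carry_floor)
  also have "\<dots> \<longleftrightarrow> ?D < 0" by (rule pos_imp_zdiv_neg_iff) simp
  also have "\<dots> \<longleftrightarrow> int (d * (\<Sum>j<k. if \<alpha> j then 2 ^ j else 0)) < int (c * (\<Sum>j<k. if \<beta> j then 2 ^ j else 0))"
    by (simp add: if_distrib cong: if_cong)
  finally show ?thesis by (simp only: of_nat_less_iff)
qed

lemma PC_carry:
  assumes c: "PC vs c" and d: "PC vs d"
    and a: "PD (lift vs @ [snd]) (\<lambda>x p. \<alpha> x (fst p) (snd p))"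
    and b: "PD (lift vs @ [snd]) (\<lambda>x p. \<beta> x (fst p) (snd p))"
    and N: "PC vs N"
  shows "PC vs (\<lambda>x e. carry (c x e) (d x e) (\<alpha> x e) (\<beta> x e) (N x e))"
  unfolding carry_def
proof (rule PC_rec[OF N c, where B = "\<lambda>x e. c x e + d x e"])
  let ?vs = "lift vs @ [\<lambda>p. fst (snd p), \<lambda>p. snd (snd p)]"
  have a': "PD ?vs (\<lambda>x p. \<alpha> x (fst p) (fst (snd p)))"
    using PC_reindex[OF a[unfolded PD_def], of "\<lambda>p. (fst p, fst (snd p))" ?vs] by (simp add: PD_def)
  have b': "PD ?vs (\<lambda>x p. \<beta> x (fst p) (fst (snd p)))"
    using PC_reindex[OF b[unfolded PD_def], of "\<lambda>p. (fst p, fst (snd p))" ?vs] by (simp add: PD_def)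
  show "PC ?vs (\<lambda>x p. (snd (snd p) + (if \<beta> x (fst p) (fst (snd p)) then 0 else c x (fst p)) +
     (if \<alpha> x (fst p) (fst (snd p)) then d x (fst p) else 0)) div 2)"
    by (intro PC_div PC_add PC_If PC_const a' b' PC_lift[OF c] PC_lift[OF d]
        PC_var[where v = "\<lambda>p. snd (snd p)"]) simp
  show "PB vs (\<lambda>x e. c x e + d x e)" by (intro PB_add PC_PB[OF c] PC_PB[OF d])
qed (rule carry_le[unfolded carry_def])

text \<open>
  The functions below decode an instance of length \<open>L\<close> given by its bits \<open>b\<close>; \<open>n\<close> is the number
  of vertices, \<open>k\<close> and \<open>l\<close> are the lengths of the two binary numbers.
\<close>

definition edge_bit :: "(nat \<Rightarrow> bool) \<Rightarrow> nat \<Rightarrow> nat \<Rightarrow> nat \<Rightarrow> bool" where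
  "edge_bit b n u v = b (n + 1 + u * n + v)"

definition tree_bit :: "(nat \<Rightarrow> bool) \<Rightarrow> nat \<Rightarrow> nat \<Rightarrow> nat \<Rightarrow> bool" where
  "tree_bit b n u v = b (n + 1 + n * n + u * n + v)"

definition num_bit :: "(nat \<Rightarrow> bool) \<Rightarrow> nat \<Rightarrow> nat \<Rightarrow> bool" where
  "num_bit b n i = b (n + 1 + n * n + n * n + 2 * i + 1)"

definition den_bit :: "(nat \<Rightarrow> bool) \<Rightarrow> nat \<Rightarrow> nat \<Rightarrow> nat \<Rightarrow> bool" where
  "den_bit b n k i = b (n + 1 + n * n + n * n + 2 * k + 1 + 2 * i + 1)"

definition num :: "(nat \<Rightarrow> bool) \<Rightarrow> nat \<Rightarrow> nat \<Rightarrow> nat" where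
  "num b n k = bval (map (num_bit b n) [0..<k])"

definition den :: "(nat \<Rightarrow> bool) \<Rightarrow> nat \<Rightarrow> nat \<Rightarrow> nat \<Rightarrow> nat" where
  "den b n k l = bval (map (den_bit b n k) [0..<l])"

text \<open>Everything about an instance except \<alpha> \<le> 1, the tree property and thinness,
  which are left to \<open>accepts\<close>. The conditions on the last bits make the numerals
  canonical, so a word has at most one decoding.\<close>

definition well_formed :: "(nat \<Rightarrow> bool) \<Rightarrow> nat \<Rightarrow> nat \<Rightarrow> nat \<Rightarrow> nat \<Rightarrow> bool" where
  "well_formed b L n k l \<longleftrightarrow>
     0 < n \<and> L = n + 1 + n * n + n * n + 2 * k + 1 + 2 * l + 1 \<and>
     (\<forall>i<n. b i) \<and> \<not> b n \<and>
     (\<forall>u<n. \<not> edge_bit b n u u) \<and>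
     (\<forall>u<n. \<forall>v<n. (edge_bit b n u v \<longrightarrow> edge_bit b n v u) \<and>
        (tree_bit b n u v \<longrightarrow> tree_bit b n v u \<and> edge_bit b n u v)) \<and>
     (\<forall>i<k. b (n + 1 + n * n + n * n + 2 * i)) \<and> \<not> b (n + 1 + n * n + n * n + 2 * k) \<and>
     (\<forall>i<l. b (n + 1 + n * n + n * n + 2 * k + 1 + 2 * i)) \<and>
     \<not> b (n + 1 + n * n + n * n + 2 * k + 1 + 2 * l) \<and>
     (k = 0 \<or> num_bit b n (k - 1)) \<and> 0 < l \<and> den_bit b n k (l - 1)"

lemma last_map_upt: "0 < k \<Longrightarrow> last (map f [0..<k]) = f (k - 1)"
  by (cases k) auto

lemma well_formed_decode:
  assumes "well_formed (bit_at x) (length x) n k l"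
  defines "b \<equiv> (bit_at x)"
  shows "x = encode_instance n (edges n (edge_bit b n)) (edges n (tree_bit b n)) (num b n k) (den b n k l)"
    "simple_graph {..<n} (edges n (edge_bit b n))" "edges n (tree_bit b n) \<subseteq> edges n (edge_bit b n)"
    "0 < den b n k l" "length (binary (num b n k)) = k" "length (binary (den b n k l)) = l"
proof -
  let ?L = "n + 1 + n * n + n * n + 2 * k + 1 + 2 * l + 1"
  have w: "well_formed b (length x) n k l" using assms by simp
  have len: "length x = ?L" and n: "0 < n" using w unfolding well_formed_def by auto
  have bx: "b i \<longleftrightarrow> x ! i" if "i < ?L" for i using that len by (simp add: b_def bit_at_def)
  have wE: "edge_bit b n v u" if "u < n" "v < n" "edge_bit b n u v" for u v
    using w that unfolding well_formed_def by blast
  have wT: "tree_bit b n v u" if "u < n" "v < n" "tree_bit b n u v" for u v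
    using w that unfolding well_formed_def by blast
  have symE: "{u, v} \<in> edges n (edge_bit b n) \<longleftrightarrow> edge_bit b n u v" if "u < n" "v < n" for u v
    using edges_mem[of n "edge_bit b n" u v, OF wE] that by blast
  have symT: "{u, v} \<in> edges n (tree_bit b n) \<longleftrightarrow> tree_bit b n u v" if "u < n" "v < n" for u v
    using edges_mem[of n "tree_bit b n" u v, OF wT] that by blast
  have split: "drop m x = take j (drop m x) @ drop (m + j) x" for m j
    using append_take_drop_id[of j "drop m x"] by (simp add: add.commute)
  have uv: "u * n + v < n * n" if "u < n" "v < n" for u v
    using that mult_le_mono1[of "Suc u" n n] by simp
  \<comment> \<open>The unary number, the two matrices and the two delimited numerals; the end mark
    \<open>x ! n\<close> stands between \<open>x1\<close> and \<open>x2\<close>.\<close>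
  define x1 where "x1 = take n x"
  define x2 where "x2 = take (n * n) (drop (n + 1) x)"
  define x3 where "x3 = take (n * n) (drop (n + 1 + n * n) x)"
  define x4 where "x4 = take (2 * k + 1) (drop (n + 1 + n * n + n * n) x)"
  define x5 where "x5 = drop (n + 1 + n * n + n * n + 2 * k + 1) x"
  have "x = x1 @ drop n x" by (simp add: x1_def)
  also have "drop n x = x ! n # drop (n + 1) x" using len by (simp add: Cons_nth_drop_Suc)
  also have "drop (n + 1) x = x2 @ drop (n + 1 + n * n) x"
    unfolding x2_def by (rule split)
  also have "drop (n + 1 + n * n) x = x3 @ drop (n + 1 + n * n + n * n) x"
    unfolding x3_def by (rule split)
  also have "drop (n + 1 + n * n + n * n) x = x4 @ x5"
    unfolding x4_def x5_def
    using split[of "n + 1 + n * n + n * n" "2 * k + 1"] by (simp only: add.assoc)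
  finally have x: "x = x1 @ x ! n # x2 @ x3 @ x4 @ x5" .
  have "\<not> b n" using w unfolding well_formed_def by blast
  hence "\<not> x ! n" using bx[of n] by simp
  moreover have "x1 = replicate n True"
  proof (rule nth_equalityI)
    fix i assume "i < length x1"
    hence i: "i < n" by (simp add: x1_def)
    hence "b i" using w unfolding well_formed_def by blast
    thus "x1 ! i = replicate n True ! i" using i bx[of i] by (simp add: x1_def)
  qed (simp add: x1_def len)
  moreover have "x2 = adjacency_matrix n (edges n (edge_bit b n))"
  proof (rule adjacency_eqI)
    show "length x2 = n * n" using len by (simp add: x2_def)
    fix u v assume "u < n" "v < n"
    thus "x2 ! (u * n + v) = ({u, v} \<in> edges n (edge_bit b n))"
      using uv[of u v] symE bx[of "n + 1 + u * n + v"] len by (simp add: x2_def edge_bit_def ac_simps)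
  qed
  moreover have "x3 = adjacency_matrix n (edges n (tree_bit b n))"
  proof (rule adjacency_eqI)
    show "length x3 = n * n" using len by (simp add: x3_def)
    fix u v assume "u < n" "v < n"
    thus "x3 ! (u * n + v) = ({u, v} \<in> edges n (tree_bit b n))"
      using uv[of u v] symT bx[of "n + 1 + n * n + u * n + v"] len by (simp add: x3_def tree_bit_def ac_simps)
  qed
  moreover have "x4 = delimit (map (num_bit b n) [0..<k])"
  proof (rule delimit_eqI)
    show "length x4 = 2 * length (map (num_bit b n) [0..<k]) + 1" using len by (simp add: x4_def)
    show "\<not> x4 ! (2 * length (map (num_bit b n) [0..<k]))"
    proof -
      have "\<not> b (n + 1 + n * n + n * n + 2 * k)" using w unfolding well_formed_def by blast
      thus ?thesis using bx[of "n + 1 + n * n + n * n + 2 * k"] len by (simp add: x4_def)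
    qed
    fix i assume i: "i < length (map (num_bit b n) [0..<k])"
    have "b (n + 1 + n * n + n * n + 2 * i)" using w i unfolding well_formed_def by simp
    thus "x4 ! (2 * i)" using bx[of "n + 1 + n * n + n * n + 2 * i"] i len by (simp add: x4_def)
    show "x4 ! (2 * i + 1) = map (num_bit b n) [0..<k] ! i"
      using bx[of "n + 1 + n * n + n * n + 2 * i + 1"] i len by (simp add: x4_def num_bit_def)
  qed
  moreover have "x5 = delimit (map (den_bit b n k) [0..<l])"
  proof (rule delimit_eqI)
    show "length x5 = 2 * length (map (den_bit b n k) [0..<l]) + 1" using len by (simp add: x5_def)
    show "\<not> x5 ! (2 * length (map (den_bit b n k) [0..<l]))"
    proof -
      have "\<not> b (n + 1 + n * n + n * n + 2 * k + 1 + 2 * l)" using w unfolding well_formed_def by blast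
      thus ?thesis using bx[of "n + 1 + n * n + n * n + 2 * k + 1 + 2 * l"] len by (simp add: x5_def)
    qed
    fix i assume i: "i < length (map (den_bit b n k) [0..<l])"
    have "b (n + 1 + n * n + n * n + 2 * k + 1 + 2 * i)" using w i unfolding well_formed_def by simp
    thus "x5 ! (2 * i)" using bx[of "n + 1 + n * n + n * n + 2 * k + 1 + 2 * i"] i len by (simp add: x5_def)
    show "x5 ! (2 * i + 1) = map (den_bit b n k) [0..<l] ! i"
      using bx[of "n + 1 + n * n + n * n + 2 * k + 1 + 2 * i + 1"] i len by (simp add: x5_def den_bit_def)
  qed
  moreover have k: "map (num_bit b n) [0..<k] = binary (num b n k)"
  proof -
    have "k = 0 \<or> last (map (num_bit b n) [0..<k])"
      using w unfolding well_formed_def by (cases "k = 0") (simp_all add: last_map_upt)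
    thus ?thesis unfolding num_def by (subst binary_bval) auto
  qed
  moreover have l: "map (den_bit b n k) [0..<l] = binary (den b n k l)"
  proof -
    have "last (map (den_bit b n k) [0..<l])"
      using w unfolding well_formed_def by (simp add: last_map_upt)
    thus ?thesis unfolding den_def by (subst binary_bval) auto
  qed
  ultimately show "x = encode_instance n (edges n (edge_bit b n)) (edges n (tree_bit b n)) (num b n k) (den b n k l)"
    using x unfolding encode_instance_def by simp
  show "length (binary (num b n k)) = k" "length (binary (den b n k l)) = l"
    by (simp_all flip: k l)
  show "0 < den b n k l"
  proof -
    have "0 < l" "last (map (den_bit b n k) [0..<l])"
      using w unfolding well_formed_def by (simp_all add: last_map_upt)
    thus ?thesis unfolding den_def by (intro bval_pos) auto
  qed
  show "edges n (tree_bit b n) \<subseteq> edges n (edge_bit b n)"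
    using w unfolding well_formed_def edges_def by blast
  show "simple_graph {..<n} (edges n (edge_bit b n))"
  proof -
    have "\<not> edge_bit b n u u" if "u < n" for u using w that unfolding well_formed_def by blast
    thus ?thesis using n edges_graph[of n "edge_bit b n"] unfolding simple_graph_def by auto
  qed
qed

lemma well_formed_encode:
  fixes p q :: nat
  assumes "simple_graph {..<n} E" "T \<subseteq> E" "0 < q"
  defines "x \<equiv> encode_instance n E T p q"
  defines "b \<equiv> (bit_at x)"
  shows "well_formed b (length x) n (length (binary p)) (length (binary q))"
    "edges n (edge_bit b n) = E" "edges n (tree_bit b n) = T"
    "num b n (length (binary p)) = p" "den b n (length (binary p)) (length (binary q)) = q"
proof -
  let ?k = "length (binary p)" and ?l = "length (binary q)"
  let ?E = "adjacency_matrix n E" and ?T = "adjacency_matrix n T"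
  have g: "\<forall>e\<in>E. e \<subseteq> {..<n} \<and> card e = 2" and n: "0 < n"
    using assms(1) by (auto simp: simple_graph_def)
  have x: "x = replicate n True @ False # ?E @ ?T @ delimit (binary p) @ delimit (binary q)"
    by (simp add: x_def encode_instance_def)
  have len: "length x = n + 1 + n * n + n * n + 2 * ?k + 1 + 2 * ?l + 1"
    by (simp add: x length_adjacency length_delimit)
  have uv: "u * n + v < n * n" if "u < n" "v < n" for u v
    using that mult_le_mono1[of "Suc u" n n] by simp
  have b1: "b i" if "i < n" for i using that len by (simp add: b_def bit_at_def x nth_append)
  have b2: "\<not> b n" by (simp add: b_def bit_at_def x nth_append)
  have b3: "b (n + 1 + i) \<longleftrightarrow> ?E ! i" if "i < n * n" for i
    using that len by (simp add: b_def bit_at_def x nth_append length_adjacency)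
  have b4: "b (n + 1 + n * n + i) \<longleftrightarrow> ?T ! i" if "i < n * n" for i
    using that len by (simp add: b_def bit_at_def x nth_append length_adjacency)
  have b5: "b (n + 1 + n * n + n * n + i) \<longleftrightarrow> delimit (binary p) ! i" if "i < 2 * ?k + 1" for i
    using that len by (simp add: b_def bit_at_def x nth_append length_adjacency length_delimit)
  have b6: "b (n + 1 + n * n + n * n + 2 * ?k + 1 + i) \<longleftrightarrow> delimit (binary q) ! i" if "i < 2 * ?l + 1" for i
    using that len by (simp add: b_def bit_at_def x nth_append length_adjacency length_delimit)
  have e: "edge_bit b n u v \<longleftrightarrow> {u, v} \<in> E" if "u < n" "v < n" for u v
    using b3[OF uv[OF that]] nth_adjacency[OF that] by (simp add: edge_bit_def ac_simps)
  have t: "tree_bit b n u v \<longleftrightarrow> {u, v} \<in> T" if "u < n" "v < n" for u v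
    using b4[OF uv[OF that]] nth_adjacency[OF that] by (simp add: tree_bit_def ac_simps)
  have nb: "num_bit b n i = binary p ! i" if "i < ?k" for i
    using b5[of "2 * i + 1"] nth_delimit(1)[OF that] that by (simp add: num_bit_def ac_simps)
  have db: "den_bit b n ?k i = binary q ! i" if "i < ?l" for i
    using b6[of "2 * i + 1"] nth_delimit(1)[OF that] that by (simp add: den_bit_def ac_simps)
  have l: "0 < ?l" "last (binary q)" using last_binary[of q] assms(3) by auto
  have k: "?k = 0 \<or> last (binary p)" using last_binary[of p] by (cases "p = 0") (auto simp: binary.simps)
  show "well_formed b (length x) n ?k ?l"
    unfolding well_formed_def
  proof (intro conjI allI impI)
    show "\<not> edge_bit b n u u" if "u < n" for u
    proof
      assume "edge_bit b n u u"
      hence "{u, u} \<in> E" using e that by simp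
      thus False using g by force
    qed
    show "edge_bit b n v u" if "u < n" "v < n" "edge_bit b n u v" for u v
      using that e by (simp add: insert_commute)
    show "tree_bit b n v u" if "u < n" "v < n" "tree_bit b n u v" for u v
      using that t by (simp add: insert_commute)
    show "edge_bit b n u v" if "u < n" "v < n" "tree_bit b n u v" for u v
      using that e t assms(2) by auto
    show "b (n + 1 + n * n + n * n + 2 * i)" if "i < ?k" for i
      using b5[of "2 * i"] nth_delimit(1)[OF that] that by simp
    show "\<not> b (n + 1 + n * n + n * n + 2 * ?k)" using b5[of "2 * ?k"] nth_delimit(2) by simp
    show "b (n + 1 + n * n + n * n + 2 * ?k + 1 + 2 * i)" if "i < ?l" for i
      using b6[of "2 * i"] nth_delimit(1)[OF that] that by simp
    show "\<not> b (n + 1 + n * n + n * n + 2 * ?k + 1 + 2 * ?l)" using b6[of "2 * ?l"] nth_delimit(2) by simp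
    show "?k = 0 \<or> num_bit b n (?k - 1)" using k nb[of "?k - 1"] by (cases "?k = 0") (auto simp: last_conv_nth)
    show "den_bit b n ?k (?l - 1)" using l db[of "?l - 1"] by (simp add: last_conv_nth)
  qed (use n len b1 b2 l in auto)
  show "edges n (edge_bit b n) = E" using edges_of_graph[OF g] edges_cong[OF e] by simp
  have "\<forall>e\<in>T. e \<subseteq> {..<n} \<and> card e = 2" using g assms(2) by blast
  thus "edges n (tree_bit b n) = T" using edges_of_graph[of T n] edges_cong[OF t] by simp
  have "map (num_bit b n) [0..<?k] = binary p" using nb by (intro nth_equalityI) auto
  thus "num b n ?k = p" by (simp add: num_def bval_binary)
  have "map (den_bit b n ?k) [0..<?l] = binary q" using db by (intro nth_equalityI) auto
  thus "den b n ?k ?l = q" by (simp add: den_def bval_binary)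
qed

section \<open>Vertex sets as certificates\<close>

definition cut_count :: "nat \<Rightarrow> (nat \<Rightarrow> nat \<Rightarrow> bool) \<Rightarrow> (nat \<Rightarrow> bool) \<Rightarrow> nat" where
  "cut_count n P A = (\<Sum>u<n. \<Sum>v<n. if A u \<and> \<not> A v \<and> P u v then 1 else 0)"

text \<open>The three ways to fail: no tree edge leaves \<open>A\<close>, \<open>A\<close> supports
  a cycle, or the cut is too thick. Only the second admits the set of all vertices. With
  \<open>c\<close> and \<open>d\<close> the numbers of tree edges and graph edges in the cut, the
  carry is below \<open>c\<close> iff \<open>d * num < c * den\<close>.\<close>

definition refutes :: "(nat \<Rightarrow> bool) \<Rightarrow> nat \<Rightarrow> nat \<Rightarrow> nat \<Rightarrow> (nat \<Rightarrow> bool) \<Rightarrow> bool" where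
  "refutes b n k l A \<longleftrightarrow>
     (\<exists>u<n. A u) \<and>
     ((\<exists>u<n. \<not> A u) \<and> (\<forall>u<n. \<forall>v<n. A u \<and> \<not> A v \<longrightarrow> \<not> tree_bit b n u v) \<or>
      (\<forall>u<n. A u \<longrightarrow> (\<exists>v<n. \<exists>w<n. v \<noteq> w \<and> A v \<and> A w \<and> tree_bit b n u v \<and> tree_bit b n u w)) \<or>
      (\<exists>u<n. \<not> A u) \<and>
       carry (cut_count n (tree_bit b n) A) (cut_count n (edge_bit b n) A)
         (\<lambda>j. j < k \<and> num_bit b n j) (\<lambda>j. j < l \<and> den_bit b n k j) (k + l)
       < cut_count n (tree_bit b n) A)"

text \<open>The carry with swapped numerals and unit factors is below 1 iff
  \<open>den < num\<close>, that is, iff \<alpha> exceeds 1.\<close>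

definition accepts :: "(nat \<Rightarrow> bool) \<Rightarrow> nat \<Rightarrow> nat \<Rightarrow> nat \<Rightarrow> nat \<Rightarrow> (nat \<Rightarrow> bool) \<Rightarrow> bool" where
  "accepts b L n k l A \<longleftrightarrow> well_formed b L n k l \<and>
     \<not> carry 1 1 (\<lambda>j. j < l \<and> den_bit b n k j) (\<lambda>j. j < k \<and> num_bit b n j) (k + l) < 1 \<and>
     \<not> refutes b n k l A"

text \<open>\<open>k + l\<close> positions cover both numerals; missing bits count as False.\<close>

lemma carry_num_den:
  "carry c d (\<lambda>j. j < k \<and> num_bit b n j) (\<lambda>j. j < l \<and> den_bit b n k j) (k + l) < c
     \<longleftrightarrow> d * num b n k < c * den b n k l"
  "carry c d (\<lambda>j. j < l \<and> den_bit b n k j) (\<lambda>j. j < k \<and> num_bit b n j) (k + l) < c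
     \<longleftrightarrow> d * den b n k l < c * num b n k"
  unfolding carry_less_iff num_def den_def
  by (simp_all add: bval_map_sum[of _ "k + l"])

lemma refutes_iff:
  assumes w: "well_formed b L n k l" and pos: "0 < den b n k l"
  defines "E \<equiv> edges n (edge_bit b n)" and "T \<equiv> edges n (tree_bit b n)"
  shows "(\<exists>A. refutes b n k l A) \<longleftrightarrow>
    \<not> (connected_graph {..<n} T \<and> (\<nexists>c. graph_cycle T c) \<and>
       thin {..<n} E T (real (num b n k) / real (den b n k l)))"
proof -
  have E1: "edge_bit b n u v = edge_bit b n v u" if "u < n" "v < n" for u v
    using w that unfolding well_formed_def by blast
  have E2: "\<not> edge_bit b n u u" if "u < n" for u
    using w that unfolding well_formed_def by blast
  have T1: "tree_bit b n u v = tree_bit b n v u" if "u < n" "v < n" for u v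
    using w that unfolding well_formed_def by blast
  have T2: "\<not> tree_bit b n u u" if "u < n" for u
    using w that unfolding well_formed_def by blast
  have Tm: "{u, v} \<in> T \<longleftrightarrow> u < n \<and> v < n \<and> tree_bit b n u v" for u v
    unfolding T_def by (rule edges_mem) (use T1 in blast)
  have TE: "T \<subseteq> E" using w unfolding T_def E_def well_formed_def edges_def by blast
  have gT: "\<forall>e\<in>T. e \<subseteq> {..<n} \<and> card e = 2" unfolding T_def using edges_graph[of n "tree_bit b n", OF T2] by blast
  have gE: "\<forall>e\<in>E. e \<subseteq> {..<n} \<and> card e = 2" unfolding E_def using edges_graph[of n "edge_bit b n", OF E2] by blast
  have finE: "finite E" using gE by (intro finite_subset[of E "Pow {..<n}"]) auto
  have cT: "card (cut_edges T {u. u < n \<and> A u}) = cut_count n (tree_bit b n) A" for A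
  proof -
    let ?S = "{u. u < n \<and> A u}"
    have "card (cut_edges T ?S) = (\<Sum>u<n. \<Sum>v<n. if u \<in> ?S \<and> v \<notin> ?S \<and> tree_bit b n u v then 1 else 0)"
      unfolding T_def by (rule card_cut_edges; (rule T1 | rule T2); assumption)
    also have "\<dots> = cut_count n (tree_bit b n) A" unfolding cut_count_def by (intro sum.cong refl) simp
    finally show ?thesis .
  qed
  have cE: "card (cut_edges E {u. u < n \<and> A u}) = cut_count n (edge_bit b n) A" for A
  proof -
    let ?S = "{u. u < n \<and> A u}"
    have "card (cut_edges E ?S) = (\<Sum>u<n. \<Sum>v<n. if u \<in> ?S \<and> v \<notin> ?S \<and> edge_bit b n u v then 1 else 0)"
      unfolding E_def by (rule card_cut_edges; (rule E1 | rule E2); assumption)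
    also have "\<dots> = cut_count n (edge_bit b n) A" unfolding cut_count_def by (intro sum.cong refl) simp
    finally show ?thesis .
  qed
  \<comment> \<open>Certificates are arbitrary predicates of which only the part below
    \<open>n\<close> matters, so they range over the subsets of the vertex set.\<close>
  have sub: "(\<exists>S. S \<subseteq> {..<n} \<and> Q S) \<longleftrightarrow> (\<exists>A. Q {u. u < n \<and> A u})" for Q
  proof
    assume "\<exists>S. S \<subseteq> {..<n} \<and> Q S"
    then obtain S where "S \<subseteq> {..<n}" "Q S" by blast
    moreover from this have "{u. u < n \<and> u \<in> S} = S" by auto
    ultimately show "\<exists>A. Q {u. u < n \<and> A u}" by (intro exI[of _ "\<lambda>u. u \<in> S"]) simp
  next
    assume "\<exists>A. Q {u. u < n \<and> A u}"
    then obtain A where "Q {u. u < n \<and> A u}" ..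
    thus "\<exists>S. S \<subseteq> {..<n} \<and> Q S" by (intro exI[of _ "{u. u < n \<and> A u}"]) auto
  qed
  have ne: "{u. u < n \<and> A u} \<noteq> {} \<longleftrightarrow> (\<exists>u<n. A u)" for A by auto
  have nV: "{u. u < n \<and> A u} \<noteq> {..<n} \<longleftrightarrow> (\<exists>u<n. \<not> A u)" for A by auto
  have 1: "\<not> connected_graph {..<n} T \<longleftrightarrow> (\<exists>A. (\<exists>u<n. A u) \<and> (\<exists>u<n. \<not> A u) \<and>
      (\<forall>u<n. \<forall>v<n. A u \<and> \<not> A v \<longrightarrow> \<not> tree_bit b n u v))"
  proof -
    have "\<not> connected_graph {..<n} T \<longleftrightarrow> (\<exists>S. S \<subseteq> {..<n} \<and> (S \<noteq> {} \<and> S \<noteq> {..<n} \<and>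
        \<not> (\<exists>u\<in>S. \<exists>v\<in>{..<n} - S. {u, v} \<in> T)))"
    proof -
      have "\<forall>e\<in>T. e \<subseteq> {..<n}" using gT by blast
      from connected_graph_iff[OF this] show ?thesis by (simp only: not_all not_imp conj_assoc)
    qed
    also have "\<dots> \<longleftrightarrow> (\<exists>A. (\<exists>u<n. A u) \<and> (\<exists>u<n. \<not> A u) \<and> (\<forall>u<n. \<forall>v<n. A u \<and> \<not> A v \<longrightarrow> \<not> tree_bit b n u v))"
    proof -
      have "(\<exists>u\<in>{u. u < n \<and> A u}. \<exists>v\<in>{..<n} - {u. u < n \<and> A u}. {u, v} \<in> T) \<longleftrightarrow>
         \<not> (\<forall>u<n. \<forall>v<n. A u \<and> \<not> A v \<longrightarrow> \<not> tree_bit b n u v)" for A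
        unfolding Tm by auto
      thus ?thesis unfolding sub ne nV by (simp only: not_not)
    qed
    finally show ?thesis .
  qed
  have 2: "(\<exists>c. graph_cycle T c) \<longleftrightarrow> (\<exists>A. (\<exists>u<n. A u) \<and>
      (\<forall>u<n. A u \<longrightarrow> (\<exists>v<n. \<exists>w<n. v \<noteq> w \<and> A v \<and> A w \<and> tree_bit b n u v \<and> tree_bit b n u w)))"
  proof -
    have "(\<exists>c. graph_cycle T c) \<longleftrightarrow> (\<exists>S. S \<subseteq> {..<n} \<and> (S \<noteq> {} \<and>
        (\<forall>u\<in>S. \<exists>v\<in>S. \<exists>w\<in>S. v \<noteq> w \<and> {u, v} \<in> T \<and> {u, w} \<in> T)))"
      unfolding cycle_iff_min_degree[OF finite_lessThan gT] by (rule refl)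
    also have "\<dots> \<longleftrightarrow> (\<exists>A. (\<exists>u<n. A u) \<and>
      (\<forall>u<n. A u \<longrightarrow> (\<exists>v<n. \<exists>w<n. v \<noteq> w \<and> A v \<and> A w \<and> tree_bit b n u v \<and> tree_bit b n u w)))"
    proof -
      have "(\<forall>u\<in>{u. u < n \<and> A u}. \<exists>v\<in>{u. u < n \<and> A u}. \<exists>w\<in>{u. u < n \<and> A u}.
           v \<noteq> w \<and> {u, v} \<in> T \<and> {u, w} \<in> T) \<longleftrightarrow>
         (\<forall>u<n. A u \<longrightarrow> (\<exists>v<n. \<exists>w<n. v \<noteq> w \<and> A v \<and> A w \<and> tree_bit b n u v \<and> tree_bit b n u w))" for A
        unfolding Tm by (simp add: Bex_def) blast
      thus ?thesis unfolding sub ne by (simp only:)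
    qed
    finally show ?thesis .
  qed
  have 3: "\<not> thin {..<n} E T (real (num b n k) / real (den b n k l)) \<longleftrightarrow>
     (\<exists>A. (\<exists>u<n. A u) \<and> (\<exists>u<n. \<not> A u) \<and>
       cut_count n (edge_bit b n) A * num b n k < cut_count n (tree_bit b n) A * den b n k l)"
  proof -
    have "\<not> thin {..<n} E T (real (num b n k) / real (den b n k l)) \<longleftrightarrow>
      (\<exists>S. S \<subseteq> {..<n} \<and> (S \<noteq> {} \<and> S \<noteq> {..<n} \<and>
         num b n k * card (cut_edges E S) < card (cut_edges T S) * den b n k l))"
      unfolding thin_iff[OF finE TE pos] by (simp only: not_all not_imp not_not conj_assoc)
    thus ?thesis unfolding sub ne nV cT cE by (simp add: mult.commute)
  qed
  show ?thesis
    unfolding refutes_def carry_num_den de_Morgan_conj not_not 1 2 3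
    by (simp only: ex_disj_distrib conj_disj_distribL)
qed

lemma ThinTreeValid_accepts:
  assumes "x \<in> ThinTreeValid"
  shows "\<exists>n<length x. \<exists>k<length x. \<exists>l<length x. \<forall>A. accepts (bit_at x) (length x) n k l A"
proof -
  obtain n E T p q where x: "x = encode_instance n E T p q" and g: "simple_graph {..<n} E"
    and st: "spanning_tree {..<n} E T" and q: "0 < q" and le: "real p / real q \<in> {0..1}"
    and th: "thin {..<n} E T (real p / real q)"
    using assms unfolding ThinTreeValid_def by blast
  let ?k = "length (binary p)" and ?l = "length (binary q)"
  have TE: "T \<subseteq> E" using st by (simp add: spanning_tree_def)
  note w = well_formed_encode[OF g TE q, of p, folded x]
  have "p \<le> q" using le q by (simp add: field_simps)
  moreover have "\<not> (\<exists>A. refutes (bit_at x) n ?k ?l A)"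
    using refutes_iff[OF w(1)] w(2-5) q st th by (simp add: spanning_tree_def)
  ultimately have "accepts (bit_at x) (length x) n ?k ?l A" for A
    unfolding accepts_def carry_num_den w(4,5) using w(1) by auto
  moreover have "n < length x" "?k < length x" "?l < length x"
    using w(1) unfolding well_formed_def by linarith+
  ultimately show ?thesis by blast
qed

text \<open>A single \<open>A\<close> has to defeat all \<open>n\<close>, \<open>k\<close>,
  \<open>l\<close> at once. It can, because a word has at most one well-formed decoding.\<close>

lemma accepts_ThinTreeValid:
  assumes "x \<notin> ThinTreeValid"
  shows "\<exists>A. \<forall>n k l. \<not> accepts (bit_at x) (length x) n k l A"
proof (cases "\<exists>n k l. well_formed (bit_at x) (length x) n k l")
  case False
  thus ?thesis unfolding accepts_def by blast
next
  case True
  then obtain n k l where w: "well_formed (bit_at x) (length x) n k l" by blast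
  let ?b = "bit_at x"
  note d = well_formed_decode[OF w]
  \<comment> \<open>Both decodings encode back to \<open>x\<close>; injectivity gives the same
    numbers, and \<open>k\<close> and \<open>l\<close> are the lengths of their canonical
    numerals.\<close>
  have uniq: "n' = n \<and> k' = k \<and> l' = l" if w': "well_formed (bit_at x) (length x) n' k' l'" for n' k' l'
  proof -
    note d' = well_formed_decode[OF w']
    have "encode_instance n' (edges n' (edge_bit ?b n')) (edges n' (tree_bit ?b n')) (num ?b n' k') (den ?b n' k' l')
      = encode_instance n (edges n (edge_bit ?b n)) (edges n (tree_bit ?b n)) (num ?b n k) (den ?b n k l)"
      using d(1) d'(1) by simp
    note i = encode_instance_inj(1,4,5)[OF this]
    show ?thesis using i d(5,6) d'(5,6) by metis
  qed
  show ?thesis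
  proof (cases "num ?b n k \<le> den ?b n k l")
    case False
    hence "\<not> accepts ?b (length x) n' k' l' A" for n' k' l' A
      unfolding accepts_def carry_num_den using uniq by fastforce
    thus ?thesis by blast
  next
    case True
    have "\<exists>A. refutes ?b n k l A"
    proof (rule ccontr)
      assume "\<not> (\<exists>A. refutes ?b n k l A)"
      hence "spanning_tree {..<n} (edges n (edge_bit ?b n)) (edges n (tree_bit ?b n))"
        "thin {..<n} (edges n (edge_bit ?b n)) (edges n (tree_bit ?b n)) (real (num ?b n k) / real (den ?b n k l))"
        using refutes_iff[OF w d(4)] d(3) by (auto simp: spanning_tree_def)
      moreover have "real (num ?b n k) / real (den ?b n k l) \<in> {0..1}"
        using True d(4) by (simp add: field_simps)
      ultimately have "x \<in> ThinTreeValid"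
        unfolding ThinTreeValid_def using d(1,2,4) by blast
      thus False using assms by simp
    qed
    then obtain A where "refutes ?b n k l A" by blast
    hence "\<not> accepts ?b (length x) n' k' l' A" for n' k' l'
      unfolding accepts_def using uniq by metis
    thus ?thesis by blast
  qed
qed

lemma refutes_cong:
  assumes "\<And>u. u < n \<Longrightarrow> A u = A' u"
  shows "refutes b n k l A = refutes b n k l A'"
proof -
  have "cut_count n P A = cut_count n P A'" for P
    unfolding cut_count_def using assms by (intro sum.cong refl) auto
  thus ?thesis unfolding refutes_def using assms by (auto cong: conj_cong)
qed

text \<open>The length \<open>L\<close> of the instance is found from the first even position
  holding False. The bits of the instance are at odd positions, and the certificate starts right
  after the end mark. This is acceptance of the instance; the verifier for the complement is its
  negation.\<close>

definition check_pair :: "bool list \<Rightarrow> bool" where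
  "check_pair w \<longleftrightarrow> (\<exists>L<length w. (\<forall>i<L. bit_at w (2 * i)) \<and> \<not> bit_at w (2 * L) \<and>
     (\<exists>n<L. \<exists>k<L. \<exists>l<L. accepts (\<lambda>i. i < L \<and> bit_at w (2 * i + 1)) L n k l (\<lambda>u. bit_at w (2 * L + 1 + u))))"

lemma check_pair_pair:
  "check_pair (pair x y) \<longleftrightarrow>
     (\<exists>n<length x. \<exists>k<length x. \<exists>l<length x. accepts (bit_at x) (length x) n k l (bit_at y))"
proof -
  let ?w = "pair x y"
  have len: "length ?w = 2 * length x + 1 + length y" by (simp add: pair_def length_delimit)
  have b1: "bit_at ?w (2 * i)" "bit_at ?w (2 * i + 1) = x ! i" if "i < length x" for i
    using nth_delimit(1)[OF that] that by (simp_all add: bit_at_def len pair_def nth_append length_delimit)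
  have b2: "\<not> bit_at ?w (2 * length x)"
    using nth_delimit(2)[of x] by (simp add: bit_at_def pair_def nth_append length_delimit)
  have b3: "bit_at ?w (2 * length x + 1 + u) = bit_at y u" for u
    by (simp add: bit_at_def len pair_def nth_append length_delimit)
  have L: "L = length x" if "\<forall>i<L. bit_at ?w (2 * i)" "\<not> bit_at ?w (2 * L)" for L
    using that b1(1) b2 by (meson linorder_neqE_nat)
  have b: "(\<lambda>i. i < length x \<and> bit_at ?w (2 * i + 1)) = bit_at x"
    using b1(2) by (auto simp: bit_at_def fun_eq_iff)
  have "check_pair ?w \<longleftrightarrow> (\<exists>n<length x. \<exists>k<length x. \<exists>l<length x.
      accepts (\<lambda>i. i < length x \<and> bit_at ?w (2 * i + 1)) (length x) n k l (\<lambda>u. bit_at ?w (2 * length x + 1 + u)))"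
  proof
    assume "check_pair ?w"
    thus "\<exists>n<length x. \<exists>k<length x. \<exists>l<length x.
      accepts (\<lambda>i. i < length x \<and> bit_at ?w (2 * i + 1)) (length x) n k l (\<lambda>u. bit_at ?w (2 * length x + 1 + u))"
      unfolding check_pair_def using L by blast
  next
    assume "\<exists>n<length x. \<exists>k<length x. \<exists>l<length x.
      accepts (\<lambda>i. i < length x \<and> bit_at ?w (2 * i + 1)) (length x) n k l (\<lambda>u. bit_at ?w (2 * length x + 1 + u))"
    moreover have "length x < length ?w" using len by simp
    ultimately show "check_pair ?w" unfolding check_pair_def using b1(1) b2 by blast
  qed
  thus ?thesis unfolding b b3 .
qed

text \<open>All decoding is arithmetic on positions of the word, so the closure rules apply once
  everything is unfolded.\<close>

lemma PD_check_pair: "PD [] (\<lambda>w (_::unit). check_pair w)"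
  unfolding check_pair_def accepts_def well_formed_def refutes_def cut_count_def
    edge_bit_def tree_bit_def num_bit_def den_bit_def
  by (intro pc_rules PC_carry; (rule PC_var, simp; fail)?)

lemma ThinTreeValid_coNP: "ThinTreeValid \<in> coNP"
proof -
  have R: "{w. \<not> check_pair w} \<in> PTIME"
    by (rule PTIME_PD[OF PD_not[OF PD_check_pair]])
  have "x \<in> - ThinTreeValid \<longleftrightarrow> (\<exists>y. length y \<le> poly [:0, 1:] (length x) \<and> pair x y \<in> {w. \<not> check_pair w})" for x
  proof
    assume "x \<in> - ThinTreeValid"
    then obtain A where A: "\<And>n k l. \<not> accepts (bit_at x) (length x) n k l A"
      using accepts_ThinTreeValid by blast
    \<comment> \<open>\<open>length x\<close> bits suffice, since the vertices are numbered below
      \<open>n < length x\<close>.\<close>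
    define y where "y = map A [0..<length x]"
    have "refutes (bit_at x) n k l (bit_at y) = refutes (bit_at x) n k l A" if "n < length x" for n k l
      by (rule refutes_cong) (use that in \<open>simp add: y_def bit_at_def\<close>)
    hence "\<not> check_pair (pair x y)"
      unfolding check_pair_pair using A unfolding accepts_def by blast
    moreover have "length y \<le> poly [:0, 1:] (length x)" by (simp add: y_def)
    ultimately show "\<exists>y. length y \<le> poly [:0, 1:] (length x) \<and> pair x y \<in> {w. \<not> check_pair w}" by blast
  next
    assume "\<exists>y. length y \<le> poly [:0, 1:] (length x) \<and> pair x y \<in> {w. \<not> check_pair w}"
    then obtain y where "\<not> check_pair (pair x y)" by blast
    thus "x \<in> - ThinTreeValid"
      unfolding check_pair_pair using ThinTreeValid_accepts by blast
  qed
  thus ?thesis unfolding coNP_def NP_def using R by blast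
qed

section \<open>Cuts of graphs made of blobs\<close>

lemma sum_blocks: "(\<Sum>p<K * B. f p) = (\<Sum>b<K. \<Sum>i<B. f (b * B + i))" for f :: "nat \<Rightarrow> 'a::comm_monoid_add"
proof (induction K)
  case (Suc K)
  have "{..<Suc K * B} = {..<K * B} \<union> {K * B..<K * B + B}" by auto
  hence "(\<Sum>p<Suc K * B. f p) = (\<Sum>p<K * B. f p) + (\<Sum>p=K * B..<K * B + B. f p)"
    by (simp add: sum.union_disjoint ivl_disj_int)
  also have "(\<Sum>p=K * B..<K * B + B. f p) = (\<Sum>i<B. f (K * B + i))"
    using sum.shift_bounds_nat_ivl[of f 0 "K * B" B] by (simp add: atLeast0LessThan add.commute)
  finally show ?case using Suc by simp
qed simp

lemma block_div_mod: "i < B \<Longrightarrow> (b * B + i) div B = b \<and> (b * B + i) mod B = i" for i B b :: nat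
  by simp

text \<open>Pairs are ordered, so for symmetric \<open>g\<close> an edge is counted once, in the
  direction out of \<open>A\<close>.\<close>

definition cut_sum :: "nat \<Rightarrow> (nat \<Rightarrow> nat \<Rightarrow> int) \<Rightarrow> (nat \<Rightarrow> bool) \<Rightarrow> int" where
  "cut_sum N g A = (\<Sum>p<N. \<Sum>q<N. if A p \<and> \<not> A q then g p q else 0)"

lemma consecutive_pairs_le:
  "(\<Sum>i<B. \<Sum>j<B. if X i \<and> (i = Suc j \<or> j = Suc i) then 1 else 0) \<le> 2 * int (card {i\<in>{..<B}. X i})"
proof -
  have "(\<Sum>j<B. if X i \<and> (i = Suc j \<or> j = Suc i) then 1 else 0) \<le> (if X i then 2 else (0::int))" for i
  proof -
    have "(\<Sum>j<B. if X i \<and> (i = Suc j \<or> j = Suc i) then 1 else 0) =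
        int (card {j\<in>{..<B}. X i \<and> (i = Suc j \<or> j = Suc i)})"
      by (simp add: sum.If_cases Int_def conj_commute)
    also have "card {j\<in>{..<B}. X i \<and> (i = Suc j \<or> j = Suc i)} \<le> (if X i then 2 else 0)"
    proof (cases "X i")
      case True
      have "card {j\<in>{..<B}. X i \<and> (i = Suc j \<or> j = Suc i)} \<le> card {i - 1, Suc i}"
        by (rule card_mono) auto
      also have "\<dots> \<le> 2" by (simp add: card_insert_if)
      finally show ?thesis using True by simp
    qed simp
    finally show ?thesis by (simp split: if_splits)
  qed
  hence "(\<Sum>i<B. \<Sum>j<B. if X i \<and> (i = Suc j \<or> j = Suc i) then 1 else 0) \<le> (\<Sum>i<B. if X i then 2 else (0::int))"
    by (rule sum_mono)
  also have "\<dots> = 2 * int (card {i\<in>{..<B}. X i})"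
    by (simp add: sum.If_cases Int_def conj_commute)
  finally show ?thesis .
qed

text \<open>\<open>D\<close> marks the vertices that deviate from the majority side. If there are
  \<open>r\<close> of them, \<open>r * (B - r)\<close> pairs are cut, each of weight at most -1
  except for at most \<open>2 * r\<close> consecutive ones of weight at most 1. So the value is at
  most \<open>4 * r - r * (B - r)\<close>, and \<open>2 * r <= B\<close> gives the bound.\<close>

lemma block_cut_le:
  fixes g :: "nat \<Rightarrow> nat \<Rightarrow> int" and X :: "nat \<Rightarrow> bool"
  assumes g: "\<And>i j. i < B \<Longrightarrow> j < B \<Longrightarrow> i \<noteq> j \<Longrightarrow> g i j \<le> (if i = Suc j \<or> j = Suc i then 1 else -1)"
    and D: "(\<forall>i<B. D i = X i) \<or> (\<forall>i<B. D i = (\<not> X i))"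
    and r: "2 * card {i\<in>{..<B}. D i} \<le> B"
  shows "2 * cut_sum B g X \<le> int (card {i\<in>{..<B}. D i}) * (8 - int B)"
proof -
  let ?r = "card {i\<in>{..<B}. D i}"
  define c where "c = (\<Sum>i<B. \<Sum>j<B. if X i \<and> \<not> X j \<and> (i = Suc j \<or> j = Suc i) then 1 else (0::int))"
  define s where "s = (\<Sum>i<B. \<Sum>j<B. if X i \<and> \<not> X j then 1 else (0::int))"
  have "cut_sum B g X \<le> (\<Sum>i<B. \<Sum>j<B. 2 * (if X i \<and> \<not> X j \<and> (i = Suc j \<or> j = Suc i) then 1 else 0) -
      (if X i \<and> \<not> X j then 1 else 0))"
    unfolding cut_sum_def
  proof (intro sum_mono)
    fix i j assume "i \<in> {..<B}" "j \<in> {..<B}"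
    thus "(if X i \<and> \<not> X j then g i j else 0) \<le>
       2 * (if X i \<and> \<not> X j \<and> (i = Suc j \<or> j = Suc i) then 1 else 0) - (if X i \<and> \<not> X j then 1 else 0)"
      using g[of i j] by (cases "i = j") auto
  qed
  hence 1: "cut_sum B g X \<le> 2 * c - s"
    by (simp add: c_def s_def sum_subtractf sum_distrib_left)
  have 2: "c \<le> 2 * int (card {i\<in>{..<B}. X i})"
  proof -
    have "c \<le> (\<Sum>i<B. \<Sum>j<B. if X i \<and> (i = Suc j \<or> j = Suc i) then 1 else 0)"
      unfolding c_def by (intro sum_mono) auto
    thus ?thesis using consecutive_pairs_le[of X B] by linarith
  qed
  have 3: "c \<le> 2 * int (card {i\<in>{..<B}. \<not> X i})"
  proof -
    have "c \<le> (\<Sum>i<B. \<Sum>j<B. if \<not> X j \<and> (j = Suc i \<or> i = Suc j) then 1 else 0)"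
      unfolding c_def by (intro sum_mono) auto
    also have "\<dots> = (\<Sum>j<B. \<Sum>i<B. if \<not> X j \<and> (j = Suc i \<or> i = Suc j) then 1 else 0)" by (rule sum.swap)
    also have "\<dots> \<le> 2 * int (card {i\<in>{..<B}. \<not> X i})" by (rule consecutive_pairs_le)
    finally show ?thesis .
  qed
  have "s = (\<Sum>i<B. if X i then (\<Sum>j<B. if \<not> X j then 1 else 0) else 0)"
    unfolding s_def by (intro sum.cong refl) auto
  also have "\<dots> = int (card {i\<in>{..<B}. X i}) * int (card {i\<in>{..<B}. \<not> X i})"
    by (simp add: sum.If_cases Int_def conj_commute)
  finally have s: "s = int (card {i\<in>{..<B}. X i}) * int (card {i\<in>{..<B}. \<not> X i})" .
  have "card {i\<in>{..<B}. X i} + card {i\<in>{..<B}. \<not> X i} = card ({i\<in>{..<B}. X i} \<union> {i\<in>{..<B}. \<not> X i})"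
    by (rule card_Un_disjoint[symmetric]) auto
  also have "{i\<in>{..<B}. X i} \<union> {i\<in>{..<B}. \<not> X i} = {..<B}" by auto
  finally have B: "card {i\<in>{..<B}. X i} + card {i\<in>{..<B}. \<not> X i} = B" by simp
  from D have "(?r = card {i\<in>{..<B}. X i}) \<or> (?r = card {i\<in>{..<B}. \<not> X i})"
  proof
    assume "\<forall>i<B. D i = X i"
    hence "{i\<in>{..<B}. D i} = {i\<in>{..<B}. X i}" by auto
    thus ?thesis by simp
  next
    assume "\<forall>i<B. D i = (\<not> X i)"
    hence "{i\<in>{..<B}. D i} = {i\<in>{..<B}. \<not> X i}" by auto
    thus ?thesis by simp
  qed
  hence sr: "s = int ?r * (int B - int ?r)" "c \<le> 2 * int ?r"
  proof -
    have "int B = int (card {i\<in>{..<B}. X i}) + int (card {i\<in>{..<B}. \<not> X i})" using B by linarith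
    moreover assume "?r = card {i\<in>{..<B}. X i} \<or> ?r = card {i\<in>{..<B}. \<not> X i}"
    ultimately have "(s = int ?r * (int B - int ?r)) \<and> c \<le> 2 * int ?r"
      using s 2 3 by (elim disjE) (simp_all only: add_diff_cancel_left' add_diff_cancel_right' mult.commute)
    thus "s = int ?r * (int B - int ?r)" "c \<le> 2 * int ?r" by simp_all
  qed
  have "int ?r * (2 * int ?r) \<le> int ?r * int B"
    using r by (intro mult_left_mono) auto
  thus ?thesis using 1 sr by (simp add: algebra_simps)
qed

text \<open>Every vertex is moved to the majority side of its block. If \<open>r\<close> vertices
  move in total, the cuts inside blocks, worth at most \<open>r * (8 - B) / 2\<close>, disappear,
  and the edges between blocks lose at most \<open>2 * r * \<Delta>\<close>. The gain covers the
  loss once \<open>4 * \<Delta> + 8 <= B\<close>.\<close>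

theorem cut_sum_rounding:
  fixes g :: "nat \<Rightarrow> nat \<Rightarrow> int"
  assumes sym: "\<And>p q. g p q = g q p"
    and internal: "\<And>b i j. b < K \<Longrightarrow> i < B \<Longrightarrow> j < B \<Longrightarrow> i \<noteq> j \<Longrightarrow>
      g (b * B + i) (b * B + j) \<le> (if i = Suc j \<or> j = Suc i then 1 else -1)"
    and deg: "\<And>p. p < K * B \<Longrightarrow> (\<Sum>q<K * B. if q div B \<noteq> p div B then \<bar>g p q\<bar> else 0) \<le> int \<Delta>"
    and B: "4 * \<Delta> + 8 \<le> B"
  shows "\<exists>\<sigma>. cut_sum (K * B) g A \<le> cut_sum (K * B) g (\<lambda>p. \<sigma> (p div B))"
proof -
  define maj where "maj b \<longleftrightarrow> B < 2 * card {i\<in>{..<B}. A (b * B + i)}" for b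
  define A' where "A' p = maj (p div B)" for p
  define dev where "dev p \<longleftrightarrow> A p \<noteq> A' p" for p
  let ?r = "\<lambda>b. card {i\<in>{..<B}. dev (b * B + i)}"
  define ext where "ext X = (\<Sum>p<K * B. \<Sum>q<K * B. if q div B \<noteq> p div B then (if X p \<and> \<not> X q then g p q else 0) else 0)" for X
  define int where "int X = (\<Sum>p<K * B. \<Sum>q<K * B. if q div B = p div B then (if X p \<and> \<not> X q then g p q else 0) else 0)" for X
  have split: "cut_sum (K * B) g X = int X + ext X" for X
    unfolding cut_sum_def int_def ext_def sum.distrib[symmetric] by (intro sum.cong refl) auto
  have int_blocks: "int X = (\<Sum>b<K. cut_sum B (\<lambda>i j. g (b * B + i) (b * B + j)) (\<lambda>i. X (b * B + i)))" for X
  proof -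
    have "int X = (\<Sum>b<K. \<Sum>i<B. \<Sum>b'<K. \<Sum>j<B. if b' = b then
        (if X (b * B + i) \<and> \<not> X (b' * B + j) then g (b * B + i) (b' * B + j) else 0) else 0)"
      unfolding int_def sum_blocks by (intro sum.cong refl) (simp add: block_div_mod)
    also have "\<dots> = (\<Sum>b<K. \<Sum>i<B. \<Sum>b'<K. if b' = b then (\<Sum>j<B.
        if X (b * B + i) \<and> \<not> X (b' * B + j) then g (b * B + i) (b' * B + j) else 0) else 0)"
      by (intro sum.cong refl) auto
    finally show ?thesis unfolding cut_sum_def by simp
  qed
  have int': "int A' = 0"
    unfolding int_def A'_def by (intro sum.neutral ballI) auto
  have intA: "2 * int A \<le> (\<Sum>b<K. of_nat (?r b) * (8 - of_nat B))"
  proof -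
    have "2 * cut_sum B (\<lambda>i j. g (b * B + i) (b * B + j)) (\<lambda>i. A (b * B + i)) \<le> of_nat (?r b) * (8 - of_nat B)"
      if "b < K" for b
    proof (rule block_cut_le)
      show "(\<forall>i<B. dev (b * B + i) = A (b * B + i)) \<or> (\<forall>i<B. dev (b * B + i) = (\<not> A (b * B + i)))"
        by (auto simp: dev_def A'_def block_div_mod)
      show "2 * ?r b \<le> B"
      proof (cases "maj b")
        case False
        hence "{i\<in>{..<B}. dev (b * B + i)} = {i\<in>{..<B}. A (b * B + i)}"
          by (auto simp: dev_def A'_def block_div_mod)
        thus ?thesis using False by (simp add: maj_def)
      next
        case True
        hence "{i\<in>{..<B}. dev (b * B + i)} = {..<B} - {i\<in>{..<B}. A (b * B + i)}"
          by (auto simp: dev_def A'_def block_div_mod)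
        hence "?r b = B - card {i\<in>{..<B}. A (b * B + i)}"
          by (simp only:) (subst card_Diff_subset, auto)
        thus ?thesis using True by (simp add: maj_def)
      qed
    qed (rule internal[OF that])
    thus ?thesis unfolding int_blocks sum_distrib_left by (intro sum_mono) auto
  qed
  have devsum: "(\<Sum>p<K * B. if dev p then c else 0) = of_nat (\<Sum>b<K. ?r b) * c" for c :: "'x::semiring_1"
  proof -
    have "(\<Sum>p<K * B. if dev p then c else 0) = (\<Sum>b<K. \<Sum>i<B. if dev (b * B + i) then c else 0)"
      by (rule sum_blocks)
    also have "\<dots> = (\<Sum>b<K. of_nat (?r b) * c)"
      by (intro sum.cong refl) (simp add: sum.If_cases Int_def conj_commute)
    finally show ?thesis by (simp add: sum_distrib_right)
  qed
  have extA: "ext A \<le> ext A' + 2 * (of_nat (\<Sum>b<K. ?r b) * of_nat \<Delta>)"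
  proof -
    \<comment> \<open>A pair between blocks changes its contribution only if an endpoint moves. Both
      orders of the pair are charged to that endpoint, hence the factor 2.\<close>
    let ?e = "\<lambda>p q. if q div B \<noteq> p div B then \<bar>g p q\<bar> else 0"
    have "ext A \<le> (\<Sum>p<K * B. \<Sum>q<K * B. (if q div B \<noteq> p div B then (if A' p \<and> \<not> A' q then g p q else 0) else 0)
        + ((if dev p then ?e p q else 0) + (if dev q then ?e q p else 0)))"
      unfolding ext_def
    proof (intro sum_mono)
      fix p q
      show "(if q div B \<noteq> p div B then (if A p \<and> \<not> A q then g p q else 0) else 0) \<le>
        (if q div B \<noteq> p div B then (if A' p \<and> \<not> A' q then g p q else 0) else 0)
        + ((if dev p then ?e p q else 0) + (if dev q then ?e q p else 0))"
        using sym[of p q] by (auto simp: dev_def)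
    qed
    also have "\<dots> = ext A' + ((\<Sum>p<K * B. \<Sum>q<K * B. if dev p then ?e p q else 0) +
        (\<Sum>p<K * B. \<Sum>q<K * B. if dev q then ?e q p else 0))"
      by (simp only: ext_def sum.distrib)
    also have "(\<Sum>p<K * B. \<Sum>q<K * B. if dev q then ?e q p else 0) =
        (\<Sum>q<K * B. \<Sum>p<K * B. if dev q then ?e q p else 0)" by (rule sum.swap)
    finally have 1: "ext A \<le> ext A' + 2 * (\<Sum>p<K * B. \<Sum>q<K * B. if dev p then ?e p q else 0)" by simp
    have "(\<Sum>p<K * B. \<Sum>q<K * B. if dev p then ?e p q else 0) \<le> (\<Sum>p<K * B. if dev p then of_nat \<Delta> else 0)"
    proof (intro sum_mono)
      fix p assume "p \<in> {..<K * B}"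
      thus "(\<Sum>q<K * B. if dev p then ?e p q else 0) \<le> (if dev p then of_nat \<Delta> else 0)"
        using deg[of p] by (cases "dev p") auto
    qed
    thus ?thesis using 1 devsum[of "of_nat \<Delta> :: int"] by simp
  qed
  have "2 * cut_sum (K * B) g A \<le> 2 * ext A' + of_nat (\<Sum>b<K. ?r b) * (4 * of_nat \<Delta> + 8 - of_nat B)"
    using intA extA unfolding split sum_distrib_right[symmetric] of_nat_sum[symmetric]
    by (simp add: algebra_simps)
  moreover have "of_nat (\<Sum>b<K. ?r b) * (4 * of_nat \<Delta> + 8 - of_nat B) \<le> (0::int)"
    using B by (intro mult_nonneg_nonpos) (auto simp: sum_nonneg)
  moreover have "a \<le> 0 + e" if "2 * a \<le> 2 * e + z" "z \<le> 0" for a e z :: int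
    using that by linarith
  ultimately have "cut_sum (K * B) g A \<le> cut_sum (K * B) g A'"
    unfolding split int' by blast
  thus ?thesis unfolding A'_def by (intro exI[of _ maj])
qed

lemma cut_sum_blocks:
  assumes "0 < B"
  shows "cut_sum (K * B) g (\<lambda>p. \<sigma> (p div B)) =
    cut_sum K (\<lambda>b b'. \<Sum>i<B. \<Sum>j<B. g (b * B + i) (b' * B + j)) \<sigma>"
proof -
  have "cut_sum (K * B) g (\<lambda>p. \<sigma> (p div B)) =
     (\<Sum>b<K. \<Sum>i<B. \<Sum>b'<K. \<Sum>j<B. if \<sigma> b \<and> \<not> \<sigma> b' then g (b * B + i) (b' * B + j) else 0)"
    unfolding cut_sum_def sum_blocks by (intro sum.cong refl) (simp add: block_div_mod)
  also have "\<dots> = (\<Sum>b<K. \<Sum>b'<K. \<Sum>i<B. \<Sum>j<B. if \<sigma> b \<and> \<not> \<sigma> b' then g (b * B + i) (b' * B + j) else 0)"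
    by (rule sum.cong[OF refl]) (rule sum.swap)
  also have "\<dots> = cut_sum K (\<lambda>b b'. \<Sum>i<B. \<Sum>j<B. g (b * B + i) (b' * B + j)) \<sigma>"
    unfolding cut_sum_def by (intro sum.cong refl) auto
  finally show ?thesis .
qed

section \<open>The comb and the blob graph\<close>

text \<open>The spine is the path through the first \<open>n\<close> blobs, that is, through all
  vertices below \<open>n * B\<close>. The tooth at \<open>p\<close> ends at the vertex of the same
  index in the partner blob, \<open>n\<close> blobs later.\<close>

definition tree_step :: "nat \<Rightarrow> nat \<Rightarrow> nat \<Rightarrow> nat \<Rightarrow> bool" where
  "tree_step n B p q \<longleftrightarrow> q = Suc p \<and> q < n * B \<or> q = p + n * B \<and> p < n * B"

definition comb_adj :: "nat \<Rightarrow> nat \<Rightarrow> nat \<Rightarrow> nat \<Rightarrow> bool" where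
  "comb_adj n B p q \<longleftrightarrow> tree_step n B p q \<or> tree_step n B q p"

text \<open>Edges to the next index in a later blob. The shift by one keeps them apart from the
  teeth, which preserve the index, and from the spine, which passes from the last index of a blob to
  index 0 of the next. A vertex gets at most one such edge to every other blob, so degrees stay
  small.\<close>

definition cross_step :: "nat \<Rightarrow> (nat \<Rightarrow> nat \<Rightarrow> nat) \<Rightarrow> nat \<Rightarrow> nat \<Rightarrow> bool" where
  "cross_step B w p q \<longleftrightarrow>
     p div B < q div B \<and> q mod B = Suc (p mod B) \<and> p mod B < w (p div B) (q div B)"

definition blob_adj :: "nat \<Rightarrow> nat \<Rightarrow> (nat \<Rightarrow> nat \<Rightarrow> nat) \<Rightarrow> nat \<Rightarrow> nat \<Rightarrow> bool" where
  "blob_adj n B w p q \<longleftrightarrow> comb_adj n B p q \<or> p div B = q div B \<and> p \<noteq> q \<or>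
     cross_step B w p q \<or> cross_step B w q p"

text \<open>For \<open>b < b'\<close>: the teeth between partners, the one spine edge between
  consecutive blobs, and the cross edges.\<close>

definition blob_weight :: "nat \<Rightarrow> nat \<Rightarrow> (nat \<Rightarrow> nat \<Rightarrow> nat) \<Rightarrow> nat \<Rightarrow> nat \<Rightarrow> int" where
  "blob_weight n B w b b' =
     (if b' = b + n then int B else 0) + (if b' = Suc b \<and> b' < n then 1 else 0) - int (w b b')"

text \<open>\<open>16 * n + 24\<close> is \<open>4 * \<Delta> + 8\<close> for the bound
  \<open>\<Delta> = 4 * n + 4\<close> on the degree between blobs. Weights below \<open>B\<close>
  leave room for the index shift of the cross edges.\<close>

locale blob_graph =
  fixes n B :: nat and w :: "nat \<Rightarrow> nat \<Rightarrow> nat"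
  assumes n: "0 < n" and B: "16 * n + 24 \<le> B"
    and w: "\<And>b b'. b < b' \<Longrightarrow> b' < 2 * n \<Longrightarrow> w b b' < B"
begin

text \<open>Summed over a cut, this is twice the number of tree edges minus the number of all
  edges.\<close>

definition g :: "nat \<Rightarrow> nat \<Rightarrow> int" where
  "g p q = (if comb_adj n B p q then 1 else if blob_adj n B w p q then -1 else 0)"

abbreviation "N \<equiv> 2 * n * B"

lemma B_pos: "0 < B"
  using B by simp

lemma nB_pos: "0 < n * B"
  using n B_pos by simp

lemma comb_sym: "comb_adj n B p q = comb_adj n B q p"
  by (auto simp: comb_adj_def)

lemma blob_sym: "blob_adj n B w p q = blob_adj n B w q p"
  using comb_sym[of p q] by (auto simp: blob_adj_def)

lemma comb_irrefl: "\<not> comb_adj n B p p"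
  using nB_pos by (auto simp: comb_adj_def tree_step_def)

lemma blob_irrefl: "\<not> blob_adj n B w p p"
  using comb_irrefl by (auto simp: blob_adj_def cross_step_def)

lemma comb_blob: "comb_adj n B p q \<Longrightarrow> blob_adj n B w p q"
  by (simp add: blob_adj_def)

abbreviation "E \<equiv> edges N (blob_adj n B w)"
abbreviation "T \<equiv> edges N (comb_adj n B)"

lemma simple: "simple_graph {..<N} E"
  unfolding simple_graph_def
proof (intro conjI ballI)
  show "{..<N} \<noteq> {}" using nB_pos by (auto simp: lessThan_empty_iff)
  fix e assume "e \<in> E"
  thus "e \<subseteq> {..<N}" "card e = 2"
    using edges_graph[of N "blob_adj n B w" e] blob_irrefl by auto
qed simp

lemma T_mem: "{p, q} \<in> T \<longleftrightarrow> p < N \<and> q < N \<and> comb_adj n B p q"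
  by (rule edges_mem) (simp add: comb_sym)

text \<open>For \<open>p\<close> other than 0 this is the only neighbour with a smaller number: the
  predecessor on the spine or the foot of the tooth.\<close>

definition parent :: "nat \<Rightarrow> nat" where
  "parent p = (if p < n * B then p - 1 else p - n * B)"

lemma comb_less: "comb_adj n B p q \<Longrightarrow> q < p \<Longrightarrow> q = parent p"
  unfolding comb_adj_def tree_step_def parent_def by (auto split: if_splits)

lemma comb_parent: "0 < p \<Longrightarrow> p < N \<Longrightarrow> comb_adj n B p (parent p) \<and> parent p < p"
  using nB_pos unfolding comb_adj_def tree_step_def parent_def by auto

text \<open>Every vertex except 0 has exactly one smaller neighbour. So the least vertex separated
  from 0 has a tree edge across the cut, and the largest vertex of a set has at most one neighbour
  in it, which excludes cycles.\<close>

lemma spanning: "spanning_tree {..<N} E T"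
  unfolding spanning_tree_def
proof (intro conjI)
  show "T \<subseteq> E" unfolding edges_def using comb_blob by blast
  have gT: "\<forall>e\<in>T. e \<subseteq> {..<N} \<and> card e = 2"
    using edges_graph[of N "comb_adj n B"] comb_irrefl by blast
  show "connected_graph {..<N} T"
  proof (subst connected_graph_iff)
    show "\<forall>e\<in>T. e \<subseteq> {..<N}" using gT by blast
    show "\<forall>A. A \<subseteq> {..<N} \<and> A \<noteq> {} \<and> A \<noteq> {..<N} \<longrightarrow> (\<exists>u\<in>A. \<exists>v\<in>{..<N} - A. {u, v} \<in> T)"
    proof (intro allI impI)
      fix A assume A: "A \<subseteq> {..<N} \<and> A \<noteq> {} \<and> A \<noteq> {..<N}"
      define P where "P p \<longleftrightarrow> p < N \<and> (p \<in> A) \<noteq> (0 \<in> A)" for p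
      have "\<exists>p. P p" using A unfolding P_def by blast
      define p where "p = (LEAST p. P p)"
      have p: "P p" unfolding p_def using \<open>\<exists>p. P p\<close> by (rule LeastI_ex)
      hence "0 < p" by (cases p) (auto simp: P_def)
      hence c: "comb_adj n B p (parent p)" "parent p < p" using p comb_parent by (auto simp: P_def)
      hence "\<not> P (parent p)" unfolding p_def using not_less_Least by blast
      moreover have "parent p < N" using c(2) p by (simp add: P_def)
      ultimately have "(p \<in> A) \<noteq> (parent p \<in> A)" using p by (auto simp: P_def)
      moreover have "{p, parent p} \<in> T" "{parent p, p} \<in> T"
        using c(1) p \<open>parent p < N\<close> comb_sym by (auto simp: T_mem P_def)
      moreover have "p \<in> {..<N}" "parent p \<in> {..<N}" using p \<open>parent p < N\<close> by (auto simp: P_def)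
      ultimately show "\<exists>u\<in>A. \<exists>v\<in>{..<N} - A. {u, v} \<in> T" by blast
    qed
  qed
  show "\<nexists>c. graph_cycle T c"
  proof (subst cycle_iff_min_degree[of "{..<N}"])
    show "\<not> (\<exists>A\<subseteq>{..<N}. A \<noteq> {} \<and> (\<forall>u\<in>A. \<exists>v\<in>A. \<exists>z\<in>A. v \<noteq> z \<and> {u, v} \<in> T \<and> {u, z} \<in> T))"
    proof
      assume "\<exists>A\<subseteq>{..<N}. A \<noteq> {} \<and> (\<forall>u\<in>A. \<exists>v\<in>A. \<exists>z\<in>A. v \<noteq> z \<and> {u, v} \<in> T \<and> {u, z} \<in> T)"
      then obtain A where A: "A \<subseteq> {..<N}" "A \<noteq> {}" "\<forall>u\<in>A. \<exists>v\<in>A. \<exists>z\<in>A. v \<noteq> z \<and> {u, v} \<in> T \<and> {u, z} \<in> T" by blast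
      have fin: "finite A" using A(1) finite_subset by blast
      hence "Max A \<in> A" using A(2) by simp
      then obtain v z where vz: "v \<in> A" "z \<in> A" "v \<noteq> z" "{Max A, v} \<in> T" "{Max A, z} \<in> T" using A(3) by blast
      have "y = parent (Max A)" if "y \<in> A" "{Max A, y} \<in> T" for y
      proof (rule comb_less)
        show c: "comb_adj n B (Max A) y" using that(2) by (simp add: T_mem)
        have "y \<le> Max A" using fin that(1) by simp
        moreover have "y \<noteq> Max A" using c comb_irrefl by auto
        ultimately show "y < Max A" by simp
      qed
      thus False using vz by metis
    qed
  qed (use gT in auto)
qed

lemma cut_sum_edges:
  assumes "A \<subseteq> {..<N}"
  shows "cut_sum N g (\<lambda>p. p \<in> A) = 2 * int (card (cut_edges T A)) - int (card (cut_edges E A))"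
proof -
  have cT: "card (cut_edges T A) = (\<Sum>u<N. \<Sum>v<N. if u \<in> A \<and> v \<notin> A \<and> comb_adj n B u v then 1 else 0)"
    by (rule card_cut_edges) (rule comb_sym, rule comb_irrefl)
  have cE: "card (cut_edges E A) = (\<Sum>u<N. \<Sum>v<N. if u \<in> A \<and> v \<notin> A \<and> blob_adj n B w u v then 1 else 0)"
    by (rule card_cut_edges) (rule blob_sym, rule blob_irrefl)
  show ?thesis
    unfolding cT cE cut_sum_def of_nat_sum sum_distrib_left sum_subtractf[symmetric]
    by (intro sum.cong refl) (auto simp: g_def dest: comb_blob)
qed

text \<open>The empty and the full vertex set have value 0, so the right-hand side can range over
  all sets.\<close>

lemma thin_iff_cut_sum: "thin {..<N} E T (real 1 / real 2) \<longleftrightarrow> (\<forall>A. cut_sum N g A \<le> 0)"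
proof -
  have finE: "finite E"
    using simple by (intro finite_subset[of E "Pow {..<N}"]) (auto simp: simple_graph_def)
  have TE: "T \<subseteq> E" using spanning by (simp add: spanning_tree_def)
  have key: "cut_sum N g (\<lambda>p. p \<in> A) \<le> 0 \<longleftrightarrow> \<not> 1 * card (cut_edges E A) < card (cut_edges T A) * 2"
    if "A \<subseteq> {..<N}" for A
    using cut_sum_edges[OF that] by linarith
  have zero: "cut_sum N g (\<lambda>p. p \<in> A) = 0" if "A = {} \<or> A = {..<N}" for A
    unfolding cut_sum_def using that by (intro sum.neutral ballI) auto
  have restrict: "cut_sum N g A = cut_sum N g (\<lambda>p. p \<in> {p. p < N \<and> A p})" for A
    unfolding cut_sum_def by (intro sum.cong refl) auto
  show ?thesis
    unfolding thin_iff[OF finE TE zero_less_numeral]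
  proof
    assume h: "\<forall>A. A \<subseteq> {..<N} \<and> A \<noteq> {} \<and> A \<noteq> {..<N} \<longrightarrow> \<not> 1 * card (cut_edges E A) < card (cut_edges T A) * 2"
    show "\<forall>A. cut_sum N g A \<le> 0"
    proof
      fix A
      let ?A = "{p. p < N \<and> A p}"
      have sub: "?A \<subseteq> {..<N}" by auto
      have "cut_sum N g (\<lambda>p. p \<in> ?A) \<le> 0"
      proof (cases "?A = {} \<or> ?A = {..<N}")
        case False
        thus ?thesis unfolding key[OF sub] using h sub by blast
      next
        case True
        from zero[OF this] show ?thesis by linarith
      qed
      thus "cut_sum N g A \<le> 0" using restrict[of A] by simp
    qed
  next
    assume "\<forall>A. cut_sum N g A \<le> 0"
    thus "\<forall>A. A \<subseteq> {..<N} \<and> A \<noteq> {} \<and> A \<noteq> {..<N} \<longrightarrow> \<not> 1 * card (cut_edges E A) < card (cut_edges T A) * 2"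
      using key by blast
  qed
qed

lemma g_sym: "g p q = g q p"
  unfolding g_def comb_sym[of p q] blob_sym[of p q] by (rule refl)

text \<open>Pairs inside a blob are joined by non-tree edges unless they are consecutive on the
  spine.\<close>

lemma g_internal:
  assumes "b < 2 * n" "i < B" "j < B" "i \<noteq> j"
  shows "g (b * B + i) (b * B + j) \<le> (if i = Suc j \<or> j = Suc i then 1 else -1)"
proof (cases "i = Suc j \<or> j = Suc i")
  case False
  have "B \<le> n * B" using n by simp
  hence "j \<noteq> i + n * B" "i \<noteq> j + n * B" using assms by linarith+
  hence "\<not> comb_adj n B (b * B + i) (b * B + j)"
    using False assms unfolding comb_adj_def tree_step_def by auto
  moreover have "blob_adj n B w (b * B + i) (b * B + j)"
    using assms by (simp add: blob_adj_def block_div_mod)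
  ultimately show ?thesis using False by (simp add: g_def)
qed (simp add: g_def)

text \<open>At most 4 neighbours come from the comb, and in each of the \<open>2 * n\<close> blobs
  only two indices are possible for cross edges.\<close>

lemma g_degree:
  assumes "p < 2 * n * B"
  shows "(\<Sum>q<2 * n * B. if q div B \<noteq> p div B then \<bar>g p q\<bar> else 0) \<le> int (4 * n + 4)"
proof -
  let ?S = "{q\<in>{..<N}. q div B \<noteq> p div B \<and> blob_adj n B w p q}"
  let ?C = "{Suc p, p - 1, p + n * B, p - n * B} \<union>
    ((\<lambda>b. b * B + Suc (p mod B)) ` {..<2 * n} \<union> (\<lambda>b. b * B + (p mod B - 1)) ` {..<2 * n})"
  have "(\<Sum>q<N. if q div B \<noteq> p div B then \<bar>g p q\<bar> else 0) \<le>
      (\<Sum>q<N. if q div B \<noteq> p div B \<and> blob_adj n B w p q then 1 else 0)"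
    by (intro sum_mono) (auto simp: g_def dest: comb_blob)
  also have "\<dots> = int (card ?S)" by (simp add: sum.If_cases Int_def conj_commute)
  also have "card ?S \<le> card ?C"
  proof (rule card_mono)
    show "?S \<subseteq> ?C"
    proof
      fix q assume "q \<in> ?S"
      hence q: "q < N" "q div B \<noteq> p div B" "blob_adj n B w p q" by auto
      have qb: "q div B < 2 * n" using q(1) by (simp add: less_mult_imp_div_less)
      have qe: "q = q div B * B + q mod B" by simp
      from q consider "comb_adj n B p q" | "cross_step B w p q" | "cross_step B w q p"
        by (auto simp: blob_adj_def)
      thus "q \<in> ?C"
      proof cases
        case 1
        thus ?thesis by (auto simp: comb_adj_def tree_step_def)
      next
        case 2
        hence "q mod B = Suc (p mod B)" by (simp add: cross_step_def)
        thus ?thesis using qb qe by (metis UnI1 UnI2 imageI lessThan_iff)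
      next
        case 3
        hence "q mod B = p mod B - 1" by (simp add: cross_step_def)
        thus ?thesis using qb qe by (metis UnI1 UnI2 imageI lessThan_iff)
      qed
    qed
  qed simp
  also have "card ?C \<le> 4 + (2 * n + 2 * n)"
  proof -
    have "card {Suc p, p - 1, p + n * B, p - n * B} \<le> 4" by (simp add: card_insert_if)
    moreover have "card ((\<lambda>b. b * B + Suc (p mod B)) ` {..<2 * n}) \<le> 2 * n"
      "card ((\<lambda>b. b * B + (p mod B - 1)) ` {..<2 * n}) \<le> 2 * n"
      using card_image_le[of "{..<2 * n}"] by (metis card_lessThan finite_lessThan)+
    ultimately show ?thesis
      using card_Un_le[of "{Suc p, p - 1, p + n * B, p - n * B}"
          "(\<lambda>b. b * B + Suc (p mod B)) ` {..<2 * n} \<union> (\<lambda>b. b * B + (p mod B - 1)) ` {..<2 * n}"]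
        card_Un_le[of "(\<lambda>b. b * B + Suc (p mod B)) ` {..<2 * n}" "(\<lambda>b. b * B + (p mod B - 1)) ` {..<2 * n}"]
      by linarith
  qed
  finally show ?thesis by simp
qed

lemma g_block_sum:
  assumes "b < b'" "b' < 2 * n"
  shows "(\<Sum>i<B. \<Sum>j<B. g (b * B + i) (b' * B + j)) = blob_weight n B w b b'"
proof -
  \<comment> \<open>Spine, teeth and cross edges between two blobs never coincide; the nested
    conditionals let the double sums collapse.\<close>
  have eqv: "g (b * B + i) (b' * B + j) =
      (if b' = b + n then if j = i then 1 else 0 else 0) +
      (if b' = Suc b \<and> b' < n then if i = B - 1 then if j = 0 then 1 else 0 else 0 else 0) -
      (if i < w b b' then if j = Suc i then 1 else 0 else 0)"
    if i: "i < B" and j: "j < B" for i j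
  proof -
    have le: "b * B + B \<le> b' * B" using assms(1) mult_le_mono1[of "Suc b" b' B] by simp
    have lt: "b * B + i < b' * B + j" using le i by linarith
    have nback: "\<not> tree_step n B (b' * B + j) (b * B + i)" using lt by (auto simp: tree_step_def)
    have link: "b' * B + j = Suc (b * B + i) \<longleftrightarrow> b' = Suc b \<and> i = B - 1 \<and> j = 0"
    proof
      assume h: "b' * B + j = Suc (b * B + i)"
      hence "b' * B = b * B + B" "j = 0" "i = B - 1" using le i by linarith+
      moreover from this have "b' * B = Suc b * B" by simp
      hence "b' = Suc b" using B_pos by (simp only: mult_right_cancel)
      ultimately show "b' = Suc b \<and> i = B - 1 \<and> j = 0" by simp
    qed (use B_pos in auto)
    have link': "b' * B + j < n * B \<longleftrightarrow> b' < n"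
    proof
      assume "b' * B + j < n * B"
      hence "b' * B < n * B" by linarith
      thus "b' < n" using B_pos by simp
    next
      assume "b' < n"
      hence "Suc b' * B \<le> n * B" by (intro mult_le_mono1) simp
      thus "b' * B + j < n * B" using j by simp
    qed
    have mate: "b' * B + j = b * B + i + n * B \<and> b * B + i < n * B \<longleftrightarrow> b' = b + n \<and> j = i"
    proof
      assume h: "b' * B + j = b * B + i + n * B \<and> b * B + i < n * B"
      hence e: "b' * B + j = (b + n) * B + i" by (simp add: algebra_simps)
      have "(b' * B + j) div B = b'" "((b + n) * B + i) div B = b + n" using i j by (simp_all only: block_div_mod)
      hence "b' = b + n" using e by simp
      thus "b' = b + n \<and> j = i" using e by simp
    next
      assume h: "b' = b + n \<and> j = i"
      hence "b < n" using assms(2) by simp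
      hence "Suc b * B \<le> n * B" by (intro mult_le_mono1) simp
      thus "b' * B + j = b * B + i + n * B \<and> b * B + i < n * B" using h i by (simp add: add_mult_distrib)
    qed
    have comb: "comb_adj n B (b * B + i) (b' * B + j) \<longleftrightarrow>
        (b' = Suc b \<and> b' < n \<and> i = B - 1 \<and> j = 0) \<or> (b' = b + n \<and> j = i)"
    proof -
      have "comb_adj n B (b * B + i) (b' * B + j) \<longleftrightarrow> tree_step n B (b * B + i) (b' * B + j)"
        unfolding comb_adj_def using nback by blast
      thus ?thesis unfolding tree_step_def mate link link' by blast
    qed
    have blob: "blob_adj n B w (b * B + i) (b' * B + j) \<longleftrightarrow> comb_adj n B (b * B + i) (b' * B + j) \<or>
        (j = Suc i \<and> i < w b b')"
      using assms(1) i j by (auto simp: blob_adj_def cross_step_def block_div_mod)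
    show ?thesis unfolding g_def blob comb using n B by auto
  qed
  have wB: "w b b' < B" by (rule w[OF assms])
  have "(\<Sum>i<B. \<Sum>j<B. g (b * B + i) (b' * B + j)) = (\<Sum>i<B. \<Sum>j<B.
      (if b' = b + n then if j = i then 1 else 0 else 0) +
      (if b' = Suc b \<and> b' < n then if i = B - 1 then if j = 0 then 1 else 0 else 0 else 0) -
      (if i < w b b' then if j = Suc i then 1 else 0 else 0))"
    by (intro sum.cong refl) (simp add: eqv)
  also have "\<dots> = (\<Sum>i<B. (if b' = b + n then 1 else 0)) +
      (\<Sum>i<B. if b' = Suc b \<and> b' < n then if i = B - 1 then 1 else 0 else 0) -
      (\<Sum>i<B. if i < w b b' then 1 else 0)"
    unfolding sum.distrib[symmetric] sum_subtractf[symmetric]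
  proof (intro sum.cong refl)
    fix i assume "i \<in> {..<B}"
    hence i: "i < B" by simp
    have 1: "(\<Sum>j<B. if i < w b b' then if j = Suc i then 1 else (0::int) else 0) = (if i < w b b' then 1 else 0)"
      using wB by auto
    have 2: "(\<Sum>j<B. if P then if Q then if j = 0 then 1 else (0::int) else 0 else 0) =
        (if P then if Q then 1 else 0 else 0)" for P Q using B_pos by (cases P; cases Q) simp_all
    have 3: "(\<Sum>j<B. if P then if j = i then 1 else (0::int) else 0) = (if P then 1 else 0)" for P
      using i by (cases P) simp_all
    show "(\<Sum>j<B. (if b' = b + n then if j = i then 1 else 0 else 0) +
      (if b' = Suc b \<and> b' < n then if i = B - 1 then if j = 0 then 1 else 0 else 0 else 0) -
      (if i < w b b' then if j = Suc i then 1 else 0 else 0)) =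
      (if b' = b + n then 1 else 0) + (if b' = Suc b \<and> b' < n then if i = B - 1 then 1 else 0 else 0) -
      (if i < w b b' then 1 else (0::int))"
      unfolding sum.distrib sum_subtractf 1 2 3 by (rule refl)
  qed
  also have "\<dots> = blob_weight n B w b b'"
  proof -
    have "{..<B} \<inter> {i. i < w b b'} = {..<w b b'}" using wB by auto
    hence "(\<Sum>i<B. if i < w b b' then 1 else (0::int)) = int (w b b')" by (simp add: sum.If_cases)
    moreover have "(\<Sum>i<B. if P then if i = B - 1 then 1 else (0::int) else 0) = (if P then 1 else 0)" for P
      using B_pos by (cases P) simp_all
    moreover have "(\<Sum>i<B. if P then 1 else (0::int)) = (if P then int B else 0)" for P by simp
    ultimately show ?thesis unfolding blob_weight_def by (simp only:)
  qed
  finally show ?thesis .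
qed

definition W :: "nat \<Rightarrow> nat \<Rightarrow> int" where
  "W b b' = (if b < b' then blob_weight n B w b b' else blob_weight n B w b' b)"

text \<open>By rounding, an optimal cut may be taken constant on blobs, so whole blobs become the
  vertices of a weighted maximum cut.\<close>

theorem thin_iff_blobs:
  "thin {..<N} E T (real 1 / real 2) \<longleftrightarrow> (\<forall>\<sigma>. cut_sum (2 * n) W \<sigma> \<le> 0)"
proof -
  have eq: "cut_sum (2 * n * B) g (\<lambda>p. \<sigma> (p div B)) = cut_sum (2 * n) W \<sigma>" for \<sigma>
    unfolding cut_sum_blocks[OF B_pos] unfolding cut_sum_def
  proof (intro sum.cong refl)
    fix b b' assume "b \<in> {..<2 * n}" "b' \<in> {..<2 * n}"
    hence lt: "b < 2 * n" "b' < 2 * n" by auto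
    have "(\<Sum>i<B. \<Sum>j<B. g (b * B + i) (b' * B + j)) = W b b'" if "b \<noteq> b'"
    proof (cases "b < b'")
      case True
      thus ?thesis using g_block_sum[OF True lt(2)] by (simp add: W_def)
    next
      case False
      hence "b' < b" using that by simp
      have "(\<Sum>i<B. \<Sum>j<B. g (b * B + i) (b' * B + j)) = (\<Sum>j<B. \<Sum>i<B. g (b' * B + j) (b * B + i))"
        by (subst sum.swap) (simp only: g_sym)
      thus ?thesis using g_block_sum[OF \<open>b' < b\<close> lt(1)] False by (simp add: W_def)
    qed
    thus "(if \<sigma> b \<and> \<not> \<sigma> b' then \<Sum>i<B. \<Sum>j<B. g (b * B + i) (b' * B + j) else 0) =
       (if \<sigma> b \<and> \<not> \<sigma> b' then W b b' else 0)" by auto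
  qed
  have round: "\<exists>\<sigma>. cut_sum (2 * n * B) g A \<le> cut_sum (2 * n * B) g (\<lambda>p. \<sigma> (p div B))" for A
    by (rule cut_sum_rounding[where \<Delta> = "4 * n + 4"])
      (rule g_sym, erule (3) g_internal, erule g_degree, use B in simp)
  show ?thesis unfolding thin_iff_cut_sum
  proof
    assume "\<forall>A. cut_sum N g A \<le> 0"
    thus "\<forall>\<sigma>. cut_sum (2 * n) W \<sigma> \<le> 0" using eq by metis
  next
    assume "\<forall>\<sigma>. cut_sum (2 * n) W \<sigma> \<le> 0"
    thus "\<forall>A. cut_sum N g A \<le> 0" using eq round by (metis order.trans)
  qed
qed

end

section \<open>Independent sets as cuts\<close>

lemma cut_sum_less:
  assumes "\<And>b b'. W b b' = W b' b"
  shows "cut_sum K W s = (\<Sum>b'<K. \<Sum>b<b'. if s b \<noteq> s b' then W b b' else 0)"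
proof (induction K)
  case (Suc K)
  have "cut_sum (Suc K) W s = cut_sum K W s + (\<Sum>b<K. (if s b \<and> \<not> s K then W b K else 0)) +
      (\<Sum>b<K. if s K \<and> \<not> s b then W K b else 0)"
    unfolding cut_sum_def by (simp add: sum.distrib)
  also have "\<dots> = cut_sum K W s + (\<Sum>b<K. if s b \<noteq> s K then W b K else 0)"
    unfolding add.assoc sum.distrib[symmetric] using assms[of K]
    by (intro arg_cong2[of _ _ _ _ "(+)"] sum.cong refl) auto
  finally show ?case using Suc by simp
qed (simp add: cut_sum_def)

lemma sum_lessThan_add: "(\<Sum>i<n + m. f i) = (\<Sum>i<n. f i) + (\<Sum>i<m. f (n + i))"
  for f :: "nat \<Rightarrow> 'a::comm_monoid_add"
  by (induction m) (auto simp: add.assoc)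

definition cdeg :: "nat \<Rightarrow> (nat \<Rightarrow> nat \<Rightarrow> bool) \<Rightarrow> nat \<Rightarrow> nat" where
  "cdeg N conf v = (\<Sum>u<N. if conf v u then 1 else 0)"

text \<open>Blobs have twice this size. It exceeds the sum of all degrees, at most
  \<open>N * N\<close>, by a margin linear in \<open>N\<close>, so that all weights between blobs
  stay below the tooth weight \<open>2 * half N\<close>.\<close>

definition half :: "nat \<Rightarrow> nat" where
  "half N = (N + 6) * (N + 6)"

text \<open>Blob 0 stands for false and \<open>Suc N\<close> for true, \<open>Suc v\<close> for the
  variable of vertex \<open>v\<close> and \<open>Suc N + Suc v\<close> for its negation. The four
  edges of \<open>v\<close> to the constants are balanced against its tooth: consistently placed,
  \<open>v\<close> loses twice its degree if chosen and 2 if not. A conflict edge is then cut when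
  the two variables agree. Of the teeth between the constants, the sum of the degrees plus
  \<open>2 * N + 1 - 2 * m\<close> is left.\<close>

definition base_weight :: "nat \<Rightarrow> nat \<Rightarrow> (nat \<Rightarrow> nat \<Rightarrow> bool) \<Rightarrow> nat \<Rightarrow> nat \<Rightarrow> nat" where
  "base_weight N m conf b b' =
     (if b = 0 then
        if b' < Suc N then half N + cdeg N conf (b' - 1)
        else if b' = Suc N then 2 * half N + 2 * m - ((\<Sum>v<N. cdeg N conf v) + 2 * N + 1)
        else half N + 1
      else if b < Suc N then
        if b' = Suc N then half N + 1
        else if Suc N < b' \<and> conf (b - 1) (b' - Suc N - 1) then 1 else 0
      else if b = Suc N then half N + cdeg N conf (b' - Suc N - 1) else 0)"

definition conf_weight :: "nat \<Rightarrow> nat \<Rightarrow> (nat \<Rightarrow> nat \<Rightarrow> bool) \<Rightarrow> nat \<Rightarrow> nat \<Rightarrow> nat" where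
  "conf_weight N m conf b b' =
     base_weight N m conf b b' + (if b' = Suc b \<and> b' < Suc N then 1 else 0)"

locale conflict =
  fixes N m :: nat and conf :: "nat \<Rightarrow> nat \<Rightarrow> bool"
  assumes conf_sym: "\<And>u v. conf u v = conf v u" and conf_irrefl: "\<And>u. \<not> conf u u"
    and m_le: "m \<le> N"
begin

abbreviation "dg \<equiv> cdeg N conf"
abbreviation "\<beta> \<equiv> half N"
abbreviation "n \<equiv> Suc N"

lemma dg_le: "dg v \<le> N"
  using sum_bounded_above[of "{..<N}" "\<lambda>u. if conf v u then 1 else 0" "1::nat"]
  by (simp add: cdeg_def)

lemma sum_dg_le: "(\<Sum>v<N. dg v) \<le> N * N"
  using sum_bounded_above[of "{..<N}" dg N] dg_le by simp

lemma half_ge: "N * N + 12 * N + 36 \<le> \<beta>"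
  by (simp add: half_def algebra_simps)

sublocale blob_graph n "2 * \<beta>" "conf_weight N m conf"
proof
  show "0 < n" by simp
  show "16 * n + 24 \<le> 2 * \<beta>" using half_ge by simp
  fix b b' assume "b < b'" "b' < 2 * n"
  have "N \<le> N * N + N" by simp
  hence le: "dg v + 3 \<le> \<beta>" for v using dg_le[of v] half_ge by linarith
  have "2 * \<beta> + 2 * m - ((\<Sum>v<N. dg v) + 2 * N + 1) < 2 * \<beta>" using m_le half_ge by linarith
  moreover have "\<beta> + 1 + 1 < 2 * \<beta>" using half_ge by linarith
  moreover have "\<beta> + dg v + 1 < 2 * \<beta>" for v using le[of v] by linarith
  moreover have "1 + 1 < 2 * \<beta>" using half_ge by linarith
  ultimately show "conf_weight N m conf b b' < 2 * \<beta>"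
    unfolding conf_weight_def base_weight_def using le
    by (auto simp: less_Suc_eq_le intro: Suc_lessD)
qed

lemma cut_formula:
  "cut_sum (2 * n) W s =
     (if s 0 \<noteq> s n then int (\<Sum>v<N. dg v) + 2 * int N + 1 - 2 * int m else 0) +
     (\<Sum>v<N. (if s (Suc v) \<noteq> s (n + Suc v) then 2 * int \<beta> else 0)
        - (int \<beta> + int (dg v)) * ((if s 0 \<noteq> s (Suc v) then 1 else 0) + (if s n \<noteq> s (n + Suc v) then 1 else 0))
        - (int \<beta> + 1) * ((if s 0 \<noteq> s (n + Suc v) then 1 else 0) + (if s (Suc v) \<noteq> s n then 1 else 0))) -
     (\<Sum>u<N. \<Sum>v<N. if conf u v \<and> s (Suc u) \<noteq> s (n + Suc v) then 1 else 0)"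
proof -
  define f where "f b b' = (if s b \<noteq> s b' then blob_weight n (2 * \<beta>) (conf_weight N m conf) b b' else 0)" for b b'
  \<comment> \<open>The spine edges between blobs cancel against the extra summand of
    \<open>conf_weight\<close>.\<close>
  have bw: "blob_weight n (2 * \<beta>) (conf_weight N m conf) b b' =
      (if b' = b + n then 2 * int \<beta> else 0) - int (base_weight N m conf b b')" for b b'
    unfolding blob_weight_def conf_weight_def by simp
  have Wsym: "W b b' = W b' b" for b b'
    unfolding W_def by auto
  have "cut_sum (2 * n) W s = (\<Sum>b'<2 * n. \<Sum>b<b'. f b b')"
    unfolding cut_sum_less[OF Wsym] f_def by (intro sum.cong refl) (auto simp: W_def)
  also have "\<dots> = (\<Sum>b'<n + n. \<Sum>b<b'. f b b')" by (simp only: mult_2)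
  \<comment> \<open>Pairs among the first \<open>n\<close> blobs, between the two halves, and among
    the partners.\<close>
  also have "\<dots> = (\<Sum>b'<n. \<Sum>b<b'. f b b') + ((\<Sum>b'<n. \<Sum>b<n. f b (n + b')) + (\<Sum>b'<n. \<Sum>b<b'. f (n + b) (n + b')))"
    by (simp only: sum_lessThan_add sum.distrib)
  also have "(\<Sum>b'<n. \<Sum>b<b'. f b b') = (\<Sum>v<N. f 0 (Suc v))"
  proof -
    have z: "f (Suc u) (Suc v) = 0" if "u < v" "v < N" for u v
      using that unfolding f_def bw base_weight_def by simp
    have "(\<Sum>b'<n. \<Sum>b<b'. f b b') = (\<Sum>v<N. f 0 (Suc v) + (\<Sum>u<v. f (Suc u) (Suc v)))"
      by (simp only: sum.lessThan_Suc_shift) simp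
    also have "\<dots> = (\<Sum>v<N. f 0 (Suc v))" by (intro sum.cong refl) (simp add: z)
    finally show ?thesis .
  qed
  also have "(\<Sum>b'<n. \<Sum>b<b'. f (n + b) (n + b')) = (\<Sum>v<N. f n (n + Suc v))"
  proof -
    have z: "f (n + Suc u) (n + Suc v) = 0" if "u < v" "v < N" for u v
      using that unfolding f_def bw base_weight_def by simp
    have "(\<Sum>b'<n. \<Sum>b<b'. f (n + b) (n + b')) = (\<Sum>v<N. f (n + 0) (n + Suc v) + (\<Sum>u<v. f (n + Suc u) (n + Suc v)))"
      by (simp only: sum.lessThan_Suc_shift) simp
    also have "\<dots> = (\<Sum>v<N. f n (n + Suc v))"
    proof (intro sum.cong refl)
      fix v assume "v \<in> {..<N}"
      hence "(\<Sum>u<v. f (n + Suc u) (n + Suc v)) = 0" by (intro sum.neutral ballI z) auto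
      thus "f (n + 0) (n + Suc v) + (\<Sum>u<v. f (n + Suc u) (n + Suc v)) = f n (n + Suc v)"
        by (simp only: add_0_right)
    qed
    finally show ?thesis .
  qed
  also have "(\<Sum>b'<n. \<Sum>b<n. f b (n + b')) =
      f 0 n + (\<Sum>u<N. f (Suc u) n) + (\<Sum>v<N. f 0 (n + Suc v)) + (\<Sum>v<N. \<Sum>u<N. f (Suc u) (n + Suc v))"
    by (simp only: sum.lessThan_Suc_shift sum.distrib) simp
  also have "(\<Sum>v<N. \<Sum>u<N. f (Suc u) (n + Suc v)) =
      (\<Sum>v<N. if s (Suc v) \<noteq> s (n + Suc v) then 2 * int \<beta> else 0) -
      (\<Sum>u<N. \<Sum>v<N. if conf u v \<and> s (Suc u) \<noteq> s (n + Suc v) then 1 else 0)"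
  proof -
    have e: "f (Suc u) (n + Suc v) =
       (if u = v then if s (Suc v) \<noteq> s (n + Suc v) then 2 * int \<beta> else 0 else 0) -
       (if conf u v \<and> s (Suc u) \<noteq> s (n + Suc v) then 1 else 0)" if "u < N" "v < N" for u v
      using that conf_irrefl unfolding f_def bw base_weight_def by auto
    have "(\<Sum>v<N. \<Sum>u<N. f (Suc u) (n + Suc v)) = (\<Sum>v<N. \<Sum>u<N.
       (if u = v then if s (Suc v) \<noteq> s (n + Suc v) then 2 * int \<beta> else 0 else 0) -
       (if conf u v \<and> s (Suc u) \<noteq> s (n + Suc v) then 1 else 0))"
      by (intro sum.cong refl e) auto
    also have "\<dots> = (\<Sum>v<N. if s (Suc v) \<noteq> s (n + Suc v) then 2 * int \<beta> else 0) -
       (\<Sum>v<N. \<Sum>u<N. if conf u v \<and> s (Suc u) \<noteq> s (n + Suc v) then 1 else 0)"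
      by (simp add: sum_subtractf)
    also have "(\<Sum>v<N. \<Sum>u<N. if conf u v \<and> s (Suc u) \<noteq> s (n + Suc v) then 1 else (0::int)) =
       (\<Sum>u<N. \<Sum>v<N. if conf u v \<and> s (Suc u) \<noteq> s (n + Suc v) then 1 else 0)" by (rule sum.swap)
    finally show ?thesis .
  qed
  finally have sum1: "cut_sum (2 * n) W s = f 0 n +
      (\<Sum>v<N. (if s (Suc v) \<noteq> s (n + Suc v) then 2 * int \<beta> else 0) + f 0 (Suc v) + f n (n + Suc v) +
         f 0 (n + Suc v) + f (Suc v) n) -
      (\<Sum>u<N. \<Sum>v<N. if conf u v \<and> s (Suc u) \<noteq> s (n + Suc v) then 1 else 0)"
    by (simp add: sum.distrib)
  have f0n: "f 0 n = (if s 0 \<noteq> s n then int (\<Sum>v<N. dg v) + 2 * int N + 1 - 2 * int m else 0)"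
  proof -
    \<comment> \<open>The subtraction of natural numbers in \<open>base_weight\<close> does not
      truncate.\<close>
    have "(\<Sum>v<N. dg v) + 2 * N + 1 \<le> 2 * \<beta> + 2 * m" using sum_dg_le half_ge by linarith
    hence "int (2 * \<beta> + 2 * m - ((\<Sum>v<N. dg v) + 2 * N + 1)) = 2 * int \<beta> + 2 * int m - (int (\<Sum>v<N. dg v) + 2 * int N + 1)"
      by linarith
    thus ?thesis unfolding f_def bw base_weight_def by simp
  qed
  show ?thesis
    unfolding sum1 f0n
  proof (intro arg_cong2[of _ _ _ _ "(-)"] arg_cong2[of _ _ _ _ "(+)"] sum.cong refl)
    fix v assume "v \<in> {..<N}"
    hence v: "v < N" by simp
    have 1: "f 0 (Suc v) = - (int \<beta> + int (dg v)) * (if s 0 \<noteq> s (Suc v) then 1 else 0)"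
      using v unfolding f_def bw base_weight_def by simp
    have 2: "f n (n + Suc v) = - (int \<beta> + int (dg v)) * (if s n \<noteq> s (n + Suc v) then 1 else 0)"
      using v unfolding f_def bw base_weight_def by simp
    have 3: "f 0 (n + Suc v) = - (int \<beta> + 1) * (if s 0 \<noteq> s (n + Suc v) then 1 else 0)"
      using v unfolding f_def bw base_weight_def by simp
    have 4: "f (Suc v) n = - (int \<beta> + 1) * (if s (Suc v) \<noteq> s n then 1 else 0)"
      using v unfolding f_def bw base_weight_def by simp
    show "(if s (Suc v) \<noteq> s (n + Suc v) then 2 * int \<beta> else 0) + f 0 (Suc v) + f n (n + Suc v) + f 0 (n + Suc v) + f (Suc v) n =
      (if s (Suc v) \<noteq> s (n + Suc v) then 2 * int \<beta> else 0)
        - (int \<beta> + int (dg v)) * ((if s 0 \<noteq> s (Suc v) then 1 else 0) + (if s n \<noteq> s (n + Suc v) then 1 else 0))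
        - (int \<beta> + 1) * ((if s 0 \<noteq> s (n + Suc v) then 1 else 0) + (if s (Suc v) \<noteq> s n then 1 else 0))"
      unfolding 1 2 3 4 by (simp add: algebra_simps)
  qed
qed

section \<open>From cuts to independent choices\<close>

text \<open>Pairs are ordered, so every violated conflict counts twice.\<close>

definition viol :: "(nat \<Rightarrow> bool) \<Rightarrow> int" where
  "viol z = (\<Sum>u<N. \<Sum>v<N. if conf u v \<and> z u \<and> z v then 1 else 0)"

definition size :: "(nat \<Rightarrow> bool) \<Rightarrow> int" where
  "size z = (\<Sum>v<N. if z v then 1 else 0)"

text \<open>With truth values as 0 and 1, agreement of two bits is 1 minus both bits plus twice
  their product; this is summed over the conflicting pairs.\<close>

lemma conf_agree_sum:
  "(\<Sum>u<N. \<Sum>v<N. if conf u v \<and> z u = z v then 1 else 0) =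
    int (\<Sum>v<N. dg v) - 2 * (\<Sum>v<N. if z v then int (dg v) else 0) + 2 * viol z"
proof -
  let ?c = "\<lambda>u v. if conf u v then 1 else (0::int)"
  have dg: "int (dg v) = (\<Sum>u<N. ?c v u)" for v by (simp add: cdeg_def if_distrib cong: if_cong)
  have "(\<Sum>u<N. \<Sum>v<N. if conf u v \<and> z u = z v then 1 else 0) =
     (\<Sum>u<N. \<Sum>v<N. ?c u v - (if z u then ?c u v else 0) - (if z v then ?c u v else 0) +
        2 * (if conf u v \<and> z u \<and> z v then 1 else 0))"
    by (intro sum.cong refl) auto
  also have "\<dots> = (\<Sum>u<N. \<Sum>v<N. ?c u v) - (\<Sum>u<N. \<Sum>v<N. if z u then ?c u v else 0)
     - (\<Sum>u<N. \<Sum>v<N. if z v then ?c u v else 0) + 2 * viol z"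
    by (simp only: sum.distrib sum_subtractf viol_def sum_distrib_left)
  also have "(\<Sum>u<N. \<Sum>v<N. ?c u v) = int (\<Sum>v<N. dg v)" by (simp only: of_nat_sum dg)
  also have "(\<Sum>u<N. \<Sum>v<N. if z u then ?c u v else 0) = (\<Sum>v<N. if z v then int (dg v) else 0)"
    unfolding dg by (intro sum.cong refl) auto
  also have "(\<Sum>u<N. \<Sum>v<N. if z v then ?c u v else 0) = (\<Sum>v<N. \<Sum>u<N. if z v then ?c u v else 0)"
    by (rule sum.swap)
  also have "\<dots> = (\<Sum>v<N. if z v then int (dg v) else 0)"
    unfolding dg using conf_sym by (intro sum.cong refl) (auto intro!: sum.cong)
  finally show ?thesis by simp
qed

text \<open>A chosen \<open>v\<close> contributes minus twice its degree and an unchosen one -2. The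
  degrees cancel against the linear terms of \<open>conf_agree_sum\<close>, leaving size, violations
  and threshold. As the value is odd, it is positive iff
  \<open>m + viol z <= size z\<close>.\<close>

lemma cut_consistent:
  assumes "\<not> s 0" "s n" "\<And>v. v < N \<Longrightarrow> s (Suc v) = z v" "\<And>v. v < N \<Longrightarrow> s (n + Suc v) = (\<not> z v)"
  shows "cut_sum (2 * n) W s = 1 + 2 * (size z - int m - viol z)"
proof -
  have 1: "(\<Sum>v<N. (if s (Suc v) \<noteq> s (n + Suc v) then 2 * int \<beta> else 0)
        - (int \<beta> + int (dg v)) * ((if s 0 \<noteq> s (Suc v) then 1 else 0) + (if s n \<noteq> s (n + Suc v) then 1 else 0))
        - (int \<beta> + 1) * ((if s 0 \<noteq> s (n + Suc v) then 1 else 0) + (if s (Suc v) \<noteq> s n then 1 else 0)))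
     = (\<Sum>v<N. 2 * (if z v then 1 else 0) - 2 * (if z v then int (dg v) else 0) - 2)"
  proof (intro sum.cong refl)
    fix v assume "v \<in> {..<N}"
    hence "s (Suc v) = z v" "s (n + Suc v) = (\<not> z v)" using assms by auto
    thus "(if s (Suc v) \<noteq> s (n + Suc v) then 2 * int \<beta> else 0)
        - (int \<beta> + int (dg v)) * ((if s 0 \<noteq> s (Suc v) then 1 else 0) + (if s n \<noteq> s (n + Suc v) then 1 else 0))
        - (int \<beta> + 1) * ((if s 0 \<noteq> s (n + Suc v) then 1 else 0) + (if s (Suc v) \<noteq> s n then 1 else 0)) =
        2 * (if z v then 1 else 0) - 2 * (if z v then int (dg v) else 0) - 2"
      using assms(1,2) by (cases "z v") simp_all
  qed
  have 2: "(\<Sum>u<N. \<Sum>v<N. if conf u v \<and> s (Suc u) \<noteq> s (n + Suc v) then 1 else 0) =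
     (\<Sum>u<N. \<Sum>v<N. if conf u v \<and> z u = z v then 1 else (0::int))"
    using assms by (intro sum.cong refl) auto
  have 3: "(\<Sum>v<N. 2 * (if z v then 1 else 0) - 2 * (if z v then int (dg v) else 0) - 2) =
     2 * size z - 2 * (\<Sum>v<N. if z v then int (dg v) else 0) - 2 * int N"
    by (simp add: sum_subtractf size_def sum_distrib_left[symmetric])
  show ?thesis
    unfolding cut_formula 1 2 3 conf_agree_sum using assms(1,2) by simp
qed

text \<open>An arbitrary cut does no better than a consistent one. If the constants are on the same
  side, no term is positive. Otherwise \<open>z\<close> is read off the variable blobs; a vertex on
  the same side as its partner loses its tooth, which pays for the at most \<open>dg v\<close>
  conflict edges that the misplaced partner may spare.\<close>

lemma cut_bound:
  assumes "0 < cut_sum (2 * n) W s"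
  shows "\<exists>z. int m + viol z \<le> size z"
proof (cases "s 0 = s n")
  case True
  have "cut_sum (2 * n) W s \<le> 0 + (\<Sum>v<N. 0) - 0"
    unfolding cut_formula
  proof (intro add_mono diff_mono sum_mono sum_nonneg)
    fix v assume "v \<in> {..<N}"
    show "(if s (Suc v) \<noteq> s (n + Suc v) then 2 * int \<beta> else 0)
        - (int \<beta> + int (dg v)) * ((if s 0 \<noteq> s (Suc v) then 1 else 0) + (if s n \<noteq> s (n + Suc v) then 1 else 0))
        - (int \<beta> + 1) * ((if s 0 \<noteq> s (n + Suc v) then 1 else 0) + (if s (Suc v) \<noteq> s n then 1 else 0)) \<le> 0"
      using True by (cases "s n"; cases "s (Suc v)"; cases "s (n + Suc v)") simp_all
  qed (use True in auto)
  thus ?thesis using assms by simp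
next
  case False
  define z where "z v \<longleftrightarrow> s (Suc v) \<noteq> s 0" for v
  let ?d = "\<lambda>v. s (Suc v) \<noteq> s (n + Suc v)"
  have 1: "(\<Sum>v<N. (if s (Suc v) \<noteq> s (n + Suc v) then 2 * int \<beta> else 0)
        - (int \<beta> + int (dg v)) * ((if s 0 \<noteq> s (Suc v) then 1 else 0) + (if s n \<noteq> s (n + Suc v) then 1 else 0))
        - (int \<beta> + 1) * ((if s 0 \<noteq> s (n + Suc v) then 1 else 0) + (if s (Suc v) \<noteq> s n then 1 else 0)))
     \<le> (\<Sum>v<N. 2 * (if z v then 1 else 0) - 2 * (if z v then int (dg v) else 0) - 2 - (if ?d v then 0 else int (dg v)))"
  proof (intro sum_mono)
    fix v assume "v \<in> {..<N}"
    have "3 * int (dg v) + 2 \<le> 2 * int \<beta>" using dg_le[of v] half_ge by linarith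
    thus "(if s (Suc v) \<noteq> s (n + Suc v) then 2 * int \<beta> else 0)
        - (int \<beta> + int (dg v)) * ((if s 0 \<noteq> s (Suc v) then 1 else 0) + (if s n \<noteq> s (n + Suc v) then 1 else 0))
        - (int \<beta> + 1) * ((if s 0 \<noteq> s (n + Suc v) then 1 else 0) + (if s (Suc v) \<noteq> s n then 1 else 0)) \<le>
        2 * (if z v then 1 else 0) - 2 * (if z v then int (dg v) else 0) - 2 - (if ?d v then 0 else int (dg v))"
      using False unfolding z_def
      by (cases "s 0"; cases "s n"; cases "s (Suc v)"; cases "s (n + Suc v)") simp_all
  qed
  \<comment> \<open>Agreeing pairs escape the penalty only through an inconsistent \<open>v\<close>,
    at most \<open>dg v\<close> of them for each.\<close>
  have 2: "(\<Sum>u<N. \<Sum>v<N. if conf u v \<and> z u = z v then 1 else 0) - (\<Sum>v<N. if ?d v then 0 else int (dg v)) \<le>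
     (\<Sum>u<N. \<Sum>v<N. if conf u v \<and> s (Suc u) \<noteq> s (n + Suc v) then 1 else (0::int))"
  proof -
    have "(\<Sum>v<N. if ?d v then 0 else int (dg v)) = (\<Sum>v<N. \<Sum>u<N. if ?d v then 0 else if conf u v then 1 else 0)"
    proof (intro sum.cong refl)
      fix v
      have "int (dg v) = (\<Sum>u<N. if conf u v then 1 else 0)"
        using conf_sym by (auto simp: cdeg_def if_distrib intro!: sum.cong)
      thus "(if ?d v then 0 else int (dg v)) = (\<Sum>u<N. if ?d v then 0 else if conf u v then 1 else 0)" by simp
    qed
    also have "\<dots> = (\<Sum>u<N. \<Sum>v<N. if ?d v then 0 else if conf u v then 1 else 0)" by (rule sum.swap)
    finally have "(\<Sum>u<N. \<Sum>v<N. if conf u v \<and> z u = z v then 1 else 0) - (\<Sum>v<N. if ?d v then 0 else int (dg v)) =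
      (\<Sum>u<N. \<Sum>v<N. (if conf u v \<and> z u = z v then 1 else 0) - (if ?d v then 0 else if conf u v then 1 else 0))"
      by (simp only: sum_subtractf)
    also have "\<dots> \<le> (\<Sum>u<N. \<Sum>v<N. if conf u v \<and> s (Suc u) \<noteq> s (n + Suc v) then 1 else (0::int))"
      by (intro sum_mono) (auto simp: z_def)
    finally show ?thesis .
  qed
  have 3: "(\<Sum>v<N. 2 * (if z v then 1 else 0) - 2 * (if z v then int (dg v) else 0) - 2 - (if ?d v then 0 else int (dg v))) =
     2 * size z - 2 * (\<Sum>v<N. if z v then int (dg v) else 0) - 2 * int N - (\<Sum>v<N. if ?d v then 0 else int (dg v))"
    by (simp add: sum_subtractf size_def sum_distrib_left[symmetric])
  have "0 < (int (\<Sum>v<N. dg v) + 2 * int N + 1 - 2 * int m) +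
     (2 * size z - 2 * (\<Sum>v<N. if z v then int (dg v) else 0) - 2 * int N - (\<Sum>v<N. if ?d v then 0 else int (dg v))) -
     (int (\<Sum>v<N. dg v) - 2 * (\<Sum>v<N. if z v then int (dg v) else 0) + 2 * viol z - (\<Sum>v<N. if ?d v then 0 else int (dg v)))"
    using assms 1 2 False unfolding cut_formula 3 conf_agree_sum by simp
  hence "int m + viol z \<le> size z" by simp
  thus ?thesis by blast
qed

text \<open>Each chosen vertex with a conflict accounts for at least one ordered violation, so
  deleting all of them leaves at least \<open>m\<close> vertices. Vertices of one group conflict
  pairwise, so the remaining ones meet each of the \<open>m\<close> groups exactly once.\<close>

lemma independent_choice:
  assumes grp: "\<And>v. v < N \<Longrightarrow> grp v < m" and same: "\<And>u v. u < N \<Longrightarrow> v < N \<Longrightarrow> u \<noteq> v \<Longrightarrow> grp u = grp v \<Longrightarrow> conf u v"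
    and z: "int m + viol z \<le> size z"
  shows "\<exists>\<tau>. (\<forall>i<m. \<tau> i < N \<and> grp (\<tau> i) = i) \<and> (\<forall>i<m. \<forall>j<m. \<not> conf (\<tau> i) (\<tau> j))"
proof -
  define I where "I = {v\<in>{..<N}. z v}"
  define I' where "I' = {v\<in>I. \<forall>u\<in>I. \<not> conf v u}"
  have sz: "size z = int (card I)"
    unfolding size_def I_def by (simp add: sum.If_cases Int_def conj_commute)
  have "(if v \<in> I - I' then 1 else 0) \<le> (\<Sum>u<N. if conf v u \<and> z v \<and> z u then 1 else (0::int))" for v
  proof (cases "v \<in> I - I'")
    case True
    then obtain u where "u \<in> I" "conf v u" by (auto simp: I'_def)
    hence "1 \<le> (\<Sum>u\<in>{u}. if conf v u \<and> z v \<and> z u then 1 else (0::int))" using True by (auto simp: I_def)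
    also have "\<dots> \<le> (\<Sum>u<N. if conf v u \<and> z v \<and> z u then 1 else 0)"
      using \<open>u \<in> I\<close> by (intro sum_mono2) (auto simp: I_def)
    finally show ?thesis using True by simp
  qed (auto intro: sum_nonneg)
  hence "(\<Sum>v<N. if v \<in> I - I' then 1 else 0) \<le> viol z"
    unfolding viol_def by (intro sum_mono)
  moreover have "(\<Sum>v<N. if v \<in> I - I' then 1 else 0) = int (card (I - I'))"
  proof -
    have "{..<N} \<inter> {v \<in> I. v \<notin> I'} = I - I'" by (auto simp: I_def)
    thus ?thesis by (simp add: sum.If_cases)
  qed
  moreover have "card I = card I' + card (I - I')"
    by (subst card_Un_disjoint[symmetric]) (auto simp: I_def I'_def intro!: arg_cong[of _ _ card])
  ultimately have card: "m \<le> card I'" using z sz by linarith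
  have inj: "inj_on grp I'"
    using same by (auto simp: inj_on_def I'_def I_def)
  have sub: "grp ` I' \<subseteq> {..<m}" using grp by (auto simp: I'_def I_def)
  have "grp ` I' = {..<m}"
    by (rule card_subset_eq[OF _ sub]) (use card card_mono[OF _ sub] card_image[OF inj] in auto)
  hence "\<forall>i<m. \<exists>v\<in>I'. grp v = i" by (metis image_iff lessThan_iff)
  then obtain \<tau> where \<tau>: "\<forall>i<m. \<tau> i \<in> I' \<and> grp (\<tau> i) = i" by metis
  hence "\<forall>i<m. \<tau> i < N \<and> grp (\<tau> i) = i" "\<forall>i<m. \<forall>j<m. \<not> conf (\<tau> i) (\<tau> j)"
    by (auto simp: I'_def I_def)
  thus ?thesis by blast
qed

theorem not_thin_iff_choice:
  assumes grp: "\<And>v. v < N \<Longrightarrow> grp v < m" and same: "\<And>u v. u < N \<Longrightarrow> v < N \<Longrightarrow> u \<noteq> v \<Longrightarrow> grp u = grp v \<Longrightarrow> conf u v"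
  shows "\<not> thin {..<2 * n * (2 * \<beta>)} E T (real 1 / real 2) \<longleftrightarrow>
    (\<exists>\<tau>. (\<forall>i<m. \<tau> i < N \<and> grp (\<tau> i) = i) \<and> (\<forall>i<m. \<forall>j<m. \<not> conf (\<tau> i) (\<tau> j)))"
proof
  assume "\<not> thin {..<2 * n * (2 * \<beta>)} E T (real 1 / real 2)"
  then obtain s where "0 < cut_sum (2 * n) W s" unfolding thin_iff_blobs by (auto simp: not_le)
  then obtain z where "int m + viol z \<le> size z" using cut_bound by blast
  thus "\<exists>\<tau>. (\<forall>i<m. \<tau> i < N \<and> grp (\<tau> i) = i) \<and> (\<forall>i<m. \<forall>j<m. \<not> conf (\<tau> i) (\<tau> j))"
    by (intro independent_choice[where grp = grp and z = z] grp same)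
next
  assume "\<exists>\<tau>. (\<forall>i<m. \<tau> i < N \<and> grp (\<tau> i) = i) \<and> (\<forall>i<m. \<forall>j<m. \<not> conf (\<tau> i) (\<tau> j))"
  then obtain \<tau> where \<tau>: "\<forall>i<m. \<tau> i < N \<and> grp (\<tau> i) = i" "\<forall>i<m. \<forall>j<m. \<not> conf (\<tau> i) (\<tau> j)" by blast
  define z where "z v \<longleftrightarrow> v \<in> \<tau> ` {..<m}" for v
  have "inj_on \<tau> {..<m}" using \<tau>(1) by (metis inj_onI lessThan_iff)
  moreover have "{..<N} \<inter> {v. z v} = \<tau> ` {..<m}" using \<tau>(1) by (auto simp: z_def)
  ultimately have "size z = int m" by (simp add: size_def sum.If_cases card_image)
  moreover have "viol z = 0"
    unfolding viol_def using \<tau>(2) by (intro sum.neutral ballI) (auto simp: z_def)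
  \<comment> \<open>The consistent cut of \<open>z\<close>; its value is 1, since the size is
    \<open>m\<close> and nothing is violated.\<close>
  moreover define s where "s b = (if b = 0 then False else if b = n then True
      else if b < n then z (b - 1) else \<not> z (b - n - 1))" for b
  have "cut_sum (2 * n) W s = 1 + 2 * (size z - int m - viol z)"
    by (rule cut_consistent) (auto simp: s_def)
  ultimately have "0 < cut_sum (2 * n) W s" by simp
  thus "\<not> thin {..<2 * n * (2 * \<beta>)} E T (real 1 / real 2)" unfolding thin_iff_blobs by (auto simp: not_le)
qed

end

section \<open>Computations as tilings\<close>

text \<open>A halted machine idles, so runs can be continued up to the time bound.\<close>

definition next_state :: "tm \<Rightarrow> nat \<Rightarrow> nat list \<Rightarrow> nat" where
  "next_state M q ss = (if q = halt M then q else fst (trans M q ss))"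

definition written :: "tm \<Rightarrow> nat \<Rightarrow> nat list \<Rightarrow> nat \<Rightarrow> nat" where
  "written M q ss j = (if q = halt M then ss ! j else fst (snd (trans M q ss) ! j))"

definition moved :: "tm \<Rightarrow> nat \<Rightarrow> nat list \<Rightarrow> nat \<Rightarrow> int" where
  "moved M q ss j = (if q = halt M then 0 else shift (snd (snd (trans M q ss) ! j)))"

text \<open>Positions are taken relative to the head. The scanned cell is then always at 0 and a
  move shifts the whole tape, so a new cell is determined by one old cell together with the state
  and the scanned symbols.\<close>

definition rel :: "tape list \<Rightarrow> nat \<Rightarrow> int \<Rightarrow> nat" where
  "rel ts j i = fst (ts ! j) (snd (ts ! j) + i)"

definition valid_config :: "tm \<Rightarrow> config \<Rightarrow> bool" where
  "valid_config M c \<longleftrightarrow> fst c < states M \<and> length (snd c) = tapes M \<and>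
     (\<forall>j<tapes M. \<forall>i. fst (snd c ! j) i < symbols M)"

lemma shift_range: "shift d \<in> {-1, 0, 1}"
  by (cases d) auto

lemma moved_range: "moved M q ss j \<in> {-1, 0, 1}"
  using shift_range by (simp add: moved_def)

lemma contents_le: "contents w i \<le> 2"
  by (simp add: contents_def)

lemma valid_start:
  assumes "turing_machine M"
  shows "valid_config M (start M w)"
proof -
  have "3 \<le> symbols M" using assms by (simp add: turing_machine_def)
  hence "contents v i < symbols M" for v i
    using contents_le[of v i] by linarith
  thus ?thesis
    using assms unfolding valid_config_def start_def turing_machine_def
    by (auto simp: nth_Cons split: nat.splits)
qed

text \<open>The cell at \<open>i\<close> from the new head was at \<open>i + moved\<close> from the
  old one; it has been rewritten iff that is 0.\<close>

lemma step_config_props: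
  assumes tm: "turing_machine M" and v: "valid_config M (q, ts)"
  defines "ss \<equiv> map scanned ts"
  shows "valid_config M (step M (q, ts))" "fst (step M (q, ts)) = next_state M q ss"
    "j < tapes M \<Longrightarrow> snd (snd (step M (q, ts)) ! j) = snd (ts ! j) + moved M q ss j"
    "j < tapes M \<Longrightarrow> rel (snd (step M (q, ts))) j i =
       (if i + moved M q ss j = 0 then written M q ss j else rel ts j (i + moved M q ss j))"
proof -
  have len: "length ts = tapes M" and q: "q < states M"
    and sy: "\<And>j i. j < tapes M \<Longrightarrow> fst (ts ! j) i < symbols M"
    using v by (auto simp: valid_config_def)
  have sc: "scanned (ts ! j) = rel ts j 0" for j by (cases "ts ! j") (simp add: rel_def)
  have ssj: "ss ! j = rel ts j 0" if "j < tapes M" for j using that len sc by (simp add: ss_def)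
  have ss1: "length ss = tapes M" using len by (simp add: ss_def)
  moreover have ss2: "\<forall>s\<in>set ss. s < symbols M"
  proof
    fix s assume "s \<in> set ss"
    then obtain j where "j < tapes M" "s = ss ! j" using ss1 by (metis in_set_conv_nth)
    thus "s < symbols M" using ssj sy by (simp add: rel_def)
  qed
  ultimately have ss: "length ss = tapes M" "\<forall>s\<in>set ss. s < symbols M" by blast+
  show "fst (step M (q, ts)) = next_state M q ss"
    by (simp add: next_state_def ss_def Let_def split_beta)
  have main: "snd (snd (step M (q, ts)) ! j) = snd (ts ! j) + moved M q ss j \<and>
      fst (snd (step M (q, ts)) ! j) = (fst (ts ! j))(snd (ts ! j) := written M q ss j) \<and>
      written M q ss j < symbols M" if j: "j < tapes M" for j
  proof (cases "q = halt M")
    case True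
    have "rel ts j 0 < symbols M" using sy j by (simp add: rel_def)
    thus ?thesis using True j ssj by (simp add: moved_def written_def rel_def)
  next
    case False
    have t: "length (snd (trans M q ss)) = tapes M" "\<forall>(s, d)\<in>set (snd (trans M q ss)). s < symbols M"
      using tm q ss unfolding turing_machine_def by blast+
    obtain s d where a: "snd (trans M q ss) ! j = (s, d)" by (cases "snd (trans M q ss) ! j")
    have "snd (step M (q, ts)) = map2 act (snd (trans M q ss)) ts"
      using False by (simp add: ss_def Let_def split_beta)
    hence "snd (step M (q, ts)) ! j = act (snd (trans M q ss) ! j) (ts ! j)"
      using j t(1) len by simp
    moreover have "s < symbols M" using t a j by (metis (no_types, lifting) case_prodD nth_mem)
    ultimately show ?thesis using False a by (cases "ts ! j") (simp add: moved_def written_def)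
  qed
  show "valid_config M (step M (q, ts))"
    unfolding valid_config_def
  proof (intro conjI allI impI)
    have "q \<noteq> halt M \<Longrightarrow> fst (trans M q ss) < states M"
      using tm q ss unfolding turing_machine_def by blast
    thus "fst (step M (q, ts)) < states M"
      using q by (simp add: ss_def Let_def split_beta)
    have "length (snd (trans M q ss)) = tapes M"
      using tm q ss unfolding turing_machine_def by blast
    thus "length (snd (step M (q, ts))) = tapes M"
      using len by (simp add: ss_def Let_def split_beta)
    show "fst (snd (step M (q, ts)) ! j) i < symbols M" if "j < tapes M" for j i
      using main[OF that] sy[OF that] by simp
  qed
  show "snd (snd (step M (q, ts)) ! j) = snd (ts ! j) + moved M q ss j" if "j < tapes M"
    using main[OF that] by blast
  show "rel (snd (step M (q, ts))) j i =
       (if i + moved M q ss j = 0 then written M q ss j else rel ts j (i + moved M q ss j))"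
    if "j < tapes M"
    using main[OF that] by (simp add: rel_def algebra_simps)
qed

text \<open>Their number depends on the machine only, so functions of a tile value are tables of
  constant size.\<close>

definition tile_values :: "tm \<Rightarrow> (nat \<times> nat list \<times> nat) set" where
  "tile_values M = {(q, ss, a). q < states M \<and> length ss = tapes M \<and> (\<forall>s\<in>set ss. s < symbols M) \<and> a < symbols M}"

lemma finite_tile_values: "finite (tile_values M)"
proof -
  have "tile_values M \<subseteq> {..<states M} \<times> {ss. set ss \<subseteq> {..<symbols M} \<and> length ss = tapes M} \<times> {..<symbols M}"
    by (auto simp: tile_values_def)
  thus ?thesis by (rule finite_subset) (intro finite_cartesian_product finite_lists_length_eq finite_lessThan)
qed

text \<open>
  A tile \<open>(t, j, i, h)\<close> says that at time \<open>t\<close> the cell at position \<open>i - W\<close> relative to the head of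
  tape \<open>j\<close> holds the third component of \<open>cd h\<close>, and that the state and the scanned symbols are the
  first two; all tiles with the same time have to agree on these.
\<close>

definition initial_symbol :: "bool list \<Rightarrow> nat \<Rightarrow> nat \<Rightarrow> nat \<Rightarrow> nat \<Rightarrow> nat \<Rightarrow> bool" where
  "initial_symbol x P W j i a \<longleftrightarrow>
     (if j = 0 \<and> W \<le> i then
        if i - W < 2 * length x then
          a = (if (i - W) mod 2 = 0 then 2 else if bit_at x ((i - W) div 2) then 2 else 1)
        else if i - W = 2 * length x then a = 1
        else if i - W \<le> 2 * length x + P then a \<le> 2
        else a = 0
      else a = 0)"

context
  fixes M :: tm and cd :: "nat \<Rightarrow> nat \<times> nat list \<times> nat"
begin

definition "tq h = fst (cd h)"
definition "ta h = snd (snd (cd h))"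
definition "tss h j = fst (snd (cd h)) ! j"
definition "tnext h = next_state M (tq h) (fst (snd (cd h)))"
definition "twr h j = written M (tq h) (fst (snd (cd h))) j"
text \<open>The move is raised by one to become a natural number.\<close>

definition "tmv h j = nat (1 + moved M (tq h) (fst (snd (cd h))) j)"
text \<open>State and scanned symbols are coded by one number, since the programs compare only
  numbers.\<close>

definition "tglobal h = to_nat (tq h, fst (snd (cd h)))"

text \<open>Position \<open>2 * T\<close> is the head. At time 0 the input tape shows the
  self-delimiting form of \<open>x\<close> followed by \<open>P\<close> free cells for the
  certificate. Acceptance needs no head position: an output of False would leave symbol 1 in a cell
  of the last tape, so that symbol is forbidden there throughout.\<close>

definition tile_ok :: "bool list \<Rightarrow> nat \<Rightarrow> nat \<Rightarrow> nat \<Rightarrow> nat \<Rightarrow> nat \<Rightarrow> nat \<Rightarrow> bool" where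
  "tile_ok x P T t j i h \<longleftrightarrow>
     (i = 2 * T \<longrightarrow> ta h = tss h j) \<and>
     (t = 0 \<longrightarrow> tq h = 0 \<and> initial_symbol x P (2 * T) j i (ta h)) \<and>
     (t = T \<and> Suc j = tapes M \<longrightarrow> ta h \<noteq> 1)"

text \<open>In this order: two tiles for one place, disagreement on state or scanned symbols, a
  wrong next state, a wrong cell after the move, and a nonblank cell following a blank one in the
  certificate, which must be a single word.\<close>

definition tile_bad ::
  "bool list \<Rightarrow> nat \<Rightarrow> nat \<Rightarrow> nat \<Rightarrow> nat \<Rightarrow> nat \<Rightarrow> nat \<Rightarrow> nat \<Rightarrow> nat \<Rightarrow> nat \<Rightarrow> bool" where
  "tile_bad x T t j i h t' j' i' h' \<longleftrightarrow>
     t = t' \<and> j = j' \<and> i = i' \<or>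
     t = t' \<and> tglobal h \<noteq> tglobal h' \<or>
     t' = Suc t \<and> tnext h \<noteq> tq h' \<or>
     t' = Suc t \<and> j = j' \<and> Suc i = i' + tmv h j \<and> ta h' \<noteq> (if i = 2 * T then twr h j else ta h) \<or>
     t = 0 \<and> t' = 0 \<and> j = 0 \<and> j' = 0 \<and> i' = Suc i \<and> 2 * T + 2 * length x < i \<and> ta h = 0 \<and> ta h' \<noteq> 0"

end

locale tiling =
  fixes M :: tm and cd :: "nat \<Rightarrow> nat \<times> nat list \<times> nat" and D :: nat
    and x :: "bool list" and P T :: nat and R :: language
  assumes tm: "turing_machine M" and cd: "bij_betw cd {..<D} (tile_values M)"
    and T: "2 * length x + 1 + P \<le> T"
    and decides: "\<And>y. length y \<le> P \<Longrightarrow> outputs_within M (pair x y) T [pair x y \<in> R]"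
begin

abbreviation "k \<equiv> tapes M"
text \<open>Unknown cells outside the window spoil one more cell at each border per step, and the
  head moves by at most \<open>T\<close> in all. After \<open>T\<close> steps the reliable
  half-width \<open>W - T = T\<close> still reaches the first output cell.\<close>

abbreviation "W \<equiv> 2 * T"

definition proper_tiling :: "(nat \<Rightarrow> nat \<Rightarrow> nat \<Rightarrow> nat) \<Rightarrow> bool" where
  "proper_tiling H \<longleftrightarrow>
     (\<forall>t\<le>T. \<forall>j<k. \<forall>i\<le>2 * W. H t j i < D \<and> tile_ok M cd x P T t j i (H t j i)) \<and>
     (\<forall>t\<le>T. \<forall>j<k. \<forall>i\<le>2 * W. \<forall>t'\<le>T. \<forall>j'<k. \<forall>i'\<le>2 * W. (t, j, i) \<noteq> (t', j', i') \<longrightarrow>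
        \<not> tile_bad M cd x T t j i (H t j i) t' j' i' (H t' j' i'))"

definition cfg :: "bool list \<Rightarrow> nat \<Rightarrow> config" where
  "cfg y t = (step M ^^ t) (start M (pair x y))"

definition cq where "cq y t = fst (cfg y t)"
definition cts where "cts y t = snd (cfg y t)"
definition css where "css y t = map scanned (cts y t)"

lemma k_pos: "0 < k"
  using tm by (simp add: turing_machine_def)

lemma valid_cfg: "valid_config M (cfg y t)"
proof (induction t)
  case 0
  thus ?case using valid_start[OF tm] by (simp add: cfg_def)
next
  case (Suc t)
  have "cfg y (Suc t) = step M (fst (cfg y t), snd (cfg y t))" by (simp add: cfg_def)
  thus ?case using step_config_props(1)[OF tm, of "fst (cfg y t)" "snd (cfg y t)"] Suc by simp
qed

lemma cfg_Suc:
  "cq y (Suc t) = next_state M (cq y t) (css y t)"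
  "j < k \<Longrightarrow> snd (cts y (Suc t) ! j) = snd (cts y t ! j) + moved M (cq y t) (css y t) j"
  "j < k \<Longrightarrow> rel (cts y (Suc t)) j i = (if i + moved M (cq y t) (css y t) j = 0
      then written M (cq y t) (css y t) j else rel (cts y t) j (i + moved M (cq y t) (css y t) j))"
proof -
  have e: "cfg y (Suc t) = step M (cq y t, cts y t)" by (simp add: cfg_def cq_def cts_def)
  have v: "valid_config M (cq y t, cts y t)" using valid_cfg by (simp add: cq_def cts_def)
  note p = step_config_props[OF tm v, folded css_def]
  show "cq y (Suc t) = next_state M (cq y t) (css y t)"
    using p(2) e by (simp add: cq_def[of _ "Suc t"])
  show "snd (cts y (Suc t) ! j) = snd (cts y t ! j) + moved M (cq y t) (css y t) j" if "j < k"
    using p(3)[OF that] e by (simp add: cts_def[of _ "Suc t"])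
  show "rel (cts y (Suc t)) j i = (if i + moved M (cq y t) (css y t) j = 0
      then written M (cq y t) (css y t) j else rel (cts y t) j (i + moved M (cq y t) (css y t) j))" if "j < k"
    using p(4)[OF that, of i] e by (simp add: cts_def[of _ "Suc t"])
qed

lemma cfg_props:
  "cq y t < states M" "length (cts y t) = k" "j < k \<Longrightarrow> rel (cts y t) j i < symbols M"
  "length (css y t) = k" "j < k \<Longrightarrow> css y t ! j = rel (cts y t) j 0" "s \<in> set (css y t) \<Longrightarrow> s < symbols M"
proof -
  have v: "valid_config M (cfg y t)" by (rule valid_cfg)
  show 1: "cq y t < states M" and 2: "length (cts y t) = k"
    using v by (auto simp: valid_config_def cq_def cts_def)
  show 3: "rel (cts y t) j i < symbols M" if "j < k" for j i
    using v that by (auto simp: valid_config_def cts_def rel_def)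
  show "length (css y t) = k" using 2 by (simp add: css_def)
  show 4: "css y t ! j = rel (cts y t) j 0" if "j < k" for j
    using that 2 by (cases "cts y t ! j") (simp add: css_def rel_def)
  show "s \<in> set (css y t) \<Longrightarrow> s < symbols M"
    using 3 4 2 by (metis in_set_conv_nth length_map css_def)
qed

lemma cfg_0:
  "cq y 0 = 0" "rel (cts y 0) 0 i = contents (pair x y) i" "0 < j \<Longrightarrow> j < k \<Longrightarrow> rel (cts y 0) j i = 0"
  "j < k \<Longrightarrow> snd (cts y 0 ! j) = 0"
  by (auto simp: cfg_def cq_def cts_def start_def rel_def contents_def nth_Cons split: nat.splits)

lemma head_bound: "j < k \<Longrightarrow> \<bar>snd (cts y t ! j)\<bar> \<le> int t"
proof (induction t)
  case 0
  thus ?case by (simp add: cfg_0)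
next
  case (Suc t)
  have "\<bar>moved M (cq y t) (css y t) j\<bar> \<le> 1" using moved_range[of M "cq y t" "css y t" j] by auto
  thus ?case using Suc cfg_Suc(2)[OF Suc.prems, of y t] by linarith
qed

lemma final_tape:
  assumes "length y \<le> P"
  shows "rel (cts y T) (k - 1) i = contents [pair x y \<in> R] (snd (cts y T ! (k - 1)) + i)"
proof -
  have "fst (last (cts y T)) = contents [pair x y \<in> R]"
    using decides[OF assms] by (simp add: outputs_within_def cfg_def cts_def split_beta Let_def)
  moreover have "last (cts y T) = cts y T ! (k - 1)"
    using cfg_props(2)[of y T] k_pos by (subst last_conv_nth) auto
  ultimately show ?thesis by (simp add: rel_def)
qed

lemma contents_pair:
  "0 \<le> p \<Longrightarrow> p < 2 * length x \<Longrightarrow> contents (pair x y) (int p) =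
     (if p mod 2 = 0 then 2 else if bit_at x (p div 2) then 2 else 1)"
  "contents (pair x y) (int (2 * length x)) = 1"
  "contents (pair x y) (int (2 * length x + 1 + p)) = contents y (int p)"
proof -
  have len: "length (pair x y) = 2 * length x + 1 + length y" by (simp add: pair_def length_delimit)
  have nth: "pair x y ! p = delimit x ! p" if "p < 2 * length x + 1" for p
    using that by (simp add: pair_def nth_append length_delimit)
  show "contents (pair x y) (int p) = (if p mod 2 = 0 then 2 else if bit_at x (p div 2) then 2 else 1)"
    if p: "p < 2 * length x" for p
  proof -
    have i: "p div 2 < length x" using p by linarith
    have "pair x y ! p \<longleftrightarrow> p mod 2 = 0 \<or> bit_at x (p div 2)"
    proof (cases "p mod 2 = 0")
      case True
      hence "p = 2 * (p div 2)" by presburger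
      hence "delimit x ! p" using nth_delimit(1)[OF i] by metis
      thus ?thesis using True nth[of p] p by simp
    next
      case False
      hence "p = 2 * (p div 2) + 1" by presburger
      hence "delimit x ! p = x ! (p div 2)" using nth_delimit(1)[OF i] by metis
      thus ?thesis using False nth[of p] p i by (simp add: bit_at_def)
    qed
    thus ?thesis using p len by (auto simp: contents_def)
  qed
  show "contents (pair x y) (int (2 * length x)) = 1"
    using nth[of "2 * length x"] nth_delimit(2)[of x] len by (simp add: contents_def nat_mult_distrib)
  show "contents (pair x y) (int (2 * length x + 1 + p)) = contents y (int p)"
    by (simp add: contents_def pair_def nth_append length_delimit nat_add_distrib nat_mult_distrib)
qed

lemma tiling_of_run:
  assumes y: "length y \<le> P" "pair x y \<in> R"
  shows "\<exists>H. proper_tiling H"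
proof -
  define val where "val t j i = (cq y t, css y t, rel (cts y t) j (int i - int W))" for t j i
  define H where "H t j i = inv_into {..<D} cd (val t j i)" for t j i
  have H: "H t j i < D \<and> cd (H t j i) = val t j i" if "j < k" for t j i
  proof -
    have "val t j i \<in> cd ` {..<D}"
      using cd cfg_props that unfolding bij_betw_def val_def tile_values_def by simp
    thus ?thesis unfolding H_def by (metis f_inv_into_f inv_into_into lessThan_iff)
  qed
  have sel: "tq cd (H t j i) = cq y t" "ta cd (H t j i) = rel (cts y t) j (int i - int W)"
    "tss cd (H t j i) j = rel (cts y t) j 0" "tnext M cd (H t j i) = cq y (Suc t)"
    "twr M cd (H t j i) j = written M (cq y t) (css y t) j"
    "int (tmv M cd (H t j i) j) = 1 + moved M (cq y t) (css y t) j"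
    "tglobal cd (H t j i) = to_nat (cq y t, css y t)" if "j < k" for t j i
    using H[OF that, of t i] cfg_Suc(1)[of y t] cfg_props(5)[OF that, of y t] moved_range[of M "cq y t" "css y t" j]
    by (auto simp: tq_def ta_def tss_def tnext_def twr_def tmv_def tglobal_def val_def)
  have init: "initial_symbol x P W j i (rel (cts y 0) j (int i - int W))" if "j < k" for j i
  proof (cases "j = 0")
    case False
    thus ?thesis using that cfg_0(3) by (simp add: initial_symbol_def)
  next
    case j: True
    show ?thesis
    proof (cases "W \<le> i")
      case False
      thus ?thesis using j by (simp add: initial_symbol_def cfg_0(2) contents_def)
    next
      case True
      define p where "p = i - W"
      have p: "int i - int W = int p" using True by (simp add: p_def)
      have a: "rel (cts y 0) j (int i - int W) = contents (pair x y) (int p)" unfolding p using j cfg_0(2) by simp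
      consider "p < 2 * length x" | "p = 2 * length x" | r where "p = 2 * length x + 1 + r"
        by (metis add.commute add_Suc_right less_imp_Suc_add linorder_neqE_nat plus_1_eq_Suc)
      thus ?thesis
      proof cases
        case 3
        have "contents y (int r) = 0" if "P \<le> r" using y(1) that by (simp add: contents_def)
        thus ?thesis unfolding a initial_symbol_def p_def[symmetric] 3 contents_pair(3)
          using contents_le[of y] j True by auto
      next
        case 1
        show ?thesis unfolding a initial_symbol_def p_def[symmetric] contents_pair(1)[OF le0 1]
          using 1 j True by simp
      next
        case 2
        show ?thesis unfolding a initial_symbol_def p_def[symmetric] 2 contents_pair(2)
          using j True by simp
      qed
    qed
  qed
  \<comment> \<open>The accepting output \<open>[True]\<close> has no cell with symbol 1.\<close>
  have fin: "rel (cts y T) j i \<noteq> 1" if "Suc j = k" for j i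
  proof -
    have "j = k - 1" using that by simp
    moreover have "contents [True] l \<noteq> 1" for l by (simp add: contents_def)
    ultimately show ?thesis using final_tape[OF y(1), of i] y(2) by simp
  qed
  have ok: "tile_ok M cd x P T t j i (H t j i)" if "j < k" for t j i
    unfolding tile_ok_def sel[OF that] using init[OF that] cfg_0(1)[of y] fin by auto
  have nb: "\<not> tile_bad M cd x T t j i (H t j i) t' j' i' (H t' j' i')"
    if "j < k" "j' < k" "(t, j, i) \<noteq> (t', j', i')" for t j i t' j' i'
  proof
    assume "tile_bad M cd x T t j i (H t j i) t' j' i' (H t' j' i')"
    hence "(t' = Suc t \<and> j = j' \<and> Suc i = i' + tmv M cd (H t j i) j \<and>
        rel (cts y t') j' (int i' - int W) \<noteq> (if i = W then written M (cq y t) (css y t) j else rel (cts y t) j (int i - int W))) \<or>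
      (t = 0 \<and> t' = 0 \<and> j = 0 \<and> j' = 0 \<and> i' = Suc i \<and> W + 2 * length x < i \<and>
        rel (cts y t) j (int i - int W) = 0 \<and> rel (cts y t') j' (int i' - int W) \<noteq> 0)"
      using that(3) unfolding tile_bad_def sel[OF that(1)] sel[OF that(2)] by auto
    thus False
    proof
      assume a: "t' = Suc t \<and> j = j' \<and> Suc i = i' + tmv M cd (H t j i) j \<and>
        rel (cts y t') j' (int i' - int W) \<noteq> (if i = W then written M (cq y t) (css y t) j else rel (cts y t) j (int i - int W))"
      have e: "(int i' - int W) + moved M (cq y t) (css y t) j = int i - int W"
        using sel(6)[OF that(1), of t i] a by linarith
      have z: "int i - int W = 0 \<longleftrightarrow> i = W" by linarith
      from a have "rel (cts y (Suc t)) j (int i' - int W) \<noteq>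
          (if i = W then written M (cq y t) (css y t) j else rel (cts y t) j (int i - int W))" by blast
      thus False using cfg_Suc(3)[OF that(1), of y t "int i' - int W", unfolded e z] by (rule notE)
    next
      assume a: "t = 0 \<and> t' = 0 \<and> j = 0 \<and> j' = 0 \<and> i' = Suc i \<and> W + 2 * length x < i \<and>
        rel (cts y t) j (int i - int W) = 0 \<and> rel (cts y t') j' (int i' - int W) \<noteq> 0"
      define p where "p = i - (W + 2 * length x + 1)"
      have "int i - int W = int (2 * length x + 1 + p)" "int i' - int W = int (2 * length x + 1 + Suc p)"
        using a by (auto simp: p_def)
      moreover have "rel (cts y 0) 0 (int i - int W) = 0" "rel (cts y 0) 0 (int i' - int W) \<noteq> 0"
        using a by auto
      ultimately have "contents y (int p) = 0" "contents y (int (Suc p)) \<noteq> 0"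
        by (simp_all only: cfg_0(2) contents_pair(3) not_False_eq_True)
      thus False by (simp add: contents_def split: if_splits)
    qed
  qed
  show ?thesis unfolding proper_tiling_def using H ok nb by (intro exI[of _ H]) blast
qed

text \<open>The certificate is read from the tiles at time 0. By induction on time, the tiles then
  agree with its run on a window that shrinks by one cell on each side per step.\<close>

lemma run_of_tiling:
  assumes "proper_tiling H"
  shows "\<exists>y. length y \<le> P \<and> pair x y \<in> R"
proof -
  let ?L = "length x"
  have HD: "H t j i < D" and ok: "tile_ok M cd x P T t j i (H t j i)"
    if "t \<le> T" "j < k" "i \<le> 2 * W" for t j i
    using assms that unfolding proper_tiling_def by blast+
  have nb: "\<not> tile_bad M cd x T t j i (H t j i) t' j' i' (H t' j' i')"
    if "t \<le> T" "j < k" "i \<le> 2 * W" "t' \<le> T" "j' < k" "i' \<le> 2 * W" "(t, j, i) \<noteq> (t', j', i')" for t j i t' j' i'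
    using assms that unfolding proper_tiling_def by blast
  define c where "c p = ta cd (H 0 0 (W + 2 * ?L + 1 + p))" for p
  have ix: "W + 2 * ?L + 1 + p \<le> 2 * W" if "p < P" for p using that T by linarith
  have init: "initial_symbol x P W j i (ta cd (H 0 j i))" "tq cd (H 0 j i) = 0" if "j < k" "i \<le> 2 * W" for j i
    using ok[of 0 j i] that by (auto simp: tile_ok_def)
  have c2: "c p \<le> 2" if "p < P" for p
    using init(1)[OF k_pos ix[OF that]] that by (simp add: initial_symbol_def c_def)
  have c0: "c (Suc p) = 0" if "c p = 0" "Suc p < P" for p
    using nb[of 0 0 "W + 2 * ?L + 1 + p" 0 0 "W + 2 * ?L + 1 + Suc p"] ix[of p] ix[of "Suc p"] that k_pos
    by (auto simp: tile_bad_def c_def)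
  \<comment> \<open>The first blank among the free cells; no nonblank one follows, so the cells
    before it form the certificate.\<close>
  define l where "l = (LEAST p. P \<le> p \<or> c p = 0)"
  have l: "P \<le> l \<or> c l = 0" unfolding l_def by (rule LeastI[of _ P]) simp
  have lP: "l \<le> P" unfolding l_def by (rule Least_le) simp
  have below: "c p \<noteq> 0" if "p < l" for p using not_less_Least[OF that[unfolded l_def]] by blast
  have above: "c p = 0" if "l \<le> p" "p < P" for p
    using that
  proof (induction p rule: dec_induct)
    case base
    thus ?case using l by simp
  next
    case (step p)
    thus ?case using c0 by simp
  qed
  define y where "y = map (\<lambda>p. c p = 2) [0..<l]"
  have cy: "contents y (int p) = (if p < P then c p else 0)" for p
  proof (cases "p < l")
    case True
    hence "c p = 1 \<or> c p = 2" using below[OF True] c2[of p] lP by (auto simp: le_Suc_eq numeral_2_eq_2)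
    thus ?thesis using True lP by (auto simp: contents_def y_def)
  next
    case False
    thus ?thesis using above[of p] by (auto simp: contents_def y_def)
  qed
  have yP: "length y \<le> P" using lP by (simp add: y_def)
  have init0: "ta cd (H 0 j i) = rel (cts y 0) j (int i - int W)" if "j < k" "i \<le> 2 * W" for j i
  proof (cases "j = 0 \<and> W \<le> i")
    case False
    hence "ta cd (H 0 j i) = 0" using init(1)[OF that] by (auto simp: initial_symbol_def)
    moreover have "rel (cts y 0) j (int i - int W) = 0"
    proof (cases "j = 0")
      case True
      thus ?thesis using False cfg_0(2)[of y] by (simp add: contents_def)
    next
      case False
      thus ?thesis using cfg_0(3) that by simp
    qed
    ultimately show ?thesis by simp
  next
    case True
    define p where "p = i - W"
    have p: "int i - int W = int p" "i = W + p" using True by (auto simp: p_def)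
    have a: "rel (cts y 0) j (int i - int W) = contents (pair x y) (int p)" unfolding p using True cfg_0(2) by simp
    note b = init(1)[OF that, unfolded initial_symbol_def, folded p_def]
    consider "p < 2 * ?L" | "p = 2 * ?L" | r where "p = 2 * ?L + 1 + r"
      by (metis add.commute add_Suc_right less_imp_Suc_add linorder_neqE_nat plus_1_eq_Suc)
    thus ?thesis
    proof cases
      case 1
      thus ?thesis unfolding a contents_pair(1)[OF le0 1] using b True by simp
    next
      case 2
      show ?thesis unfolding a unfolding 2 contents_pair(2) using b True 2 by simp
    next
      case 3
      have "W + (2 * ?L + 1 + r) = W + 2 * ?L + 1 + r" by simp
      hence "ta cd (H 0 j i) = (if r < P then c r else 0)"
        using b True 3 p(2) by (auto simp: c_def add.assoc)
      thus ?thesis unfolding a unfolding 3 contents_pair(3) cy .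
    qed
  qed
  define S where "S t \<longleftrightarrow> (\<forall>j<k. \<forall>i\<le>2 * W. tq cd (H t j i) = cq y t \<and>
      (\<bar>int i - int W\<bar> \<le> int W - int t \<longrightarrow> ta cd (H t j i) = rel (cts y t) j (int i - int W)))" for t
  have "S t" if "t \<le> T" for t
    using that
  proof (induction t)
    case 0
    show ?case unfolding S_def using init0 init(2) cfg_0(1)[of y] by simp
  next
    case (Suc t)
    hence S: "S t" and tT: "t \<le> T" "Suc t \<le> T" by auto
    \<comment> \<open>The scanned symbol of tape \<open>j'\<close> is known from the tile in its
      head cell, and all tiles at time \<open>t\<close> agree on it.\<close>
    have glob: "fst (snd (cd (H t j i))) = css y t" if ji: "j < k" "i \<le> 2 * W" for j i
    proof (rule nth_equalityI)
      have "cd (H t j i) \<in> tile_values M"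
        using cd HD[OF tT(1) ji] unfolding bij_betw_def by blast
      thus "length (fst (snd (cd (H t j i)))) = length (css y t)"
        by (auto simp: tile_values_def cfg_props(4))
      fix j' assume "j' < length (fst (snd (cd (H t j i))))"
      with \<open>cd (H t j i) \<in> tile_values M\<close> have j': "j' < k" by (auto simp: tile_values_def)
      have "tglobal cd (H t j i) = tglobal cd (H t j' W)"
        using nb[OF tT(1) ji tT(1) j', of W] by (cases "(t, j, i) = (t, j', W)") (auto simp: tile_bad_def)
      hence "fst (snd (cd (H t j i))) = fst (snd (cd (H t j' W)))" by (simp add: tglobal_def)
      hence "fst (snd (cd (H t j i))) ! j' = tss cd (H t j' W) j'" by (simp add: tss_def)
      also have "\<dots> = ta cd (H t j' W)" using ok[OF tT(1) j', of W] by (simp add: tile_ok_def)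
      also have "\<dots> = rel (cts y t) j' (int W - int W)"
        using S j' tT(1) unfolding S_def by simp
      also have "\<dots> = css y t ! j'" using cfg_props(5)[OF j', of y t] by simp
      finally show "fst (snd (cd (H t j i))) ! j' = css y t ! j'" .
    qed
    have q: "tq cd (H t j i) = cq y t" if "j < k" "i \<le> 2 * W" for j i
      using S that unfolding S_def by blast
    show ?case
      unfolding S_def
    proof (intro allI impI conjI)
      fix j i' assume ji: "j < k" "i' \<le> 2 * W"
      have "tnext M cd (H t j i') = tq cd (H (Suc t) j i')"
        using nb[OF tT(1) ji tT(2) ji] by (auto simp: tile_bad_def)
      thus "tq cd (H (Suc t) j i') = cq y (Suc t)"
        by (simp add: tnext_def glob[OF ji] q[OF ji] cfg_Suc(1))
      assume b: "\<bar>int i' - int W\<bar> \<le> int W - int (Suc t)"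
      define d where "d = moved M (cq y t) (css y t) j"
      have d: "d \<in> {-1, 0, 1}" unfolding d_def by (rule moved_range)
      \<comment> \<open>The position at time \<open>t\<close> of the cell that is at
        \<open>i'\<close> after the move.\<close>
      define i where "i = nat (int i' + d)"
      have ii: "int i = int i' + d" using b d tT(2) unfolding i_def by auto
      have i: "i \<le> 2 * W" "\<bar>int i - int W\<bar> \<le> int W - int t" using ii b d by auto
      have mv: "Suc i = i' + tmv M cd (H t j i) j"
        using ii d unfolding tmv_def glob[OF ji(1) i(1)] q[OF ji(1) i(1)] d_def[symmetric] by auto
      have "ta cd (H (Suc t) j i') = (if i = W then twr M cd (H t j i) j else ta cd (H t j i))"
        using nb[OF tT(1) ji(1) i(1) tT(2) ji] mv by (auto simp: tile_bad_def)
      also have "\<dots> = (if int i' - int W + d = 0 then written M (cq y t) (css y t) j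
          else rel (cts y t) j (int i' - int W + d))"
      proof -
        have e: "int i' - int W + d = int i - int W" using ii by simp
        have "ta cd (H t j i) = rel (cts y t) j (int i - int W)"
          using S ji(1) i unfolding S_def by blast
        thus ?thesis unfolding e twr_def glob[OF ji(1) i(1)] q[OF ji(1) i(1)] by simp
      qed
      also have "\<dots> = rel (cts y (Suc t)) j (int i' - int W)"
        unfolding cfg_Suc(3)[OF ji(1)] d_def ..
      finally show "ta cd (H (Suc t) j i') = rel (cts y (Suc t)) j (int i' - int W)" .
    qed
  qed
  hence S: "S T" by simp
  have "pair x y \<in> R"
  proof (rule ccontr)
    assume "pair x y \<notin> R"
    define h where "h = snd (cts y T ! (k - 1))"
    have h: "\<bar>h\<bar> \<le> int T" unfolding h_def by (rule head_bound) (use k_pos in simp)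
    \<comment> \<open>The window index of cell 0 of the output tape, which holds symbol 1 if the
      answer is False.\<close>
    define i where "i = nat (int W - h)"
    have ii: "int i = int W - h" using h unfolding i_def by auto
    have i: "i \<le> 2 * W" "\<bar>int i - int W\<bar> \<le> int W - int T" using ii h by auto
    have "ta cd (H T (k - 1) i) = rel (cts y T) (k - 1) (int i - int W)"
      using S i k_pos unfolding S_def by simp
    also have "\<dots> = contents [pair x y \<in> R] (h + (int i - int W))"
      unfolding final_tape[OF yP] h_def ..
    also have "\<dots> = 1" using ii \<open>pair x y \<notin> R\<close> by (simp add: contents_def)
    finally show False using ok[of T "k - 1" i] i k_pos by (simp add: tile_ok_def)
  qed
  thus ?thesis using yP by blast
qed

end

section \<open>The reduction\<close>

lemma outputs_within_mono:
  assumes "outputs_within M w t y" "t \<le> t'"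
  shows "outputs_within M w t' y"
proof -
  obtain q ts where c: "(step M ^^ t) (start M w) = (q, ts)" by (cases "(step M ^^ t) (start M w)")
  hence h: "q = halt M" "fst (last ts) = contents y" using assms(1) by (auto simp: outputs_within_def)
  have "(step M ^^ s) (q, ts) = (q, ts)" for s by (induction s) (simp_all add: h(1))
  hence "(step M ^^ (t + (t' - t))) (start M w) = (q, ts)" by (rule funpow_trans[OF c])
  thus ?thesis using assms(2) h by (simp add: outputs_within_def)
qed

lemma poly_nat_mono: "a \<le> b \<Longrightarrow> poly p a \<le> poly p b" for p :: "nat poly"
  by (induction p) (auto intro: add_mono mult_mono)

lemma PC_table2:
  assumes "PC vs f" "PC vs g" "\<And>x e. f x e < K" "\<And>x e. g x e < L"
  shows "PC vs (\<lambda>x e. h (f x e) (g x e))"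
proof -
  have b: "f x e * L + g x e < K * L" for x e
  proof -
    have "Suc (f x e) * L \<le> K * L" using assms(3)[of x e] by (intro mult_le_mono1) simp
    thus ?thesis using assms(4)[of x e] by simp
  qed
  have "PC vs (\<lambda>x e. (\<lambda>c. h (c div L) (c mod L)) (f x e * L + g x e))"
    by (rule PC_table[OF _ b]) (intro PC_add PC_mult PC_const assms)
  moreover have "(f x e * L + g x e) div L = f x e" "(f x e * L + g x e) mod L = g x e" for x e
    using assms(4)[of x e] by auto
  ultimately show ?thesis by simp
qed

lemma div_mod_eqI:
  fixes a b k :: nat
  assumes "a div k = b div k" "a mod k = b mod k"
  shows "a = b"
proof -
  have "a = a div k * k + a mod k" by simp
  also have "\<dots> = b" unfolding assms by simp
  finally show ?thesis .
qed

lemma map_upt_add: "map f [0..<a + b] = map f [0..<a] @ map (\<lambda>i. f (a + i)) [0..<b]"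
  by (induction b) auto

lemma PD_If:
  assumes "PD vs P" "PD vs Q" "PD vs S"
  shows "PD vs (\<lambda>x e. if P x e then Q x e else S x e)"
  by (rule PD_cong[OF PD_disj[OF PD_conj[OF assms(1,2)] PD_conj[OF PD_not[OF assms(1)] assms(3)]]]) auto

text \<open>The final offsets are the set bits of \<open>11 0 10 11 0\<close>, the delimited
  numerals 1 and 2 of \<alpha> = 1/2.\<close>

definition instance_bit :: "nat \<Rightarrow> (nat \<Rightarrow> nat \<Rightarrow> bool) \<Rightarrow> (nat \<Rightarrow> nat \<Rightarrow> bool) \<Rightarrow> nat \<Rightarrow> bool" where
  "instance_bit V e t i \<longleftrightarrow>
     (if i < V then True
      else if i < V + 1 then False
      else if i < V + 1 + V * V then e ((i - (V + 1)) div V) ((i - (V + 1)) mod V)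
      else if i < V + 1 + V * V + V * V then
        t ((i - (V + 1 + V * V)) div V) ((i - (V + 1 + V * V)) mod V)
      else i - (V + 1 + V * V + V * V) = 0 \<or> i - (V + 1 + V * V + V * V) = 1 \<or>
        i - (V + 1 + V * V + V * V) = 3 \<or> i - (V + 1 + V * V + V * V) = 5 \<or>
        i - (V + 1 + V * V + V * V) = 6)"

lemma instance_bits:
  assumes e: "\<And>u v. u < V \<Longrightarrow> v < V \<Longrightarrow> e u v = ({u, v} \<in> E)"
    and t: "\<And>u v. u < V \<Longrightarrow> v < V \<Longrightarrow> t u v = ({u, v} \<in> F)"
  shows "map (instance_bit V e t) [0..<V + 1 + V * V + V * V + 8] = encode_instance V E F 1 2"
proof -
  let ?f = "instance_bit V e t"
  have uv: "u * V + v < V * V" "(u * V + v) div V = u" "(u * V + v) mod V = v" if "u < V" "v < V" for u v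
    using that mult_le_mono1[of "Suc u" V V] by auto
  have "map ?f [0..<V] = replicate V True"
    by (rule nth_equalityI) (auto simp: instance_bit_def)
  moreover have "map (\<lambda>i. ?f (V + i)) [0..<1] = [False]" by (simp add: instance_bit_def)
  moreover have "map (\<lambda>i. ?f (V + 1 + i)) [0..<V * V] = adjacency_matrix V E"
  proof (rule adjacency_eqI)
    fix u v assume h: "u < V" "v < V"
    show "map (\<lambda>i. ?f (V + 1 + i)) [0..<V * V] ! (u * V + v) = ({u, v} \<in> E)"
      using uv[OF h] e[OF h] by (simp add: instance_bit_def)
  qed simp
  moreover have "map (\<lambda>i. ?f (V + 1 + V * V + i)) [0..<V * V] = adjacency_matrix V F"
  proof (rule adjacency_eqI)
    fix u v assume h: "u < V" "v < V"
    show "map (\<lambda>i. ?f (V + 1 + V * V + i)) [0..<V * V] ! (u * V + v) = ({u, v} \<in> F)"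
      using uv[OF h] t[OF h] by (simp add: instance_bit_def)
  qed simp
  moreover have "map (\<lambda>i. ?f (V + 1 + V * V + V * V + i)) [0..<8] = delimit (binary 1) @ delimit (binary 2)"
  proof -
    have "?f (V + 1 + V * V + V * V + i) = (i = 0 \<or> i = 1 \<or> i = 3 \<or> i = 5 \<or> i = 6)" for i
      by (simp add: instance_bit_def)
    hence "map (\<lambda>i. ?f (V + 1 + V * V + V * V + i)) [0..<8] = map (\<lambda>i. i = 0 \<or> i = 1 \<or> i = 3 \<or> i = 5 \<or> i = 6) [0..<8]"
      by (simp only:)
    also have "\<dots> = [True, True, False, True, False, True, True, False]"
      by (simp add: upt_rec numeral_eq_Suc)
    also have "\<dots> = delimit (binary 1) @ delimit (binary 2)"
      by (simp add: binary.simps delimit_Cons delimit_Nil)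
    finally show ?thesis .
  qed
  ultimately show ?thesis unfolding encode_instance_def map_upt_add by simp
qed

locale reduction =
  fixes M :: tm and cd :: "nat \<Rightarrow> nat \<times> nat list \<times> nat" and D :: nat
    and P q :: "nat poly" and R :: language
  assumes tm: "turing_machine M" and cd: "bij_betw cd {..<D} (tile_values M)"
    and decides: "\<And>w. outputs_within M w (poly q (length w)) [w \<in> R]"
begin

abbreviation "k \<equiv> tapes M"

definition cert :: "bool list \<Rightarrow> nat" where
  "cert x = poly P (length x)"

text \<open>The second summand makes the window contain the whole input together with the
  certificate.\<close>

definition time :: "bool list \<Rightarrow> nat" where
  "time x = poly q (2 * length x + 1 + cert x) + (2 * length x + 1 + cert x)"

text \<open>One group for every time, tape and position; the positions are \<open>0\<close> to
  \<open>2 * W\<close> with \<open>W = 2 * time x\<close>.\<close>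

definition groups :: "bool list \<Rightarrow> nat" where
  "groups x = (time x + 1) * k * (4 * time x + 1)"

definition tiles :: "bool list \<Rightarrow> nat" where
  "tiles x = groups x * D"

text \<open>Tile \<open>u\<close> stands for
  \<open>((t * k + j) * (4 * time x + 1) + i) * D + h\<close>. A tile that is forbidden by itself
  clashes with all others, which expresses a unary constraint by binary ones.\<close>

definition clash :: "bool list \<Rightarrow> nat \<Rightarrow> nat \<Rightarrow> bool" where
  "clash x u v \<longleftrightarrow>
     \<not> tile_ok M cd x (cert x) (time x) (u div D div (4 * time x + 1) div k)
         (u div D div (4 * time x + 1) mod k) (u div D mod (4 * time x + 1)) (u mod D) \<or>
     tile_bad M cd x (time x) (u div D div (4 * time x + 1) div k)
         (u div D div (4 * time x + 1) mod k) (u div D mod (4 * time x + 1)) (u mod D)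
       (v div D div (4 * time x + 1) div k)
         (v div D div (4 * time x + 1) mod k) (v div D mod (4 * time x + 1)) (v mod D)"

definition conf :: "bool list \<Rightarrow> nat \<Rightarrow> nat \<Rightarrow> bool" where
  "conf x u v \<longleftrightarrow> u \<noteq> v \<and> (clash x u v \<or> clash x v u)"

lemma k_pos: "0 < k"
  using tm by (simp add: turing_machine_def)

lemma D_pos: "0 < D"
proof -
  have "(0, replicate k 0, 0) \<in> tile_values M"
    using tm by (auto simp: tile_values_def turing_machine_def)
  hence "{..<D} \<noteq> {}" using cd unfolding bij_betw_def by blast
  thus ?thesis by auto
qed

sublocale T: tiling M cd D x "cert x" "time x" R for x
proof
  show "2 * length x + 1 + cert x \<le> time x" by (simp add: time_def)
  fix y :: "bool list" assume "length y \<le> cert x"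
  hence "poly q (length (pair x y)) \<le> poly q (2 * length x + 1 + cert x)"
    by (intro poly_nat_mono) (simp add: pair_def length_delimit)
  hence "poly q (length (pair x y)) \<le> time x" by (simp add: time_def)
  thus "outputs_within M (pair x y) (time x) [pair x y \<in> R]" using decides outputs_within_mono by blast
qed (rule tm cd)+

sublocale C: conflict "tiles x" "groups x" "conf x" for x
  using D_pos by unfold_locales (auto simp: conf_def tiles_def)

lemma choice_iff_tiling:
  "(\<exists>\<tau>. (\<forall>g<groups x. \<tau> g < tiles x \<and> \<tau> g div D = g) \<and> (\<forall>g<groups x. \<forall>g'<groups x. \<not> conf x (\<tau> g) (\<tau> g')))
    \<longleftrightarrow> (\<exists>H. T.proper_tiling x H)"
proof
  let ?W = "4 * time x + 1"
  assume "\<exists>\<tau>. (\<forall>g<groups x. \<tau> g < tiles x \<and> \<tau> g div D = g) \<and> (\<forall>g<groups x. \<forall>g'<groups x. \<not> conf x (\<tau> g) (\<tau> g'))"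
  then obtain \<tau> where \<tau>: "\<And>g. g < groups x \<Longrightarrow> \<tau> g div D = g"
    and nc: "\<And>g g'. g < groups x \<Longrightarrow> g' < groups x \<Longrightarrow> \<not> conf x (\<tau> g) (\<tau> g')" by blast
  define ix where "ix t j i = (t * k + j) * ?W + i" for t j i
  define H where "H t j i = \<tau> (ix t j i) mod D" for t j i
  have ix: "ix t j i < groups x" "ix t j i div ?W div k = t" "ix t j i div ?W mod k = j" "ix t j i mod ?W = i"
    if "t \<le> time x" "j < k" "i \<le> 2 * (2 * time x)" for t j i
  proof -
    have i: "i < ?W" using that(3) by simp
    have "t * k + j < Suc t * k" using that(2) by simp
    also have "\<dots> \<le> (time x + 1) * k" using that(1) by (intro mult_le_mono1) simp
    finally have tk: "t * k + j < (time x + 1) * k" .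
    have "ix t j i < Suc (t * k + j) * ?W" using i unfolding ix_def by simp
    also have "\<dots> \<le> (time x + 1) * k * ?W" using tk by (intro mult_le_mono1) simp
    finally show "ix t j i < groups x" unfolding groups_def .
    have "ix t j i div ?W = t * k + j" "ix t j i mod ?W = i"
      unfolding ix_def using block_div_mod[OF i, of "t * k + j"] by blast+
    thus "ix t j i div ?W div k = t" "ix t j i div ?W mod k = j" "ix t j i mod ?W = i"
      using block_div_mod[OF that(2), of t] by auto
  qed
  have clash: "\<not> clash x (\<tau> g) (\<tau> g')" if "g < groups x" "g' < groups x" "g \<noteq> g'" for g g'
    using nc[OF that(1,2)] \<tau>[OF that(1)] \<tau>[OF that(2)] that(3) unfolding conf_def by auto
  \<comment> \<open>A forbidden tile is excluded only through its clash with another chosen tile, so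
    there must be a second group.\<close>
  have g2: "1 < groups x"
  proof -
    have "1 \<le> time x" by (simp add: time_def)
    hence "(1 + 1) * 1 * 1 \<le> groups x" unfolding groups_def using k_pos by (intro mult_le_mono) auto
    thus ?thesis by simp
  qed
  have "T.proper_tiling x H"
    unfolding T.proper_tiling_def
  proof (intro conjI allI impI)
    fix t j i assume h: "t \<le> time x" "j < k" "i \<le> 2 * (2 * time x)"
    show "H t j i < D" using D_pos by (simp add: H_def)
    obtain g' where "g' < groups x" "ix t j i \<noteq> g'" using g2 by (metis less_trans zero_less_one zero_neq_one)
    from clash[OF ix(1)[OF h] this] show "tile_ok M cd x (cert x) (time x) t j i (H t j i)"
      unfolding clash_def \<tau>[OF ix(1)[OF h]] ix(2-4)[OF h] H_def by blast
  next
    fix t j i t' j' i' assume h: "t \<le> time x" "j < k" "i \<le> 2 * (2 * time x)"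
      and h': "t' \<le> time x" "j' < k" "i' \<le> 2 * (2 * time x)" and ne: "(t, j, i) \<noteq> (t', j', i')"
    have "ix t j i \<noteq> ix t' j' i'" using ix(2-4)[OF h] ix(2-4)[OF h'] ne by auto
    from clash[OF ix(1)[OF h] ix(1)[OF h'] this]
    show "\<not> tile_bad M cd x (time x) t j i (H t j i) t' j' i' (H t' j' i')"
      unfolding clash_def \<tau>[OF ix(1)[OF h]] \<tau>[OF ix(1)[OF h']] ix(2-4)[OF h] ix(2-4)[OF h'] H_def by blast
  qed
  thus "\<exists>H. T.proper_tiling x H" by blast
next
  let ?W = "4 * time x + 1"
  assume "\<exists>H. T.proper_tiling x H"
  then obtain H where H: "T.proper_tiling x H" by blast
  define \<tau> where "\<tau> g = g * D + H (g div ?W div k) (g div ?W mod k) (g mod ?W)" for g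
  have dec: "g div ?W div k \<le> time x" "g div ?W mod k < k" "g mod ?W \<le> 2 * (2 * time x)" if "g < groups x" for g
  proof -
    have "g div ?W < (time x + 1) * k" using that unfolding groups_def by (rule less_mult_imp_div_less)
    hence "g div ?W div k < time x + 1" by (rule less_mult_imp_div_less)
    thus "g div ?W div k \<le> time x" by simp
    show "g div ?W mod k < k" using k_pos by simp
    have "g mod ?W < ?W" by (rule mod_less_divisor) simp
    thus "g mod ?W \<le> 2 * (2 * time x)" by simp
  qed
  have okH: "tile_ok M cd x (cert x) (time x) t j i (H t j i)"
    if "t \<le> time x" "j < k" "i \<le> 2 * (2 * time x)" for t j i
    using H that unfolding T.proper_tiling_def by blast
  have nbH: "\<not> tile_bad M cd x (time x) t j i (H t j i) t' j' i' (H t' j' i')"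
    if "t \<le> time x" "j < k" "i \<le> 2 * (2 * time x)" "t' \<le> time x" "j' < k" "i' \<le> 2 * (2 * time x)"
      "(t, j, i) \<noteq> (t', j', i')" for t j i t' j' i'
    using H that unfolding T.proper_tiling_def by blast
  have HD: "H (g div ?W div k) (g div ?W mod k) (g mod ?W) < D" if "g < groups x" for g
    using H dec[OF that] unfolding T.proper_tiling_def by blast
  have \<tau>: "\<tau> g div D = g" "\<tau> g mod D = H (g div ?W div k) (g div ?W mod k) (g mod ?W)" if "g < groups x" for g
    unfolding \<tau>_def using block_div_mod[OF HD[OF that], of g] by blast+
  have "\<tau> g < tiles x" if "g < groups x" for g
  proof -
    have "Suc g * D \<le> groups x * D" using that by (intro mult_le_mono1) simp
    thus ?thesis using HD[OF that] by (simp add: \<tau>_def tiles_def)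
  qed
  moreover have "\<not> conf x (\<tau> g) (\<tau> g')" if g: "g < groups x" "g' < groups x" for g g'
  proof (cases "g = g'")
    case False
    have ne: "(g div ?W div k, g div ?W mod k, g mod ?W) \<noteq> (g' div ?W div k, g' div ?W mod k, g' mod ?W)"
    proof
      assume "(g div ?W div k, g div ?W mod k, g mod ?W) = (g' div ?W div k, g' div ?W mod k, g' mod ?W)"
      hence e: "g div ?W div k = g' div ?W div k" "g div ?W mod k = g' div ?W mod k" "g mod ?W = g' mod ?W"
        by blast+
      have "g div ?W = g' div ?W" by (rule div_mod_eqI[OF e(1,2)])
      hence "g = g'" by (rule div_mod_eqI[OF _ e(3)])
      thus False using False by simp
    qed
    have "\<not> clash x (\<tau> g) (\<tau> g')"
      unfolding clash_def \<tau>[OF g(1)] \<tau>[OF g(2)]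
      using okH[OF dec[OF g(1)]] nbH[OF dec[OF g(1)] dec[OF g(2)] ne] by simp
    moreover have "\<not> clash x (\<tau> g') (\<tau> g)"
      unfolding clash_def \<tau>[OF g(1)] \<tau>[OF g(2)]
      using okH[OF dec[OF g(2)]] nbH[OF dec[OF g(2)] dec[OF g(1)] ne[symmetric]] by simp
    ultimately show ?thesis by (simp add: conf_def)
  qed (simp add: conf_def)
  ultimately show "\<exists>\<tau>. (\<forall>g<groups x. \<tau> g < tiles x \<and> \<tau> g div D = g) \<and>
      (\<forall>g<groups x. \<forall>g'<groups x. \<not> conf x (\<tau> g) (\<tau> g'))"
    using \<tau>(1) by (intro exI[of _ \<tau>]) blast
qed

definition order :: "bool list \<Rightarrow> nat" where
  "order x = 2 * Suc (tiles x) * (2 * half (tiles x))"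

definition weights :: "bool list \<Rightarrow> nat \<Rightarrow> nat \<Rightarrow> nat" where
  "weights x = conf_weight (tiles x) (groups x) (conf x)"

definition reduce :: "bool list \<Rightarrow> bool list" where
  "reduce x = map (instance_bit (order x) (blob_adj (Suc (tiles x)) (2 * half (tiles x)) (weights x))
       (comb_adj (Suc (tiles x)) (2 * half (tiles x)))) [0..<order x + 1 + order x * order x + order x * order x + 8]"

lemma reduce_correct:
  "reduce x \<in> ThinTreeValid \<longleftrightarrow> \<not> (\<exists>y. length y \<le> cert x \<and> pair x y \<in> R)"
proof -
  let ?E = "edges (order x) (blob_adj (Suc (tiles x)) (2 * half (tiles x)) (weights x))"
  let ?T = "edges (order x) (comb_adj (Suc (tiles x)) (2 * half (tiles x)))"
  have enc: "reduce x = encode_instance (order x) ?E ?T 1 2"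
    unfolding reduce_def
  proof (rule instance_bits)
    fix u v assume "u < order x" "v < order x"
    moreover have "{u, v} \<in> ?E \<longleftrightarrow> u < order x \<and> v < order x \<and>
        blob_adj (Suc (tiles x)) (2 * half (tiles x)) (weights x) u v"
      by (rule edges_mem) (unfold weights_def, erule iffD1[OF C.blob_sym])
    ultimately show "blob_adj (Suc (tiles x)) (2 * half (tiles x)) (weights x) u v = ({u, v} \<in> ?E)" by blast
  next
    fix u v assume "u < order x" "v < order x"
    moreover have "{u, v} \<in> ?T \<longleftrightarrow> u < order x \<and> v < order x \<and>
        comb_adj (Suc (tiles x)) (2 * half (tiles x)) u v"
      by (rule edges_mem) (erule iffD1[OF C.comb_sym])
    ultimately show "comb_adj (Suc (tiles x)) (2 * half (tiles x)) u v = ({u, v} \<in> ?T)" by blast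
  qed
  have g: "simple_graph {..<order x} ?E" using C.simple[of x] by (simp only: order_def weights_def)
  have st: "spanning_tree {..<order x} ?E ?T" using C.spanning[of x] by (simp only: order_def weights_def)
  have "reduce x \<in> ThinTreeValid \<longleftrightarrow> thin {..<order x} ?E ?T (real 1 / real 2)"
  proof
    assume "reduce x \<in> ThinTreeValid"
    then obtain n E F a b where h: "reduce x = encode_instance n E F a b" "simple_graph {..<n} E"
      "spanning_tree {..<n} E F" "thin {..<n} E F (real a / real b)"
      unfolding ThinTreeValid_def by blast
    \<comment> \<open>Injectivity of the encoding identifies the instance found in the language with
      the constructed one.\<close>
    have "order x = n \<and> ?E = E \<and> ?T = F \<and> 1 = a \<and> 2 = b"
    proof (rule encode_instance_inj_graph)
      show "encode_instance (order x) ?E ?T 1 2 = encode_instance n E F a b" using enc h(1) by simp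
      show "\<forall>e\<in>?E. e \<subseteq> {..<order x} \<and> card e = 2" using g by (simp add: simple_graph_def)
      show "\<forall>e\<in>E. e \<subseteq> {..<n} \<and> card e = 2" using h(2) by (simp add: simple_graph_def)
      show "?T \<subseteq> ?E" using st by (simp add: spanning_tree_def)
      show "F \<subseteq> E" using h(3) by (simp add: spanning_tree_def)
    qed
    thus "thin {..<order x} ?E ?T (real 1 / real 2)" using h(4) by blast
  next
    assume "thin {..<order x} ?E ?T (real 1 / real 2)"
    moreover have "real 1 / real 2 \<in> {0..1}" by simp
    ultimately show "reduce x \<in> ThinTreeValid"
      unfolding ThinTreeValid_def using enc g st by (metis (mono_tags, lifting) mem_Collect_eq zero_less_numeral)
  qed
  moreover have "\<not> thin {..<order x} ?E ?T (real 1 / real 2) \<longleftrightarrow> (\<exists>H. T.proper_tiling x H)"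
    unfolding choice_iff_tiling[symmetric] order_def weights_def
  proof (rule C.not_thin_iff_choice)
    fix v assume "v < tiles x"
    thus "v div D < groups x" unfolding tiles_def by (rule less_mult_imp_div_less)
  next
    fix u v assume "u \<noteq> v" "u div D = v div D"
    thus "conf x u v" by (simp add: conf_def clash_def tile_bad_def)
  qed
  moreover have "(\<exists>H. T.proper_tiling x H) \<longleftrightarrow> (\<exists>y. length y \<le> cert x \<and> pair x y \<in> R)"
    using T.tiling_of_run T.run_of_tiling by blast
  ultimately show ?thesis by blast
qed

section \<open>The reduction runs in polynomial time\<close>

lemma pc_cert: "PC vs (\<lambda>x e. cert x)"
  unfolding cert_def by (intro PC_poly PC_length)

lemma pc_time: "PC vs (\<lambda>x e. time x)"
  unfolding time_def by (intro pc_rules PC_poly pc_cert)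

lemma pc_groups: "PC vs (\<lambda>x e. groups x)"
  unfolding groups_def by (intro pc_rules pc_time)

lemma pc_tiles: "PC vs (\<lambda>x e. tiles x)"
  unfolding tiles_def by (intro pc_rules pc_groups)

lemma pc_half: "PC vs f \<Longrightarrow> PC vs (\<lambda>x e. half (f x e))"
  unfolding half_def by (intro pc_rules)

lemma pc_order: "PC vs (\<lambda>x e. order x)"
  unfolding order_def by (intro pc_rules pc_tiles pc_half)

text \<open>\<open>D\<close> and the tables depend on the machine only; the remainder supplies the
  bound on the argument that \<open>PC_table\<close> needs.\<close>

lemma pc_table_value: assumes "PC vs f" shows "PC vs (\<lambda>x e. h (f x e mod D))"
  by (rule PC_table[where K = D]) (intro PC_mod PC_const assms, simp add: D_pos)

lemma pc_table_tape: assumes "PC vs f" "PC vs g" shows "PC vs (\<lambda>x e. h (f x e mod D) (g x e mod k))"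
  by (rule PC_table2[where K = D and L = k]) (intro PC_mod PC_const assms, intro PC_mod PC_const assms, simp_all add: D_pos k_pos)

lemmas pc_tables = pc_table_value[where h = "tq cd"] pc_table_value[where h = "ta cd"]
  pc_table_value[where h = "tnext M cd"] pc_table_value[where h = "tglobal cd"]
  pc_table_tape[where h = "tss cd"] pc_table_tape[where h = "twr M cd"] pc_table_tape[where h = "tmv M cd"]

lemma pd_clash: "PD [fst, snd] (\<lambda>x p. clash x (fst p) (snd p))"
  unfolding clash_def tile_ok_def tile_bad_def initial_symbol_def
  by (intro pc_rules PD_If pc_tables pc_time pc_cert; (rule PC_var, simp; fail)?)

lemma pd_conf: "PD [fst, snd] (\<lambda>x p. conf x (fst p) (snd p))"
  unfolding conf_def by (intro pc_rules PD_comp2[OF pd_clash]; (rule PC_var, simp; fail)?)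

lemma pc_cdeg: "PC [\<lambda>u. u] (\<lambda>x v. cdeg (tiles x) (conf x) v)"
  unfolding cdeg_def by (intro pc_rules pc_tiles PD_comp2[OF pd_conf]; (rule PC_var, simp; fail)?)

lemma pc_weights: "PC [fst, snd] (\<lambda>x p. weights x (fst p) (snd p))"
  unfolding weights_def conf_weight_def base_weight_def
  by (intro pc_rules pc_tiles pc_groups pc_half PC_comp1[OF pc_cdeg] PD_comp2[OF pd_conf];
      (rule PC_var, simp; fail)?)

lemma pd_comb: "PD [fst, snd] (\<lambda>x p. comb_adj (Suc (tiles x)) (2 * half (tiles x)) (fst p) (snd p))"
  unfolding comb_adj_def tree_step_def
  by (intro pc_rules pc_tiles pc_half; (rule PC_var, simp; fail)?)

lemma pd_blob: "PD [fst, snd] (\<lambda>x p. blob_adj (Suc (tiles x)) (2 * half (tiles x)) (weights x) (fst p) (snd p))"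
  unfolding blob_adj_def cross_step_def
  by (intro pc_rules pd_comb pc_tiles pc_half PC_comp2[OF pc_weights]; (rule PC_var, simp; fail)?)

lemma reduce_polytime: "polytime_computable reduce"
proof -
  have "PD [\<lambda>u. u] (\<lambda>x i. instance_bit (order x) (blob_adj (Suc (tiles x)) (2 * half (tiles x)) (weights x))
       (comb_adj (Suc (tiles x)) (2 * half (tiles x))) i)"
    unfolding instance_bit_def
    by (intro pc_rules PD_If pc_order PD_comp2[OF pd_blob] PD_comp2[OF pd_comb]; (rule PC_var, simp; fail)?)
  moreover have "PC [] (\<lambda>x (_::unit). order x + 1 + order x * order x + order x * order x + 8)"
    by (intro pc_rules pc_order)
  ultimately show ?thesis
    unfolding reduce_def[abs_def] by (intro polytime_computable_bits)
qed

end

theorem theorem1: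
  shows "coNP_complete ThinTreeValid"
  unfolding coNP_complete_def
proof (intro conjI ballI)
  show "ThinTreeValid \<in> coNP" by (rule ThinTreeValid_coNP)
  fix L assume "L \<in> coNP"
  then obtain R P where R: "R \<in> PTIME"
    and L: "\<And>x. x \<in> - L \<longleftrightarrow> (\<exists>y. length y \<le> poly P (length x) \<and> pair x y \<in> R)"
    unfolding coNP_def NP_def by blast
  obtain M q where M: "turing_machine M" "\<And>w. outputs_within M w (poly q (length w)) [w \<in> R]"
    using R unfolding PTIME_def polytime_computable_def by blast
  \<comment> \<open>The set of tile values depends only on the machine, so an enumeration of it can
    be built into the reduction.\<close>
  obtain cd where "bij_betw cd {0..<card (tile_values M)} (tile_values M)"
    using ex_bij_betw_nat_finite[OF finite_tile_values] by blast
  hence "bij_betw cd {..<card (tile_values M)} (tile_values M)" by (simp add: atLeast0LessThan)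
  then interpret reduction M cd "card (tile_values M)" P q R
    using M by unfold_locales
  have "x \<in> L \<longleftrightarrow> reduce x \<in> ThinTreeValid" for x
    unfolding reduce_correct cert_def using L[of x] by blast
  thus "polytime_reducible L ThinTreeValid"
    unfolding polytime_reducible_def using reduce_polytime by blast
qed

end
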